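(* Let $n\ge 2$, let $\Gamma_n=GZZ(n,2)$ (a graph with $2n+6$ edges), let $X_n\subset\mathbb{P}^{2n+5}$ be its graph hypersurface, defined by the graph polynomial $\Psi_{\Gamma_n}$, and let $$\eta_n=\frac{\Omega_{2n+5}}{\Psi_{\Gamma_n}^2}\in\Gamma\big(\mathbb{P}^{2n+5},\omega(2X_n)\big).$$ Then the de Rham class $[\eta_n]\in H^{2n+5}_{DR}(\mathbb{P}^{2n+5}\setminus X_n)$ is nonzero.
   Context: Work over an algebraically closed field $K$ of characteristic $0$. The graph $GZZ(n,2)$: vertices $u_1,u_2,u_3,u_4$, $v_{1,1},\dots,v_{1,n-1}$, $v_{2,1}$; edges $(u_1,u_2),(u_2,u_3),(u_3,u_4)$; the $n$ edges of the path $u_1,v_{1,1},\dots,v_{1,n-1},u_3$; the edges $(v_{1,j},u_2)$ for $1\le j\le n-1$; the two edges of the path $u_2,v_{2,1},u_4$; the edge $(v_{2,1},u_3)$; and the edge $(u_1,u_4)$. For a finite connected graph $\Gamma$ with $N$ edges, the graph polynomial is $\Psi_\Gamma=\sum_T\prod_{e\notin T}A_e$ (sum over spanning trees $T$), of degree $h_1(\Gamma)=\mathrm{rank}\,H_1(\Gamma,\mathbb{Z})$, and the graph hypersurface is $\{\Psi_\Gamma=0\}\subset\mathbb{P}^{N-1}$. Here $N=2n+6=2h_1(\Gamma_n)$. On $\mathbb{P}^{N-1}$ with homogeneous coordinates $A_1,\dots,A_N$, $\Omega_{N-1}=\sum_{i=1}^{N}(-1)^iA_i\,dA_1\wedge\dots\wedge\widehat{dA_i}\wedge\dots\wedge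 dA_N$. *)

theory Defs
  imports
    "HOL-Library.Poly_Mapping"
    "HOL-Computational_Algebra.Fraction_Field"
    "HOL-Computational_Algebra.Polynomial"
begin

section \<open>Graphs and graph polynomials\<close>

text \<open>
  Undirected multigraphs: \<open>mends G e\<close> is the set of endpoints of the edge \<open>e\<close>
  (a singleton for a loop).
\<close>

record ('v, 'e) multigraph =
  mverts :: "'v set"
  medges :: "'e set"
  mends :: "'e \<Rightarrow> 'v set"

definition connected_by :: "('v, 'e) multigraph \<Rightarrow> 'e set \<Rightarrow> bool" where
  "connected_by G T \<longleftrightarrow> mverts G \<noteq> {} \<and>
     (\<forall>x\<in>mverts G. \<forall>y\<in>mverts G. (\<lambda>a b. \<exists>e\<in>T. mends G e = {a, b})\<^sup>*\<^sup>* x y)"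

text \<open>Circuits of length 1 are loops, circuits of length 2 are pairs of parallel edges.\<close>

definition is_circuit :: "('v, 'e) multigraph \<Rightarrow> 'v list \<Rightarrow> 'e list \<Rightarrow> bool" where
  "is_circuit G vs es \<longleftrightarrow> es \<noteq> [] \<and> length vs = length es \<and> distinct vs \<and> distinct es \<and>
     (\<forall>i<length es. mends G (es ! i) = {vs ! i, vs ! (Suc i mod length es)})"

definition spanning_tree :: "('v, 'e) multigraph \<Rightarrow> 'e set \<Rightarrow> bool" where
  "spanning_tree G T \<longleftrightarrow> T \<subseteq> medges G \<and> connected_by G T \<and>
     \<not> (\<exists>vs es. set es \<subseteq> T \<and> is_circuit G vs es)"

text \<open>
  Polynomials in variables \<open>A\<^sub>i\<close> indexed by natural numbers: finitely supported maps from
  exponent vectors to coefficients.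
\<close>

type_synonym 'k mpoly = "(nat \<Rightarrow>\<^sub>0 nat) \<Rightarrow>\<^sub>0 'k"
type_synonym 'k ratfun = "'k mpoly fract"

definition mvar :: "nat \<Rightarrow> 'k::field mpoly" where
  "mvar i = Poly_Mapping.single (Poly_Mapping.single i 1) 1"

definition graph_poly :: "('v, nat) multigraph \<Rightarrow> 'k::field mpoly" where
  "graph_poly G = (\<Sum>T | spanning_tree G T. \<Prod>e\<in>medges G - T. mvar e)"

subsection \<open>The graphs GZZ(n,2)\<close>

datatype gzz_vertex = UVert nat | VVert nat nat

definition path_edges :: "'v list \<Rightarrow> 'v set list" where
  "path_edges xs = map2 (\<lambda>x y. {x, y}) xs (tl xs)"

definition gzz2_edges :: "nat \<Rightarrow> gzz_vertex set list" where
  "gzz2_edges n =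
     [{UVert 1, UVert 2}, {UVert 2, UVert 3}, {UVert 3, UVert 4}]
     @ path_edges ([UVert 1] @ map (VVert 1) [1..<n] @ [UVert 3])
     @ map (\<lambda>j. {VVert 1 j, UVert 2}) [1..<n]
     @ path_edges [UVert 2, VVert 2 1, UVert 4]
     @ [{VVert 2 1, UVert 3}]
     @ [{UVert 1, UVert 4}]"

lemma length_gzz2_edges: "n \<ge> 1 \<Longrightarrow> length (gzz2_edges n) = 2 * n + 6"
  by (simp add: gzz2_edges_def path_edges_def)

text \<open>The edges are numbered \<open>1, \<dots>, 2n + 6\<close>, in the order of the above list.\<close>

definition gzz2 :: "nat \<Rightarrow> (gzz_vertex, nat) multigraph" where
  "gzz2 n = \<lparr> mverts = UVert ` {1..4} \<union> VVert 1 ` {1..n - 1} \<union> {VVert 2 1},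
              medges = {1..2 * n + 6},
              mends = (\<lambda>i. gzz2_edges n ! (i - 1)) \<rparr>"

section \<open>Partial derivatives of rational functions\<close>

definition pderiv_mpoly :: "nat \<Rightarrow> 'k::field mpoly \<Rightarrow> 'k mpoly" where
  "pderiv_mpoly j p = (\<Sum>m\<in>Poly_Mapping.keys p. Poly_Mapping.single (m - Poly_Mapping.single j 1)
      (of_nat (Poly_Mapping.lookup m j) * Poly_Mapping.lookup p m))"

lemma pderiv_mpoly_superset:
  assumes "finite S" "Poly_Mapping.keys p \<subseteq> S"
  shows "pderiv_mpoly j p = (\<Sum>m\<in>S. Poly_Mapping.single (m - Poly_Mapping.single j 1)
      (of_nat (Poly_Mapping.lookup m j) * Poly_Mapping.lookup p m))"
  unfolding pderiv_mpoly_def using assms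
  by (intro sum.mono_neutral_left) (auto simp: in_keys_iff)

lemma pderiv_mpoly_add: "pderiv_mpoly j (p + q) = pderiv_mpoly j p + pderiv_mpoly j q"
proof -
  let ?S = "Poly_Mapping.keys p \<union> Poly_Mapping.keys q"
  have "Poly_Mapping.keys (p + q) \<subseteq> ?S" by (rule Poly_Mapping.keys_add)
  then show ?thesis
    by (simp add: pderiv_mpoly_superset[of ?S] lookup_add distrib_left single_add sum.distrib)
qed

lemma pderiv_mpoly_0 [simp]: "pderiv_mpoly j 0 = 0"
  by (simp add: pderiv_mpoly_def)

lemma pderiv_mpoly_sum: "pderiv_mpoly j (sum f S) = (\<Sum>x\<in>S. pderiv_mpoly j (f x))"
  by (induction S rule: infinite_finite_induct) (simp_all add: pderiv_mpoly_add)

lemma pderiv_mpoly_single: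
  "pderiv_mpoly j (Poly_Mapping.single m c) =
     Poly_Mapping.single (m - Poly_Mapping.single j 1) (of_nat (Poly_Mapping.lookup m j) * c)"
  by (subst pderiv_mpoly_superset[of "{m}"]) auto

lemma mpoly_eq_sum_single:
  "p = (\<Sum>m\<in>Poly_Mapping.keys p. Poly_Mapping.single m (Poly_Mapping.lookup p m))"
  by (rule poly_mapping_eqI)
    (auto simp: lookup_sum lookup_single when_def in_keys_iff)

lemma single_shift:
  fixes c :: "'k::field"
  shows "Poly_Mapping.single ((m - Poly_Mapping.single j 1) + m') (of_nat (Poly_Mapping.lookup m j) * c)
       = Poly_Mapping.single (m + m' - Poly_Mapping.single j 1) (of_nat (Poly_Mapping.lookup m j) * c)"
proof (cases "Poly_Mapping.lookup m j = 0")
  case False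
  then have "(m - Poly_Mapping.single j 1) + m' = m + m' - Poly_Mapping.single j 1"
    by (intro poly_mapping_eqI) (auto simp: lookup_add lookup_minus lookup_single when_def)
  then show ?thesis by simp
qed simp

lemma pderiv_mpoly_mult_single:
  "pderiv_mpoly j (Poly_Mapping.single m c * Poly_Mapping.single m' c') =
     pderiv_mpoly j (Poly_Mapping.single m c) * Poly_Mapping.single m' c' +
     Poly_Mapping.single m c * pderiv_mpoly j (Poly_Mapping.single m' c')"
  using single_shift[of m j m' "c * c'"] single_shift[of m' j m "c * c'"]
  by (simp add: mult_single pderiv_mpoly_single lookup_add distrib_left distrib_right ac_simps flip: single_add)

lemma pderiv_mpoly_mult:
  "pderiv_mpoly j (p * q) = pderiv_mpoly j p * q + p * pderiv_mpoly j q"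
proof -
  define s where "s p m = Poly_Mapping.single m (Poly_Mapping.lookup p m)" for p :: "'a mpoly" and m
  have s: "r = (\<Sum>m\<in>Poly_Mapping.keys r. s r m)" for r :: "'a mpoly"
    unfolding s_def by (rule mpoly_eq_sum_single)
  have "pderiv_mpoly j ((\<Sum>a\<in>A. s p a) * (\<Sum>b\<in>B. s q b)) =
     pderiv_mpoly j (\<Sum>a\<in>A. s p a) * (\<Sum>b\<in>B. s q b) +
     (\<Sum>a\<in>A. s p a) * pderiv_mpoly j (\<Sum>b\<in>B. s q b)" for A B
    unfolding s_def
    by (simp add: sum_product pderiv_mpoly_sum pderiv_mpoly_mult_single sum.distrib)
  from this[of "Poly_Mapping.keys p" "Poly_Mapping.keys q"] show ?thesis
    by (simp flip: s)
qed

lemma quotient_rule_respects: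
  fixes p q p' q' dp dq dp' dq' :: "'a::idom"
  assumes "p * q' = p' * q" "dp * q' + p * dq' = dp' * q + p' * dq"
  shows "(dp * q - p * dq) * (q' * q') = (dp' * q' - p' * dq') * (q * q)"
  using assms by algebra

text \<open>The quotient rule; by \<open>pderiv_rat_Fract\<close> below it does not depend on the fraction chosen.\<close>

definition pderiv_rat :: "nat \<Rightarrow> 'k::field ratfun \<Rightarrow> 'k ratfun" where
  "pderiv_rat j r = (THE s. \<exists>p q. q \<noteq> 0 \<and> r = Fraction_Field.Fract p q \<and>
     s = Fraction_Field.Fract (pderiv_mpoly j p * q - p * pderiv_mpoly j q) (q * q))"

lemma pderiv_rat_Fract:
  assumes "q \<noteq> 0"
  shows "pderiv_rat j (Fraction_Field.Fract p q) =
     Fraction_Field.Fract (pderiv_mpoly j p * q - p * pderiv_mpoly j q) (q * q)"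
  unfolding pderiv_rat_def
proof (rule the_equality)
  fix s
  assume "\<exists>p' q'. q' \<noteq> 0 \<and> Fraction_Field.Fract p q = Fraction_Field.Fract p' q' \<and>
    s = Fraction_Field.Fract (pderiv_mpoly j p' * q' - p' * pderiv_mpoly j q') (q' * q')"
  then obtain p' q' where nz: "q' \<noteq> 0"
    and "Fraction_Field.Fract p q = Fraction_Field.Fract p' q'"
    and s: "s = Fraction_Field.Fract (pderiv_mpoly j p' * q' - p' * pderiv_mpoly j q') (q' * q')"
    by blast
  then have eq: "p * q' = p' * q"
    using eq_fract(1)[OF assms nz] by blast
  have "pderiv_mpoly j p * q' + p * pderiv_mpoly j q' =
      pderiv_mpoly j p' * q + p' * pderiv_mpoly j q"
    unfolding pderiv_mpoly_mult[symmetric] eq ..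
  note r = quotient_rule_respects[OF eq this]
  have "q * q \<noteq> 0" "q' * q' \<noteq> 0"
    using assms nz no_zero_divisors by blast+
  from eq_fract(1)[OF this] r
  show "s = Fraction_Field.Fract (pderiv_mpoly j p * q - p * pderiv_mpoly j q) (q * q)"
    unfolding s by metis
qed (use assms in blast)

section \<open>Algebraic de Rham cohomology of projective hypersurface complements\<close>

text \<open>
  A differential form in the coordinates \<open>A\<^sub>i\<close> with rational coefficients is represented by
  its coefficient function \<open>\<omega>\<close>: for \<open>I = {i\<^sub>1 < \<dots> < i\<^sub>p}\<close> the value \<open>\<omega> I\<close> is the coefficient
  of \<open>dA\<^bsub>i\<^sub>1\<^esub> \<and> \<dots> \<and> dA\<^bsub>i\<^sub>p\<^esub>\<close>.
\<close>

type_synonym 'k dform = "nat set \<Rightarrow> 'k ratfun"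

definition ext_deriv :: "'k::field dform \<Rightarrow> 'k dform" where
  "ext_deriv \<omega> = (\<lambda>J. \<Sum>j\<in>J. (- 1) ^ card {i\<in>J. i < j} * pderiv_rat j (\<omega> (J - {j})))"

text \<open>Contraction with the Euler vector field \<open>\<Sum>\<^sub>j A\<^sub>j \<partial>/\<partial>A\<^sub>j\<close>.\<close>

definition euler_contract :: "nat \<Rightarrow> 'k::field dform \<Rightarrow> 'k dform" where
  "euler_contract N \<omega> = (\<lambda>I. \<Sum>j\<in>{1..N} - I.
     (- 1) ^ card {i\<in>I. i < j} * Fraction_Field.Fract (mvar j) 1 * \<omega> (insert j I))"

definition homogeneous :: "nat \<Rightarrow> nat \<Rightarrow> 'k::field mpoly \<Rightarrow> bool" where
  "homogeneous N d P \<longleftrightarrow> (\<forall>m\<in>Poly_Mapping.keys P. Poly_Mapping.keys m \<subseteq> {1..N} \<and>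
     (\<Sum>i\<in>Poly_Mapping.keys m. Poly_Mapping.lookup m i) = d)"

text \<open>The homogeneous elements of degree \<open>e\<close> of \<open>K[A\<^sub>1, \<dots>, A\<^sub>N][1/F]\<close>, for \<open>F \<noteq> 0\<close> homogeneous.\<close>

definition localization_part :: "nat \<Rightarrow> 'k::field mpoly \<Rightarrow> int \<Rightarrow> 'k ratfun set" where
  "localization_part N F e = {r. \<exists>P k d h. homogeneous N h F \<and> homogeneous N d P \<and>
     int d - int k * int h = e \<and> r = Fraction_Field.Fract P (F ^ k)}"

text \<open>
  The regular \<open>p\<close>-forms on \<open>{F \<noteq> 0} \<subseteq> P\<^bsup>N-1\<^esup>\<close>, in homogeneous coordinates.  By the Euler sequence,
  \<open>\<Omega>\<^sup>p\<close> on \<open>P\<^bsup>N-1\<^esup>\<close> is the kernel of the contraction with the Euler vector field on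
  \<open>\<Oplus>\<^sub>I O(-p) dA\<^sub>I\<close>, where \<open>I\<close> ranges over the \<open>p\<close>-element subsets of \<open>{1..N}\<close>.  So the coefficients
  have degree \<open>-p\<close> and their denominators are powers of \<open>F\<close>.
\<close>

definition compl_forms :: "nat \<Rightarrow> 'k::field mpoly \<Rightarrow> nat \<Rightarrow> 'k dform set" where
  "compl_forms N F p = {\<omega>.
     (\<forall>I. I \<subseteq> {1..N} \<and> card I = p \<longrightarrow> \<omega> I \<in> localization_part N F (- int p)) \<and>
     (\<forall>I. \<not> (I \<subseteq> {1..N} \<and> card I = p) \<longrightarrow> \<omega> I = 0) \<and>
     euler_contract N \<omega> = (\<lambda>_. 0)}"

text \<open>
  The complement of a hypersurface in projective space is affine and smooth, so its de Rham
  cohomology is the cohomology of the complex of global regular forms.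
\<close>

definition closed_forms :: "nat \<Rightarrow> 'k::field mpoly \<Rightarrow> nat \<Rightarrow> 'k dform set" where
  "closed_forms N F p = {\<omega> \<in> compl_forms N F p. ext_deriv \<omega> = (\<lambda>_. 0)}"

definition exact_forms :: "nat \<Rightarrow> 'k::field mpoly \<Rightarrow> nat \<Rightarrow> 'k dform set" where
  "exact_forms N F p =
     (case p of 0 \<Rightarrow> {\<lambda>_. 0} | Suc q \<Rightarrow> ext_deriv ` compl_forms N F q)"

text \<open>The class of a closed form in \<open>H\<^sup>p\<^sub>D\<^sub>R\<close>, as a coset of the space of exact forms.\<close>

definition deRham_class :: "nat \<Rightarrow> 'k::field mpoly \<Rightarrow> nat \<Rightarrow> 'k dform \<Rightarrow> 'k dform set" where
  "deRham_class N F p \<omega> = {\<omega>' \<in> closed_forms N F p. (\<lambda>I. \<omega>' I - \<omega> I) \<in> exact_forms N F p}"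

text \<open>\<open>proj_volume N\<close> is the form \<open>\<Omega>\<^bsub>N-1\<^esub> = \<Sum>\<^sub>i (-1)\<^sup>i A\<^sub>i dA\<^sub>1 \<and> \<dots> (omit dA\<^sub>i) \<dots> \<and> dA\<^sub>N\<close>.\<close>

definition proj_volume :: "nat \<Rightarrow> 'k::field dform" where
  "proj_volume N = (\<lambda>I. \<Sum>i\<in>{1..N}.
     if I = {1..N} - {i} then (- 1) ^ i * Fraction_Field.Fract (mvar i) 1 else 0)"

end

theory Submission
  imports Defs "HOL-Library.Product_Plus"
begin

text \<open>
  Exactness of \<open>\<eta>\<close> would make \<open>A\<^sub>i / \<Psi>\<^sup>2\<close> a sum of derivatives \<open>\<partial>\<^sub>j g\<^sub>j\<close> with \<open>j \<noteq> i\<close> and \<open>g\<^sub>j\<close> having a power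
  of \<open>\<Psi>\<close> as denominator.  We exclude this by an algebraic period: a linear functional on such fractions
  that kills all these derivatives but not \<open>A\<^sub>i / \<Psi>\<^sup>2\<close>.

  Let two adjacent vertices of degree 3 lie on a triangle with edge variables \<open>x\<close>, \<open>y\<close>, \<open>t\<close> (where \<open>t\<close> joins
  them), and let \<open>s\<close>, \<open>e\<close> be the outer edges at these vertices.  The star-triangle relation says that, with
  \<open>Y = x + y + t\<close>, the graph polynomial is \<open>Y\<close> times the polynomial of the graph in which the two vertices are
  merged to one vertex of degree 3, evaluated at \<open>x y / Y\<close>, \<open>s + y t / Y\<close>, \<open>e + x t / Y\<close>.  In these
  coordinates together with \<open>Y\<close> and \<open>X = y\<close> the volume form divided by \<open>\<Psi>\<^sup>2\<close> is the one of the smaller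
  graph times \<open>(dY / Y) (dX / X)\<close>, so taking residues in \<open>Y\<close> and \<open>X\<close> lifts a functional from the smaller
  graph.  Applied \<open>n - 1\<close> times this reduces \<open>GZZ(n,2)\<close> to the wheel with four spokes, and once more to \<open>K\<^sub>4\<close>.
  There \<open>\<Psi>\<close> is the determinant of the generic symmetric \<open>3 \<times> 3\<close> matrix, and by the Capelli identity the
  apolar pairing with powers of the dual determinant, suitably normalised, is a functional as required.
\<close>

section \<open>Spanning trees\<close>

text \<open>The periods carried through the reduction are affine. Each graph in it has twice as many
  edges as the degree of its polynomial F, so dA / F^2 in all variables has degree 0; the functional
  is nonzero at 1 / F^2 and kills the derivatives in every variable, a property that the double
  residue preserves. The projective form behaves differently: its component without dA_y is A_y /
  F^2 up to sign, and exactness yields only derivatives in the other variables. The passage between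
  the two is made in the move that ends at the full graph. There X = A_y is a constant for every
  derivation except the one in A_y, so any Laurent coefficient in X is compatible with them, and
  taking that of X^1 instead of X^0 sends A_y / F^2 to the old value at 1 / F^2. Residues are
  coefficients of Laurent polynomials and the value on K4 is a finite sum over monomials, so no
  cycle has to be exhibited.\<close>

definition gconn :: "('e \<Rightarrow> 'v set) \<Rightarrow> 'e set \<Rightarrow> 'v \<Rightarrow> 'v \<Rightarrow> bool" where
  "gconn ends T = (\<lambda>a b. \<exists>e\<in>T. ends e = {a, b})\<^sup>*\<^sup>*"

lemma gconn_refl [simp]: "gconn ends T x x"
  by (simp add: gconn_def)

lemma gconn_trans: "gconn ends T x y \<Longrightarrow> gconn ends T y z \<Longrightarrow> gconn ends T x z"
  unfolding gconn_def by (rule rtranclp_trans)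

lemma gconn_edge: "e \<in> T \<Longrightarrow> ends e = {a, b} \<Longrightarrow> gconn ends T a b"
  unfolding gconn_def by (rule r_into_rtranclp) blast

lemma gconn_sym: "gconn ends T x y \<Longrightarrow> gconn ends T y x"
  unfolding gconn_def
proof (induction rule: rtranclp_induct)
  case (step y z)
  then have "(\<lambda>a b. \<exists>e\<in>T. ends e = {a, b}) z y" by (auto simp: insert_commute)
  then show ?case using step.IH by (rule converse_rtranclp_into_rtranclp)
qed simp

lemma gconn_induct [consumes 1, case_names refl step]:
  assumes "gconn ends T x y" "P x"
    "\<And>y z e. gconn ends T x y \<Longrightarrow> e \<in> T \<Longrightarrow> ends e = {y, z} \<Longrightarrow> P y \<Longrightarrow> P z"
  shows "P y"
  using assms(1)[unfolded gconn_def]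
proof (induction rule: rtranclp_induct)
  case base
  show ?case by (rule assms(2))
next
  case (step y z)
  then show ?case using assms(3)[of y _ z] unfolding gconn_def by blast
qed

lemma gconn_mono:
  assumes "gconn ends T x y" "T \<subseteq> T'"
  shows "gconn ends T' x y"
  using assms(1)
proof (induction rule: gconn_induct)
  case (step y z e)
  then have "gconn ends T' y z" using assms(2) by (auto intro: gconn_edge)
  with step.IH show ?case by (rule gconn_trans)
qed simp

lemma gconn_empty: "gconn ends {} x y \<longleftrightarrow> x = y"
proof
  assume "gconn ends {} x y"
  then show "x = y" by (induction rule: gconn_induct) auto
qed auto

lemma gconn_insert:
  assumes "ends e = {a, b}"
  shows "gconn ends (insert e T) x y \<longleftrightarrow>
    gconn ends T x y \<or> gconn ends T x a \<and> gconn ends T b y \<or> gconn ends T x b \<and> gconn ends T a y"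
    (is "_ \<longleftrightarrow> ?R y")
proof
  assume "gconn ends (insert e T) x y"
  then show "?R y"
  proof (induction rule: gconn_induct)
    case (step y z e')
    then show ?case
    proof (cases "e' = e")
      case True
      with step assms have "y = a \<and> z = b \<or> y = b \<and> z = a" by (auto simp: doubleton_eq_iff)
      with step.IH show ?thesis by (auto intro: gconn_sym)
    next
      case False
      with step have "gconn ends T y z" by (auto intro: gconn_edge)
      with step.IH show ?thesis by (blast intro: gconn_trans)
    qed
  qed simp
next
  have m: "gconn ends T u v \<Longrightarrow> gconn ends (insert e T) u v" for u v
    by (rule gconn_mono) auto
  have ab: "gconn ends (insert e T) a b" "gconn ends (insert e T) b a"
    using assms by (auto intro: gconn_edge gconn_sym)
  assume "?R y"
  with ab show "gconn ends (insert e T) x y" by (blast intro: gconn_trans m)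
qed

lemma gconn_insert_redundant:
  assumes "ends e = {a, b}" "gconn ends T a b"
  shows "gconn ends (insert e T) x y \<longleftrightarrow> gconn ends T x y"
proof -
  have ba: "gconn ends T b a" using assms(2) by (rule gconn_sym)
  have "gconn ends T x y" if "gconn ends T x a" "gconn ends T b y"
    using that assms(2) gconn_trans by metis
  moreover have "gconn ends T x y" if "gconn ends T x b" "gconn ends T a y"
    using that ba gconn_trans by metis
  ultimately show ?thesis using gconn_insert[of ends e a b T x y, OF assms(1)] by auto
qed

lemma gconn_image:
  assumes "gconn ends T x y" "\<And>e. e \<in> T \<Longrightarrow> ends' e = h ` ends e"
  shows "gconn ends' T (h x) (h y)"
  using assms(1)
proof (induction rule: gconn_induct)
  case (step y z e)
  then have "ends' e = {h y, h z}" using assms(2) by auto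
  then show ?case using step gconn_edge gconn_trans by metis
qed simp

section \<open>Counting components, and trees as connected edge sets of the right size\<close>

definition incident :: "'v set \<Rightarrow> 'e set \<Rightarrow> ('e \<Rightarrow> 'v set) \<Rightarrow> bool" where
  "incident V E ends \<longleftrightarrow> finite V \<and> finite E \<and> (\<forall>e\<in>E. \<exists>c\<in>V. \<exists>d\<in>V. ends e = {c, d})"

lemma incident_finite: "incident V E ends \<Longrightarrow> finite V" "incident V E ends \<Longrightarrow> finite E"
  by (simp_all add: incident_def)

lemma incidentD: "incident V E ends \<Longrightarrow> e \<in> E \<Longrightarrow> ends e \<subseteq> V"
  unfolding incident_def by auto

lemma incident_subset: "incident V E ends \<Longrightarrow> T \<subseteq> E \<Longrightarrow> incident V T ends"
  unfolding incident_def by (blast intro: finite_subset)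

text \<open>The map \<open>g\<close> labels the components of \<open>(V, T)\<close>; adding an edge merges at most two of them.\<close>

lemma component_labelling:
  assumes "incident V T ends"
  shows "\<exists>g::'v \<Rightarrow> 'v. (\<forall>x\<in>V. \<forall>y\<in>V. g x = g y \<longleftrightarrow> gconn ends T x y) \<and>
    card V \<le> card (g ` V) + card T \<and>
    (card V = card (g ` V) + card T \<or>
     (\<exists>e\<in>T. \<exists>a b. ends e = {a, b} \<and> gconn ends (T - {e}) a b))"
proof -
  have "finite T" and V: "finite V" using assms by (simp_all add: incident_finite)
  from this(1) assms show ?thesis
  proof (induction T rule: finite_induct)
    case empty
    show ?case by (rule exI[of _ "\<lambda>x. x"]) (simp add: gconn_empty)
  next
    case (insert e T)
    have "incident V T ends" using insert.prems by (rule incident_subset) auto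
    from insert.IH[OF this] obtain g :: "'v \<Rightarrow> 'v" where
      g: "\<And>x y. x \<in> V \<Longrightarrow> y \<in> V \<Longrightarrow> g x = g y \<longleftrightarrow> gconn ends T x y"
      and le: "card V \<le> card (g ` V) + card T"
      and eq: "card V = card (g ` V) + card T \<or>
       (\<exists>e\<in>T. \<exists>a b. ends e = {a, b} \<and> gconn ends (T - {e}) a b)" by blast
    from insert.prems obtain a b where ab: "a \<in> V" "b \<in> V" "ends e = {a, b}"
      by (auto simp: incident_def)
    have mem: "insert e T - {e} = T" using insert.hyps by auto
    show ?case
    proof (cases "g a = g b")
      case True
      then have c: "gconn ends T a b" using g ab by auto
      have "\<exists>e'\<in>insert e T. \<exists>a b. ends e' = {a, b} \<and> gconn ends (insert e T - {e'}) a b"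
        using c ab mem by (metis insertI1)
      then show ?thesis using g le insert.hyps
        by (intro exI[of _ g]) (auto simp: gconn_insert_redundant[of ends e a b T, OF ab(3) c])
    next
      case False
      define g' where "g' v = (if g v = g b then g a else g v)" for v
      have im: "g' ` V = g ` V - {g b}"
        using False ab by (auto simp: g'_def image_iff)
      have "card (g ` V) = Suc (card (g' ` V))"
        unfolding im using ab V by (metis card.remove finite_imageI image_eqI)
      moreover have "\<exists>e'\<in>insert e T. \<exists>a b. ends e' = {a, b} \<and> gconn ends (insert e T - {e'}) a b"
        if "\<exists>e\<in>T. \<exists>a b. ends e = {a, b} \<and> gconn ends (T - {e}) a b"
      proof -
        from that obtain e' c d where "e' \<in> T" "ends e' = {c, d}" "gconn ends (T - {e'}) c d" by blast
        moreover from this have "gconn ends (insert e T - {e'}) c d"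
          by (elim gconn_mono) auto
        ultimately show ?thesis by blast
      qed
      moreover have "g' x = g' y \<longleftrightarrow> gconn ends (insert e T) x y" if "x \<in> V" "y \<in> V" for x y
        unfolding gconn_insert[of ends e a b T x y, OF ab(3)] g'_def
        using that ab g[symmetric] by auto
      ultimately show ?thesis using le eq insert.hyps
        by (intro exI[of _ g']) auto
    qed
  qed
qed

lemma card_le_if_connected:
  assumes "incident V T ends" "\<And>x y. x \<in> V \<Longrightarrow> y \<in> V \<Longrightarrow> gconn ends T x y"
  shows "card V \<le> card T + 1"
proof (cases "V = {}")
  case False
  then obtain v where "v \<in> V" by blast
  obtain g :: "'a \<Rightarrow> 'a" where
    g: "\<And>x y. x \<in> V \<Longrightarrow> y \<in> V \<Longrightarrow> g x = g y \<longleftrightarrow> gconn ends T x y"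
    "card V \<le> card (g ` V) + card T"
    "card V = card (g ` V) + card T \<or>
       (\<exists>e\<in>T. \<exists>a b. ends e = {a, b} \<and> gconn ends (T - {e}) a b)"
    using component_labelling[OF assms(1)] by blast
  have "g ` V = {g v}" using g(1) assms(2) \<open>v \<in> V\<close> by blast
  with g(2) show ?thesis by simp
qed simp

lemma simple_path:
  assumes "gconn ends T a b"
  obtains vs es where "length vs = Suc (length es)" "distinct vs" "set es \<subseteq> T" "vs ! 0 = a"
    "vs ! length es = b" "\<And>i. i < length es \<Longrightarrow> ends (es ! i) = {vs ! i, vs ! Suc i}"
proof -
  from assms have "\<exists>vs es. length vs = Suc (length es) \<and> distinct vs \<and> set es \<subseteq> T \<and> vs ! 0 = a \<and>
    vs ! length es = b \<and> (\<forall>i<length es. ends (es ! i) = {vs ! i, vs ! Suc i})"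
  proof (induction rule: gconn_induct)
    case refl
    show ?case by (intro exI[of _ "[a]"] exI[of _ "[]"]) auto
  next
    case (step y z e)
    then obtain vs es where p: "length vs = Suc (length es)" "distinct vs" "set es \<subseteq> T" "vs ! 0 = a"
      "vs ! length es = y" "\<And>i. i < length es \<Longrightarrow> ends (es ! i) = {vs ! i, vs ! Suc i}" by blast
    show ?case
    \<comment> \<open>If the walk returns to a vertex of the path, the path is cut back to that
      vertex; otherwise it is extended.\<close>
    proof (cases "z \<in> set vs")
      case True
      then obtain i where i: "i < length vs" "vs ! i = z" by (auto simp: in_set_conv_nth)
      have "set (take i es) \<subseteq> T" using p(3) set_take_subset by fastforce
      then show ?thesis using p i
        by (intro exI[of _ "take (Suc i) vs"] exI[of _ "take i es"]) auto
    next
      case False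
      have "ends ((es @ [e]) ! i) = {(vs @ [z]) ! i, (vs @ [z]) ! Suc i}" if "i < Suc (length es)" for i
        using that p step.hyps by (cases "i = length es") (auto simp: nth_append)
      then show ?thesis using p False step.hyps
        by (intro exI[of _ "vs @ [z]"] exI[of _ "es @ [e]"]) (auto simp: nth_append)
    qed
  qed
  then show ?thesis using that by blast
qed

lemma circuit_if_redundant:
  assumes "e \<in> T" "mends G e = {a, b}" "gconn (mends G) (T - {e}) a b"
  shows "\<exists>vs es. set es \<subseteq> T \<and> is_circuit G vs es"
proof -
  from simple_path[OF assms(3)] obtain vs es where
    p: "length vs = Suc (length es)" "distinct vs" "set es \<subseteq> T - {e}" "vs ! 0 = a"
    "vs ! length es = b" "\<And>i. i < length es \<Longrightarrow> mends G (es ! i) = {vs ! i, vs ! Suc i}" by metis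
  \<comment> \<open>A repeated edge would have the same ends at two positions of the path, which the
    distinctness of the vertices forbids.\<close>
  have "distinct es"
  proof (rule ccontr)
    assume "\<not> distinct es"
    then obtain i j where ij: "i < j" "j < length es" "es ! i = es ! j"
      by (metis distinct_conv_nth linorder_neqE_nat)
    have "{vs ! i, vs ! Suc i} = {vs ! j, vs ! Suc j}" using p(6)[of i] p(6)[of j] ij by auto
    then have "vs ! i = vs ! j \<or> vs ! i = vs ! Suc j" by auto
    then show False using p(1,2) ij by (auto simp: nth_eq_iff_index_eq)
  qed
  moreover have "mends G ((es @ [e]) ! i) = {vs ! i, vs ! (Suc i mod length (es @ [e]))}"
    if "i < length (es @ [e])" for i
    using that p assms(2) by (cases "i = length es") (auto simp: nth_append)
  ultimately show ?thesis using p(1-3) assms(1)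
    by (intro exI[of _ vs] exI[of _ "es @ [e]"]) (auto simp: is_circuit_def)
qed

text \<open>Without its closing edge, which the reduction mod the length leads from the last vertex
  back to the first, a circuit still connects the ends of that edge.\<close>

lemma redundant_if_circuit:
  assumes "set es \<subseteq> T" "is_circuit G vs es"
  obtains e a b where "e \<in> T" "mends G e = {a, b}" "gconn (mends G) (T - {e}) a b"
proof -
  define l where "l = length es - 1"
  have l: "length es = Suc l" "length vs = Suc l" using assms by (auto simp: is_circuit_def l_def)
  have d: "distinct es" and m: "\<And>i. i < Suc l \<Longrightarrow> mends G (es ! i) = {vs ! i, vs ! (Suc i mod Suc l)}"
    using assms l by (auto simp: is_circuit_def)
  have "i \<le> l \<Longrightarrow> gconn (mends G) (T - {es ! l}) (vs ! 0) (vs ! i)" for i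
  proof (induction i)
    case (Suc i)
    then have "es ! i \<in> T - {es ! l}" using d l assms(1) by (auto simp: nth_eq_iff_index_eq)
    moreover have "mends G (es ! i) = {vs ! i, vs ! Suc i}" using m[of i] Suc.prems by simp
    ultimately show ?case using Suc gconn_edge gconn_trans by (metis Suc_leD)
  qed simp
  then have "gconn (mends G) (T - {es ! l}) (vs ! l) (vs ! 0)" by (blast intro: gconn_sym)
  moreover have "es ! l \<in> T" using assms(1) l by auto
  moreover have "mends G (es ! l) = {vs ! l, vs ! 0}" using m[of l] by simp
  ultimately show ?thesis using that by blast
qed

text \<open>An edge count survives deletion and contraction without any reference to circuits. For
  connected \<open>T\<close> there is one component, so the count of
  \<open>component_labelling\<close> is exact unless some edge is redundant, and a redundant edge
  closes a circuit. Conversely, a circuit contains a redundant edge; dropping it keeps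
  \<open>T\<close> connected and would violate \<open>card_le_if_connected\<close>.\<close>

lemma spanning_tree_iff_card:
  fixes G :: "('v, 'e) multigraph"
  assumes "incident (mverts G) (medges G) (mends G)"
  shows "spanning_tree G T \<longleftrightarrow> T \<subseteq> medges G \<and>
    (\<forall>x\<in>mverts G. \<forall>y\<in>mverts G. gconn (mends G) T x y) \<and> card T + 1 = card (mverts G)"
proof (cases "T \<subseteq> medges G \<and> mverts G \<noteq> {} \<and> (\<forall>x\<in>mverts G. \<forall>y\<in>mverts G. gconn (mends G) T x y)")
  case True
  let ?V = "mverts G"
  have inc: "incident ?V T (mends G)" using incident_subset[OF assms, of T] True by simp
  obtain g :: "'v \<Rightarrow> 'v" where
    g: "\<And>x y. x \<in> ?V \<Longrightarrow> y \<in> ?V \<Longrightarrow> g x = g y \<longleftrightarrow> gconn (mends G) T x y"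
    "card ?V \<le> card (g ` ?V) + card T"
    "card ?V = card (g ` ?V) + card T \<or>
       (\<exists>e\<in>T. \<exists>a b. mends G e = {a, b} \<and> gconn (mends G) (T - {e}) a b)"
    using component_labelling[OF inc] by blast
  obtain v where "v \<in> ?V" using True by blast
  then have "g ` ?V = {g v}" using g(1) True by blast
  then have c1: "card (g ` ?V) = 1" by simp
  have "card T + 1 = card ?V" if "\<not> (\<exists>vs es. set es \<subseteq> T \<and> is_circuit G vs es)"
  proof -
    have "\<not> (\<exists>e\<in>T. \<exists>a b. mends G e = {a, b} \<and> gconn (mends G) (T - {e}) a b)"
      using circuit_if_redundant[of _ T G] that by blast
    with g(3) c1 show ?thesis by auto
  qed
  moreover have False if c: "card T + 1 = card ?V" and "set es \<subseteq> T" "is_circuit G vs es" for vs es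
  proof -
    from redundant_if_circuit[OF that(2,3)] obtain e a b where
      e: "e \<in> T" "mends G e = {a, b}" "gconn (mends G) (T - {e}) a b" by blast
    have "gconn (mends G) (T - {e}) x y" if "x \<in> ?V" "y \<in> ?V" for x y
      using gconn_insert_redundant[of "mends G" e a b "T - {e}" x y] e True that by (simp add: insert_absorb)
    then have "card ?V \<le> card (T - {e}) + 1"
      by (intro card_le_if_connected[OF incident_subset[OF inc]]) auto
    moreover have "finite T" by (rule incident_finite[OF inc])
    ultimately show False using c e(1) card_Suc_Diff1 by (metis Suc_eq_plus1 not_less_eq_eq order_refl)
  qed
  ultimately show ?thesis using True by (auto simp: spanning_tree_def connected_by_def gconn_def)
next
  case False
  then show ?thesis
    by (cases "mverts G = {}") (auto simp: spanning_tree_def connected_by_def gconn_def)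
qed

section \<open>Deletion and contraction\<close>

definition tree_poly :: "'v set \<Rightarrow> nat set \<Rightarrow> (nat \<Rightarrow> 'v set) \<Rightarrow> 'k::field mpoly" where
  "tree_poly V E ends = (\<Sum>T | T \<subseteq> E \<and> (\<forall>x\<in>V. \<forall>y\<in>V. gconn ends T x y) \<and> card T + 1 = card V.
     \<Prod>e\<in>E - T. mvar e)"

lemma graph_poly_eq_tree_poly:
  assumes "incident (mverts G) (medges G) (mends G)"
  shows "graph_poly G = tree_poly (mverts G) (medges G) (mends G)"
  unfolding graph_poly_def tree_poly_def spanning_tree_iff_card[OF assms] ..

lemma tree_poly_cong:
  assumes "\<And>e. e \<in> E \<Longrightarrow> ends e = ends' e"
  shows "tree_poly V E ends = tree_poly V E ends'"
proof -
  have "gconn ends T = gconn ends' T" if "T \<subseteq> E" for T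
  proof -
    have "(\<exists>e\<in>T. ends e = {a, b}) \<longleftrightarrow> (\<exists>e\<in>T. ends' e = {a, b})" for a b
      using that assms by (metis subsetD)
    then show ?thesis by (simp add: gconn_def)
  qed
  then show ?thesis unfolding tree_poly_def by (intro sum.cong) auto
qed

text \<open>A path in the contracted graph lifts by inserting \<open>e\<close> where it passes
  through the merged vertex; a path using \<open>e\<close> descends because \<open>e\<close> becomes
  a loop.\<close>

lemma gconn_contract:
  fixes a b :: 'v
  defines "m \<equiv> \<lambda>v. if v = b then a else v"
  assumes "ends e = {a, b}" "\<And>e. e \<in> T \<Longrightarrow> \<exists>c d. ends e = {c, d}"
  shows "gconn (\<lambda>e. m ` ends e) T (m x) (m y) \<longleftrightarrow> gconn ends (insert e T) x y"
proof
  have mm: "gconn ends (insert e T) v (m v)" "gconn ends (insert e T) (m v) v" for v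
    using assms(2) by (auto simp: m_def intro: gconn_edge gconn_sym)
  assume "gconn (\<lambda>e. m ` ends e) T (m x) (m y)"
  then have "gconn ends (insert e T) (m x) (m y)"
  proof (induction rule: gconn_induct)
    case (step y z e')
    then obtain c d where cd: "ends e' = {c, d}" using assms(3) by blast
    with step have "y = m c \<and> z = m d \<or> y = m d \<and> z = m c" by (auto simp: doubleton_eq_iff)
    moreover have "gconn ends (insert e T) c d" "gconn ends (insert e T) d c"
      using cd step.hyps by (auto intro: gconn_edge gconn_sym)
    ultimately have "gconn ends (insert e T) y z" using mm by (metis gconn_trans)
    with step.IH show ?case by (rule gconn_trans)
  qed simp
  then show "gconn ends (insert e T) x y" using mm by (metis gconn_trans)
next
  assume "gconn ends (insert e T) x y"
  then have "gconn (\<lambda>e. m ` ends e) (insert e T) (m x) (m y)" by (rule gconn_image) simp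
  then show "gconn (\<lambda>e. m ` ends e) T (m x) (m y)"
    using assms(2) by (subst (asm) gconn_insert_redundant[of _ e a a]) (auto simp: m_def)
qed

text \<open>Trees avoiding \<open>e\<close> contribute the factor \<open>mvar e\<close>; those
  through \<open>e\<close> are the trees of the contraction. A loop lies in no tree, because the set
  without it stays connected but has too few edges.\<close>

lemma tree_poly_insert:
  fixes a b :: 'v
  assumes inc: "incident V (insert e E) ends" and e: "e \<notin> E" "ends e = {a, b}"
  shows "(tree_poly V (insert e E) ends :: 'k::field mpoly) = mvar e * tree_poly V E ends +
    (if a = b then 0 else tree_poly (V - {b}) E (\<lambda>x. (\<lambda>v. if v = b then a else v) ` ends x))"
proof -
  let ?c = "\<lambda>T. (\<forall>x\<in>V. \<forall>y\<in>V. gconn ends T x y) \<and> card T + 1 = card V"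
  let ?P = "\<lambda>T. \<Prod>e\<in>insert e E - T. mvar e :: 'k mpoly"
  have fin: "finite E" "finite V" using incident_finite[OF inc] by auto
  have ab: "a \<in> V" "b \<in> V" using incidentD[OF inc, of e] e by auto
  let ?A = "{T. T \<subseteq> E \<and> ?c T}" and ?B = "{T. T \<subseteq> E \<and> ?c (insert e T)}"
  have split: "{T. T \<subseteq> insert e E \<and> ?c T} = ?A \<union> insert e ` ?B"
  proof -
    have "T \<in> ?A \<union> insert e ` ?B" if "T \<subseteq> insert e E" "?c T" for T
    proof (cases "e \<in> T")
      case True
      then have "T = insert e (T - {e})" "T - {e} \<subseteq> E" using that by auto
      then show ?thesis using that(2) by (intro UnI2 image_eqI[of _ _ "T - {e}"]) auto
    qed (use that in auto)
    then show ?thesis by auto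
  qed
  have finA: "finite ?A" "finite ?B" using fin by auto
  have "tree_poly V (insert e E) ends = sum ?P ?A + sum ?P (insert e ` ?B)"
    unfolding tree_poly_def split using finA e by (intro sum.union_disjoint) auto
  also have "sum ?P (insert e ` ?B) = (\<Sum>T\<in>?B. ?P (insert e T))"
    using e by (intro sum.reindex_cong[of "insert e"]) (auto simp: inj_on_def)
  also have "\<dots> = (\<Sum>T\<in>?B. \<Prod>e\<in>E - T. mvar e)"
    using e by (intro sum.cong refl prod.cong) auto
  also have "sum ?P ?A = mvar e * tree_poly V E ends"
    unfolding tree_poly_def sum_distrib_left
  proof (intro sum.cong refl)
    fix T assume "T \<in> ?A"
    then have "insert e E - T = insert e (E - T)" using e by auto
    then show "?P T = mvar e * (\<Prod>e\<in>E - T. mvar e)" using e fin by simp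
  qed
  also have "(\<Sum>T\<in>?B. \<Prod>e\<in>E - T. mvar e) =
    (if a = b then 0 else tree_poly (V - {b}) E (\<lambda>x. (\<lambda>v. if v = b then a else v) ` ends x))"
  proof (cases "a = b")
    case True
    have "?B = {}"
    proof (rule ccontr)
      assume "?B \<noteq> {}"
      then obtain T where T: "T \<subseteq> E" "?c (insert e T)" by auto
      have "gconn ends T x y" if "x \<in> V" "y \<in> V" for x y
        using gconn_insert_redundant[of ends e a b T x y] T e that True by auto
      then have "card V \<le> card T + 1"
        using T inc by (intro card_le_if_connected[OF incident_subset[OF inc]]) auto
      moreover have "card (insert e T) = Suc (card T)"
        using T e fin by (intro card_insert_disjoint) (auto intro: finite_subset)
      ultimately show False using T by simp
    qed
    then show ?thesis using True by (simp only: sum.empty if_True simp_thms)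
  next
    case False
    let ?m = "\<lambda>v. if v = b then a else v"
    have "?c (insert e T) \<longleftrightarrow> (\<forall>x\<in>V - {b}. \<forall>y\<in>V - {b}. gconn (\<lambda>x. ?m ` ends x) T x y) \<and>
        card T + 1 = card (V - {b})" if "T \<subseteq> E" for T
    proof -
      have "gconn ends (insert e T) x y \<longleftrightarrow> gconn (\<lambda>x. ?m ` ends x) T (?m x) (?m y)" for x y
      proof -
        have "\<exists>c d. ends e' = {c, d}" if "e' \<in> T" for e'
          using that \<open>T \<subseteq> E\<close> inc unfolding incident_def by blast
        then show ?thesis using gconn_contract[of ends e a b T x y] e by blast
      qed
      then have "(\<forall>x\<in>V. \<forall>y\<in>V. gconn ends (insert e T) x y) \<longleftrightarrow>
        (\<forall>x\<in>?m ` V. \<forall>y\<in>?m ` V. gconn (\<lambda>x. ?m ` ends x) T x y)" by (simp only: ball_simps)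
      also have "?m ` V = V - {b}" using ab False by auto
      finally have 1: "(\<forall>x\<in>V. \<forall>y\<in>V. gconn ends (insert e T) x y) \<longleftrightarrow>
        (\<forall>x\<in>V - {b}. \<forall>y\<in>V - {b}. gconn (\<lambda>x. ?m ` ends x) T x y)" .
      have "card (insert e T) = Suc (card T)"
        using that e fin by (intro card_insert_disjoint) (auto intro: finite_subset)
      moreover have "card V = Suc (card (V - {b}))" using ab fin by (metis card_Suc_Diff1)
      ultimately show ?thesis using 1 by simp
    qed
    then have "?B = {T. T \<subseteq> E \<and> (\<forall>x\<in>V - {b}. \<forall>y\<in>V - {b}. gconn (\<lambda>x. ?m ` ends x) T x y) \<and>
        card T + 1 = card (V - {b})}" by blast
    then show ?thesis unfolding tree_poly_def using False by (simp only: if_False)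
  qed
  finally show ?thesis .
qed

text \<open>Vertices with equal labels are identified. A chain of contractions then changes only
  \<open>f\<close> and keeps \<open>V\<close>, \<open>E\<close> and \<open>ends\<close>
  fixed.\<close>

definition label_poly :: "'v set \<Rightarrow> nat set \<Rightarrow> (nat \<Rightarrow> 'v set) \<Rightarrow> ('v \<Rightarrow> 'v) \<Rightarrow> 'k::field mpoly" where
  "label_poly V E ends f = tree_poly (f ` V) E (\<lambda>e. f ` ends e)"

lemma label_poly_insert:
  assumes inc: "incident V (insert e E) ends" and e: "e \<notin> E" "ends e = {a, b}"
  shows "label_poly V (insert e E) ends f = mvar e * label_poly V E ends f +
    (if f a = f b then 0 else label_poly V E ends (\<lambda>v. if f v = f b then f a else f v))"
proof -
  have "incident (f ` V) (insert e E) (\<lambda>e. f ` ends e)"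
    using inc unfolding incident_def by fastforce
  from tree_poly_insert[OF this e(1), of "f a" "f b"] e(2)
  have *: "label_poly V (insert e E) ends f = mvar e * label_poly V E ends f +
    (if f a = f b then 0 else tree_poly (f ` V - {f b}) E
       (\<lambda>x. (\<lambda>v. if v = f b then f a else v) ` f ` ends x))"
    by (simp add: label_poly_def del: image_image)
  have "(\<lambda>v. if f v = f b then f a else f v) ` V = f ` V - {f b}" if "f a \<noteq> f b"
  proof -
    have "a \<in> V" using incidentD[OF inc, of e] e by auto
    then show ?thesis using that by (auto simp: image_iff)
  qed
  then show ?thesis unfolding * unfolding label_poly_def
    by (cases "f a = f b") (simp_all only: if_True if_False simp_thms image_image)
qed

lemma label_poly_isolated:
  assumes "p \<in> V" "r \<in> V" "f r \<noteq> f p" "\<And>e v. e \<in> E \<Longrightarrow> v \<in> ends e \<Longrightarrow> f v \<noteq> f p"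
  shows "label_poly V E ends f = 0"
proof -
  have "\<not> gconn (\<lambda>e. f ` ends e) T (f p) (f r)" if "T \<subseteq> E" for T
  proof
    assume "gconn (\<lambda>e. f ` ends e) T (f p) (f r)"
    then have "f r = f p"
    proof (induction rule: gconn_induct)
      case (step y z e)
      then have "f p \<in> f ` ends e" "e \<in> E" using that by auto
      then show ?case using assms(4) by force
    qed simp
    then show False using assms(3) by blast
  qed
  then have "{T. T \<subseteq> E \<and> (\<forall>x\<in>f ` V. \<forall>y\<in>f ` V. gconn (\<lambda>e. f ` ends e) T x y) \<and>
      card T + 1 = card (f ` V)} = {}"
    using assms(1,2) by blast
  then show ?thesis unfolding label_poly_def tree_poly_def by (simp only: sum.empty)
qed

text \<open>Only the partition of \<open>V\<close> into fibres matters: each labelling is a function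
  of the other on \<open>V\<close>, and such a function carries connections over.\<close>

lemma label_poly_cong:
  assumes E: "\<And>e. e \<in> E \<Longrightarrow> ends e \<subseteq> V"
    and "\<And>x y. x \<in> V \<Longrightarrow> y \<in> V \<Longrightarrow> f x = f y \<longleftrightarrow> g x = g y"
  shows "label_poly V E ends f = label_poly V E ends g"
proof -
  have tr: "gconn (\<lambda>e. g ` ends e) T (g x) (g y)"
    if fg: "\<And>x y. x \<in> V \<Longrightarrow> y \<in> V \<Longrightarrow> f x = f y \<Longrightarrow> g x = g y"
    and T: "T \<subseteq> E" and xy: "x \<in> V" "y \<in> V" and c: "gconn (\<lambda>e. f ` ends e) T (f x) (f y)"
    for f g :: "'a \<Rightarrow> 'a" and T x y
  proof -
    define h where "h \<alpha> = g (SOME x. x \<in> V \<and> f x = \<alpha>)" for \<alpha>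
    have h: "h (f x) = g x" if "x \<in> V" for x
    proof -
      have "(SOME x'. x' \<in> V \<and> f x' = f x) \<in> V \<and> f (SOME x'. x' \<in> V \<and> f x' = f x) = f x"
        using that by (intro someI[of "\<lambda>x'. x' \<in> V \<and> f x' = f x"]) auto
      then show ?thesis unfolding h_def using fg that by blast
    qed
    have "gconn (\<lambda>e. g ` ends e) T (h (f x)) (h (f y))"
      using c
    proof (rule gconn_image)
      fix e assume "e \<in> T"
      then show "g ` ends e = h ` f ` ends e" using T E h by (force simp: image_image)
    qed
    then show ?thesis using h xy by simp
  qed
  have 1: "gconn (\<lambda>e. f ` ends e) T (f x) (f y) \<longleftrightarrow> gconn (\<lambda>e. g ` ends e) T (g x) (g y)"
    if "x \<in> V" "y \<in> V" "T \<subseteq> E" for x y T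
    using tr[of f g T x y] tr[of g f T x y] that assms(2) by blast
  have "card (f ` V) = card (g ` V)"
  proof -
    define h where "h \<alpha> = g (inv_into V f \<alpha>)" for \<alpha>
    have hf: "h (f x) = g x" if "x \<in> V" for x
      using that assms(2)[of "inv_into V f (f x)" x] by (simp add: h_def f_inv_into_f inv_into_into)
    have "inj_on h (f ` V)" using assms(2) hf by (auto simp: inj_on_def)
    moreover have "h ` f ` V = g ` V" using hf by (auto simp: image_image)
    ultimately show ?thesis by (metis card_image)
  qed
  then have "{T. T \<subseteq> E \<and> (\<forall>x\<in>f ` V. \<forall>y\<in>f ` V. gconn (\<lambda>e. f ` ends e) T x y) \<and> card T + 1 = card (f ` V)} =
    {T. T \<subseteq> E \<and> (\<forall>x\<in>g ` V. \<forall>y\<in>g ` V. gconn (\<lambda>e. g ` ends e) T x y) \<and> card T + 1 = card (g ` V)}"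
    using 1 by auto
  then show ?thesis unfolding label_poly_def tree_poly_def by (simp only:)
qed

section \<open>Stars and triangles\<close>

text \<open>Lets the contracted labelling be replaced by any \<open>g\<close> with the same fibres,
  so that the expansions below can name it as an update of \<open>id\<close>.\<close>

lemma label_poly_branch:
  assumes "incident V (insert e E) ends" "e \<notin> E" "ends e = {a, b}" "f a \<noteq> f b"
    and "\<And>x y. x \<in> V \<Longrightarrow> y \<in> V \<Longrightarrow>
      g x = g y \<longleftrightarrow> (if f x = f b then f a else f x) = (if f y = f b then f a else f y)"
  shows "label_poly V (insert e E) ends f = mvar e * label_poly V E ends f + label_poly V E ends g"
proof -
  have "label_poly V E ends (\<lambda>v. if f v = f b then f a else f v) = label_poly V E ends g"
    using incidentD[OF assms(1)] assms(5) by (intro label_poly_cong) blast+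
  then show ?thesis by (subst label_poly_insert[OF assms(1-3)]) (simp add: assms(4))
qed

lemma label_poly_loop:
  assumes "incident V (insert e E) ends" "e \<notin> E" "ends e = {a, b}" "f a = f b"
  shows "label_poly V (insert e E) ends f = mvar e * label_poly V E ends f"
  by (subst label_poly_insert[OF assms(1-3)]) (simp add: assms(4))

lemma label_poly_restrict:
  assumes "\<And>e. e \<in> E \<Longrightarrow> ends e \<subseteq> W" "\<And>v. v \<in> V \<Longrightarrow> v \<notin> W \<Longrightarrow> f v \<in> W \<and> f (f v) = f v" "W \<subseteq> V"
    and "\<And>x y. x \<in> W \<Longrightarrow> y \<in> W \<Longrightarrow> f x = f y \<longleftrightarrow> g x = g y"
  shows "label_poly V E ends f = label_poly W E ends g"
proof -
  have "f ` V = f ` W" 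
  proof -
    have "f v \<in> f ` W" if "v \<in> V" for v
      using assms(2)[OF that] that by (metis image_eqI)
    then show ?thesis using assms(3) by auto
  qed
  then have "label_poly V E ends f = label_poly W E ends f" by (simp add: label_poly_def)
  also have "\<dots> = label_poly W E ends g" using assms(1,4) by (rule label_poly_cong)
  finally show ?thesis .
qed

text \<open>Once the edges at \<open>p\<close> are expanded, the rest of the graph enters only
  through its contractions along the five partitions of the terminals \<open>h\<close>,
  \<open>p'\<close>, \<open>q'\<close>. In this form the star can be compared with the
  triangle.\<close>

lemma tree_poly_star:
  assumes inc0: "incident W H ends"
    and W: "h \<in> W" "p' \<in> W" "q' \<in> W" "p \<notin> W"
    and D: "h \<noteq> p'" "h \<noteq> q'" "p' \<noteq> q'" "distinct [x, e, s]" "x \<notin> H" "e \<notin> H" "s \<notin> H"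
    and ends: "ends x = {p, h}" "ends e = {p, p'}" "ends s = {p, q'}"
  shows "tree_poly (insert p W) (insert x (insert e (insert s H))) ends =
    label_poly W H ends (id(p' := h, q' := h)) + mvar s * label_poly W H ends (id(p' := h)) +
    mvar e * label_poly W H ends (id(q' := h)) + mvar x * label_poly W H ends (id(q' := p')) +
    (mvar x * mvar e + mvar x * mvar s + mvar e * mvar s) * label_poly W H ends id"
proof -
  let ?L = "\<lambda>E. label_poly (insert p W) E ends"
  have inc: "incident (insert p W) (insert x (insert e (insert s H))) ends"
    using inc0 W ends unfolding incident_def by simp blast
  have H: "\<And>e. e \<in> H \<Longrightarrow> ends e \<subseteq> W" using incidentD[OF inc0] .
  have H': "v \<in> W" if "e \<in> H" "v \<in> ends e" for e v using H that by blast
  \<comment> \<open>The facts run from the leaves of the deletion-contraction tree to its root. A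
    leaf is 0 if \<open>p\<close> is isolated and otherwise a contraction of the rest; unfolding in
    the opposite order evaluates the root.\<close>
  have n0: "?L H (id) = 0"
    using W H D by (intro label_poly_isolated[of p _ h]) (auto dest: H')
  have n1: "?L H (id(p := q')) = label_poly W H ends (id)"
    using W H D by (intro label_poly_restrict) auto
  have n2: "?L (insert s H) (id) = mvar s * ?L (H) (id) + ?L (H) (id(p := q'))"
    using W D ends by (intro label_poly_branch[of _ _ _ _ p q'] incident_subset[OF inc]) auto
  have n3: "?L H (id(p := p')) = label_poly W H ends (id)"
    using W H D by (intro label_poly_restrict) auto
  have n4: "?L H (id(p := p', q' := p')) = label_poly W H ends (id(q' := p'))"
    using W H D by (intro label_poly_restrict) auto
  have n5: "?L (insert s H) (id(p := p')) = mvar s * ?L (H) (id(p := p')) + ?L (H) (id(p := p', q' := p'))"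
    using W D ends by (intro label_poly_branch[of _ _ _ _ p q'] incident_subset[OF inc]) auto
  have n6: "?L (insert e (insert s H)) (id) = mvar e * ?L (insert s H) (id) + ?L (insert s H) (id(p := p'))"
    using W D ends by (intro label_poly_branch[of _ _ _ _ p p'] incident_subset[OF inc]) auto
  have n7: "?L H (id(p := h)) = label_poly W H ends (id)"
    using W H D by (intro label_poly_restrict) auto
  have n8: "?L H (id(p := h, q' := h)) = label_poly W H ends (id(q' := h))"
    using W H D by (intro label_poly_restrict) auto
  have n9: "?L (insert s H) (id(p := h)) = mvar s * ?L (H) (id(p := h)) + ?L (H) (id(p := h, q' := h))"
    using W D ends by (intro label_poly_branch[of _ _ _ _ p q'] incident_subset[OF inc]) auto
  have n10: "?L H (id(p := h, p' := h)) = label_poly W H ends (id(p' := h))"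
    using W H D by (intro label_poly_restrict) auto
  have n11: "?L H (id(p := h, p' := h, q' := h)) = label_poly W H ends (id(p' := h, q' := h))"
    using W H D by (intro label_poly_restrict) auto
  have n12: "?L (insert s H) (id(p := h, p' := h)) = mvar s * ?L (H) (id(p := h, p' := h)) + ?L (H) (id(p := h, p' := h, q' := h))"
    using W D ends by (intro label_poly_branch[of _ _ _ _ p q'] incident_subset[OF inc]) auto
  have n13: "?L (insert e (insert s H)) (id(p := h)) = mvar e * ?L (insert s H) (id(p := h)) + ?L (insert s H) (id(p := h, p' := h))"
    using W D ends by (intro label_poly_branch[of _ _ _ _ p p'] incident_subset[OF inc]) auto
  have n14: "?L (insert x (insert e (insert s H))) (id) = mvar x * ?L (insert e (insert s H)) (id) + ?L (insert e (insert s H)) (id(p := h))"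
    using W D ends by (intro label_poly_branch[of _ _ _ _ p h] incident_subset[OF inc]) auto
  have "tree_poly (insert p W) (insert x (insert e (insert s H))) ends = ?L (insert x (insert e (insert s H))) id"
    by (simp add: label_poly_def)
  then show ?thesis unfolding n14 n13 n12 n11 n10 n9 n8 n7 n6 n5 n4 n3 n2 n1 n0 by (simp add: algebra_simps)
qed

text \<open>The same five contractions of the rest occur as in \<open>tree_poly_star\<close>, so the
  star-triangle relation becomes a comparison of five coefficients.\<close>

lemma tree_poly_triangle:
  assumes inc0: "incident W H ends"
    and W: "h \<in> W" "p' \<in> W" "q' \<in> W" "p \<notin> W" "q \<notin> W" "p \<noteq> q"
    and D: "h \<noteq> p'" "h \<noteq> q'" "p' \<noteq> q'" "distinct [t, x, y, e, s]" "t \<notin> H" "x \<notin> H" "y \<notin> H" "e \<notin> H" "s \<notin> H"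
    and ends: "ends t = {p, q}" "ends x = {p, h}" "ends y = {q, h}" "ends e = {p, p'}" "ends s = {q, q'}"
  shows "tree_poly (insert p (insert q W)) (insert t (insert x (insert y (insert e (insert s H))))) ends =
    (mvar x + mvar y + mvar t) * label_poly W H ends (id(p' := h, q' := h)) +
    ((mvar x + mvar y + mvar t) * mvar s + mvar y * mvar t) * label_poly W H ends (id(p' := h)) +
    ((mvar x + mvar y + mvar t) * mvar e + mvar x * mvar t) * label_poly W H ends (id(q' := h)) +
    mvar x * mvar y * label_poly W H ends (id(q' := p')) +
    (mvar x * mvar y * (mvar e + mvar s + mvar t) + (mvar x + mvar y + mvar t) * mvar e * mvar s +
      mvar e * mvar y * mvar t + mvar s * mvar x * mvar t) * label_poly W H ends id"
proof -
  let ?L = "\<lambda>E. label_poly (insert p (insert q W)) E ends"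
  have inc: "incident (insert p (insert q W)) (insert t (insert x (insert y (insert e (insert s H))))) ends"
    using inc0 W ends unfolding incident_def by simp blast
  have H: "\<And>e. e \<in> H \<Longrightarrow> ends e \<subseteq> W" using incidentD[OF inc0] .
  have H': "v \<in> W" if "e \<in> H" "v \<in> ends e" for e v using H that by blast
  have n0: "?L H (id) = 0"
    using W H D by (intro label_poly_isolated[of p _ h]) (auto dest: H')
  have n1: "?L H (id(q := q')) = 0"
    using W H D by (intro label_poly_isolated[of p _ h]) (auto dest: H')
  have n2: "?L (insert s H) (id) = mvar s * ?L (H) (id) + ?L (H) (id(q := q'))"
    using W D ends by (intro label_poly_branch[of _ _ _ _ q q'] incident_subset[OF inc]) auto
  have n3: "?L H (id(p := p')) = 0"
    using W H D by (intro label_poly_isolated[of q _ h]) (auto dest: H')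
  have n4: "?L H (id(p := p', q := q')) = label_poly W H ends (id)"
    using W H D by (intro label_poly_restrict) auto
  have n5: "?L (insert s H) (id(p := p')) = mvar s * ?L (H) (id(p := p')) + ?L (H) (id(p := p', q := q'))"
    using W D ends by (intro label_poly_branch[of _ _ _ _ q q'] incident_subset[OF inc]) auto
  have n6: "?L (insert e (insert s H)) (id) = mvar e * ?L (insert s H) (id) + ?L (insert s H) (id(p := p'))"
    using W D ends by (intro label_poly_branch[of _ _ _ _ p p'] incident_subset[OF inc]) auto
  have n7: "?L H (id(q := h)) = 0"
    using W H D by (intro label_poly_isolated[of p _ h]) (auto dest: H')
  have n8: "?L H (id(q := h, q' := h)) = 0"
    using W H D by (intro label_poly_isolated[of p _ h]) (auto dest: H')
  have n9: "?L (insert s H) (id(q := h)) = mvar s * ?L (H) (id(q := h)) + ?L (H) (id(q := h, q' := h))"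
    using W D ends by (intro label_poly_branch[of _ _ _ _ q q'] incident_subset[OF inc]) auto
  have n10: "?L H (id(p := p', q := h)) = label_poly W H ends (id)"
    using W H D by (intro label_poly_restrict) auto
  have n11: "?L H (id(p := p', q := h, q' := h)) = label_poly W H ends (id(q' := h))"
    using W H D by (intro label_poly_restrict) auto
  have n12: "?L (insert s H) (id(p := p', q := h)) = mvar s * ?L (H) (id(p := p', q := h)) + ?L (H) (id(p := p', q := h, q' := h))"
    using W D ends by (intro label_poly_branch[of _ _ _ _ q q'] incident_subset[OF inc]) auto
  have n13: "?L (insert e (insert s H)) (id(q := h)) = mvar e * ?L (insert s H) (id(q := h)) + ?L (insert s H) (id(p := p', q := h))"
    using W D ends by (intro label_poly_branch[of _ _ _ _ p p'] incident_subset[OF inc]) auto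
  have n14: "?L (insert y (insert e (insert s H))) (id) = mvar y * ?L (insert e (insert s H)) (id) + ?L (insert e (insert s H)) (id(q := h))"
    using W D ends by (intro label_poly_branch[of _ _ _ _ q h] incident_subset[OF inc]) auto
  have n15: "?L H (id(p := h)) = 0"
    using W H D by (intro label_poly_isolated[of q _ h]) (auto dest: H')
  have n16: "?L H (id(p := h, q := q')) = label_poly W H ends (id)"
    using W H D by (intro label_poly_restrict) auto
  have n17: "?L (insert s H) (id(p := h)) = mvar s * ?L (H) (id(p := h)) + ?L (H) (id(p := h, q := q'))"
    using W D ends by (intro label_poly_branch[of _ _ _ _ q q'] incident_subset[OF inc]) auto
  have n18: "?L H (id(p := h, p' := h)) = 0"
    using W H D by (intro label_poly_isolated[of q _ h]) (auto dest: H')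
  have n19: "?L H (id(p := h, p' := h, q := q')) = label_poly W H ends (id(p' := h))"
    using W H D by (intro label_poly_restrict) auto
  have n20: "?L (insert s H) (id(p := h, p' := h)) = mvar s * ?L (H) (id(p := h, p' := h)) + ?L (H) (id(p := h, p' := h, q := q'))"
    using W D ends by (intro label_poly_branch[of _ _ _ _ q q'] incident_subset[OF inc]) auto
  have n21: "?L (insert e (insert s H)) (id(p := h)) = mvar e * ?L (insert s H) (id(p := h)) + ?L (insert s H) (id(p := h, p' := h))"
    using W D ends by (intro label_poly_branch[of _ _ _ _ p p'] incident_subset[OF inc]) auto
  have n22: "?L H (id(p := h, q := h)) = label_poly W H ends (id)"
    using W H D by (intro label_poly_restrict) auto
  have n23: "?L H (id(p := h, q := h, q' := h)) = label_poly W H ends (id(q' := h))"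
    using W H D by (intro label_poly_restrict) auto
  have n24: "?L (insert s H) (id(p := h, q := h)) = mvar s * ?L (H) (id(p := h, q := h)) + ?L (H) (id(p := h, q := h, q' := h))"
    using W D ends by (intro label_poly_branch[of _ _ _ _ q q'] incident_subset[OF inc]) auto
  have n25: "?L H (id(p := h, p' := h, q := h)) = label_poly W H ends (id(p' := h))"
    using W H D by (intro label_poly_restrict) auto
  have n26: "?L H (id(p := h, p' := h, q := h, q' := h)) = label_poly W H ends (id(p' := h, q' := h))"
    using W H D by (intro label_poly_restrict) auto
  have n27: "?L (insert s H) (id(p := h, p' := h, q := h)) = mvar s * ?L (H) (id(p := h, p' := h, q := h)) + ?L (H) (id(p := h, p' := h, q := h, q' := h))"
    using W D ends by (intro label_poly_branch[of _ _ _ _ q q'] incident_subset[OF inc]) auto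
  have n28: "?L (insert e (insert s H)) (id(p := h, q := h)) = mvar e * ?L (insert s H) (id(p := h, q := h)) + ?L (insert s H) (id(p := h, p' := h, q := h))"
    using W D ends by (intro label_poly_branch[of _ _ _ _ p p'] incident_subset[OF inc]) auto
  have n29: "?L (insert y (insert e (insert s H))) (id(p := h)) = mvar y * ?L (insert e (insert s H)) (id(p := h)) + ?L (insert e (insert s H)) (id(p := h, q := h))"
    using W D ends by (intro label_poly_branch[of _ _ _ _ q h] incident_subset[OF inc]) auto
  have n30: "?L (insert x (insert y (insert e (insert s H)))) (id) = mvar x * ?L (insert y (insert e (insert s H))) (id) + ?L (insert y (insert e (insert s H))) (id(p := h))"
    using W D ends by (intro label_poly_branch[of _ _ _ _ p h] incident_subset[OF inc]) auto
  have n31: "?L H (id(q := p)) = 0"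
    using W H D by (intro label_poly_isolated[of p _ h]) (auto dest: H')
  have n32: "?L H (id(p := q', q := q')) = label_poly W H ends (id)"
    using W H D by (intro label_poly_restrict) auto
  have n33: "?L (insert s H) (id(q := p)) = mvar s * ?L (H) (id(q := p)) + ?L (H) (id(p := q', q := q'))"
    using W D ends by (intro label_poly_branch[of _ _ _ _ q q'] incident_subset[OF inc]) auto
  have n34: "?L H (id(p := p', q := p')) = label_poly W H ends (id)"
    using W H D by (intro label_poly_restrict) auto
  have n35: "?L H (id(p := p', q := p', q' := p')) = label_poly W H ends (id(q' := p'))"
    using W H D by (intro label_poly_restrict) auto
  have n36: "?L (insert s H) (id(p := p', q := p')) = mvar s * ?L (H) (id(p := p', q := p')) + ?L (H) (id(p := p', q := p', q' := p'))"
    using W D ends by (intro label_poly_branch[of _ _ _ _ q q'] incident_subset[OF inc]) auto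
  have n37: "?L (insert e (insert s H)) (id(q := p)) = mvar e * ?L (insert s H) (id(q := p)) + ?L (insert s H) (id(p := p', q := p'))"
    using W D ends by (intro label_poly_branch[of _ _ _ _ p p'] incident_subset[OF inc]) auto
  have n38: "?L (insert y (insert e (insert s H))) (id(q := p)) = mvar y * ?L (insert e (insert s H)) (id(q := p)) + ?L (insert e (insert s H)) (id(p := h, q := h))"
    using W D ends by (intro label_poly_branch[of _ _ _ _ q h] incident_subset[OF inc]) auto
  have n39: "?L (insert y (insert e (insert s H))) (id(p := h, q := h)) = mvar y * ?L (insert e (insert s H)) (id(p := h, q := h))"
    using W D ends by (intro label_poly_loop[of _ _ _ _ q h] incident_subset[OF inc]) auto
  have n40: "?L (insert x (insert y (insert e (insert s H)))) (id(q := p)) = mvar x * ?L (insert y (insert e (insert s H))) (id(q := p)) + ?L (insert y (insert e (insert s H))) (id(p := h, q := h))"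
    using W D ends by (intro label_poly_branch[of _ _ _ _ p h] incident_subset[OF inc]) auto
  have n41: "?L (insert t (insert x (insert y (insert e (insert s H))))) (id) = mvar t * ?L (insert x (insert y (insert e (insert s H)))) (id) + ?L (insert x (insert y (insert e (insert s H)))) (id(q := p))"
    using W D ends by (intro label_poly_branch[of _ _ _ _ p q] incident_subset[OF inc]) auto
  have "tree_poly (insert p (insert q W)) (insert t (insert x (insert y (insert e (insert s H))))) ends = ?L (insert t (insert x (insert y (insert e (insert s H))))) id"
    by (simp add: label_poly_def)
  then show ?thesis unfolding n41 n40 n39 n38 n37 n36 n35 n34 n33 n32 n31 n30 n29 n28 n27 n26 n25 n24 n23 n22 n21 n20 n19 n18 n17 n16 n15 n14 n13 n12 n11 n10 n9 n8 n7 n6 n5 n4 n3 n2 n1 n0 by (simp add: algebra_simps)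
qed

section \<open>Polynomials and Laurent polynomials\<close>

lemma poly_mapping_sum_single:
  "f = (\<Sum>k\<in>Poly_Mapping.keys f. Poly_Mapping.single k (Poly_Mapping.lookup f k))"
  by (rule poly_mapping_eqI)
    (auto simp: lookup_sum lookup_single when_def in_keys_iff)

lemma poly_mapping_single_induct [case_names zero single add]:
  fixes f :: "'a \<Rightarrow>\<^sub>0 'b::comm_monoid_add"
  assumes "P 0" "\<And>k c. P (Poly_Mapping.single k c)" "\<And>f g. P f \<Longrightarrow> P g \<Longrightarrow> P (f + g)"
  shows "P f"
proof -
  have "P (\<Sum>k\<in>K. Poly_Mapping.single k (Poly_Mapping.lookup f k))" for K
    by (induction K rule: infinite_finite_induct) (use assms in auto)
  then show ?thesis using poly_mapping_sum_single[of f] by metis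
qed

lemma exponent_induct [case_names zero add]:
  fixes m :: "nat \<Rightarrow>\<^sub>0 nat"
  assumes "P 0" "\<And>m i. P m \<Longrightarrow> P (m + Poly_Mapping.single i 1)"
  shows "P m"
proof (induction m rule: poly_mapping_single_induct)
  case zero
  show ?case by (rule assms)
next
  case (single k c)
  have *: "P (m + Poly_Mapping.single k c)" if "P m" for m
  proof (induction c)
    case (Suc c)
    have "P (m + Poly_Mapping.single k c + Poly_Mapping.single k 1)" using Suc assms(2) by blast
    then show ?case by (simp add: add.assoc single_add[symmetric])
  qed (use that in simp)
  show ?case using *[of 0] assms(1) by simp
next
  case (add f g)
  have "P (f + g)" if "P f" for f g
    using that
  proof (induction g arbitrary: f rule: poly_mapping_single_induct)
    case (single k c)
    show ?case
    proof (induction c)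
      case (Suc c)
      have "P (f + Poly_Mapping.single k c + Poly_Mapping.single k 1)" using Suc assms(2) by blast
      then show ?case by (simp add: add.assoc single_add[symmetric])
    qed (use single in simp)
  next
    case (add g h)
    then show ?case by (metis add.assoc)
  qed simp
  then show ?case using add by blast
qed

abbreviation mconst :: "'k::field \<Rightarrow> 'k mpoly" where
  "mconst c \<equiv> Poly_Mapping.single 0 c"

lemma mpoly_induct [case_names const add mult]:
  fixes p :: "'k::field mpoly"
  assumes "\<And>c. P (mconst c)" "\<And>p q. P p \<Longrightarrow> P q \<Longrightarrow> P (p + q)" "\<And>p i. P p \<Longrightarrow> P (p * mvar i)"
  shows "P p"
proof (induction p rule: poly_mapping_single_induct)
  case zero
  show ?case using assms(1)[of 0] by simp
next
  case (single k c)
  show ?case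
  proof (induction k rule: exponent_induct)
    case (add m i)
    then show ?case using assms(3)[of "Poly_Mapping.single m c" i] by (simp add: mvar_def mult_single)
  qed (rule assms)
qed (rule assms)

lemma pderiv_mpoly_const [simp]: "pderiv_mpoly j (mconst c) = 0"
  by (simp add: pderiv_mpoly_single)

lemma pderiv_mpoly_one [simp]: "pderiv_mpoly j 1 = 0"
  using pderiv_mpoly_const[of j 1] by simp

lemma pderiv_mpoly_of_nat [simp]: "pderiv_mpoly j (of_nat k) = 0"
  by (induction k) (simp_all add: pderiv_mpoly_add)

lemma pderiv_mpoly_mvar: "pderiv_mpoly j (mvar i) = (if i = j then 1 else 0)"
  by (simp add: mvar_def pderiv_mpoly_single lookup_single when_def)

lemma pderiv_mpoly_uminus: "pderiv_mpoly j (- p) = - pderiv_mpoly j p"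
  using pderiv_mpoly_add[of j p "- p"] by (simp add: eq_neg_iff_add_eq_0 add.commute)

lemma pderiv_mpoly_diff: "pderiv_mpoly j (p - q) = pderiv_mpoly j p - pderiv_mpoly j q"
  using pderiv_mpoly_add[of j p "- q"] by (simp add: pderiv_mpoly_uminus)

lemma pderiv_mpoly_power:
  "pderiv_mpoly j (p ^ k) = of_nat k * p ^ (k - 1) * pderiv_mpoly j p"
proof (induction k)
  case (Suc k)
  then show ?case by (cases k) (simp_all add: pderiv_mpoly_mult algebra_simps)
qed simp

section \<open>Laurent polynomials in the units Y and X (exponents in this order) with polynomial
  coefficients\<close>

type_synonym 'k laurent = "(int \<times> int) \<Rightarrow>\<^sub>0 'k mpoly"

abbreviation lconst :: "'k::field mpoly \<Rightarrow> 'k laurent" where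
  "lconst p \<equiv> Poly_Mapping.single 0 p"

abbreviation lmono :: "int \<Rightarrow> int \<Rightarrow> 'k::field laurent" where
  "lmono a b \<equiv> Poly_Mapping.single (a, b) 1"

lemma lookup_single_mult:
  fixes f :: "'a::ab_group_add \<Rightarrow>\<^sub>0 'b::semiring_0"
  shows "Poly_Mapping.lookup (Poly_Mapping.single a c * f) b = c * Poly_Mapping.lookup f (b - a)"
  by (induction f rule: poly_mapping_single_induct)
    (auto simp: mult_single lookup_single when_def distrib_left lookup_add algebra_simps)

definition eval_monom :: "(nat \<Rightarrow> 'r::comm_ring_1) \<Rightarrow> (nat \<Rightarrow>\<^sub>0 nat) \<Rightarrow> 'r" where
  "eval_monom v m = (\<Prod>i\<in>Poly_Mapping.keys m. v i ^ Poly_Mapping.lookup m i)"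

lemma eval_monom_superset:
  "finite S \<Longrightarrow> Poly_Mapping.keys m \<subseteq> S \<Longrightarrow> eval_monom v m = (\<Prod>i\<in>S. v i ^ Poly_Mapping.lookup m i)"
  unfolding eval_monom_def by (intro prod.mono_neutral_left) (auto simp: in_keys_iff)

lemma eval_monom_add: "eval_monom v (m + m') = eval_monom v m * eval_monom v m'"
proof -
  let ?S = "Poly_Mapping.keys m \<union> Poly_Mapping.keys m'"
  have "Poly_Mapping.keys (m + m') \<subseteq> ?S" by (rule Poly_Mapping.keys_add)
  then show ?thesis
    by (simp add: eval_monom_superset[of ?S] lookup_add power_add prod.distrib)
qed

definition laurent_subst :: "(nat \<Rightarrow> 'k laurent) \<Rightarrow> 'k::field mpoly \<Rightarrow> 'k laurent" where
  "laurent_subst v p = (\<Sum>m\<in>Poly_Mapping.keys p. lconst (mconst (Poly_Mapping.lookup p m)) * eval_monom v m)"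

lemma laurent_subst_superset:
  assumes "finite S" "Poly_Mapping.keys p \<subseteq> S"
  shows "laurent_subst v p = (\<Sum>m\<in>S. lconst (mconst (Poly_Mapping.lookup p m)) * eval_monom v m)"
  unfolding laurent_subst_def using assms
  by (intro sum.mono_neutral_left) (auto simp: in_keys_iff)

lemma laurent_subst_add: "laurent_subst v (p + q) = laurent_subst v p + laurent_subst v q"
proof -
  let ?S = "Poly_Mapping.keys p \<union> Poly_Mapping.keys q"
  have "Poly_Mapping.keys (p + q) \<subseteq> ?S" by (rule Poly_Mapping.keys_add)
  then show ?thesis
    by (simp add: laurent_subst_superset[of ?S] lookup_add single_add distrib_right sum.distrib)
qed

lemma laurent_subst_single:
  "laurent_subst v (Poly_Mapping.single m c) = lconst (mconst c) * eval_monom v m"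
  by (subst laurent_subst_superset[of "{m}"]) auto

lemma laurent_subst_0 [simp]: "laurent_subst v 0 = 0"
  by (simp add: laurent_subst_def)

lemma laurent_subst_const: "laurent_subst v (mconst c) = lconst (mconst c)"
  by (simp add: laurent_subst_single eval_monom_def)

lemma laurent_subst_1 [simp]: "laurent_subst v 1 = 1"
  using laurent_subst_const[of v 1] by simp

lemma laurent_subst_mvar [simp]: "laurent_subst v (mvar i) = v i"
  by (simp add: laurent_subst_single eval_monom_def mvar_def)

lemma laurent_subst_mult: "laurent_subst v (p * q) = laurent_subst v p * laurent_subst v q"
proof (induction p rule: poly_mapping_single_induct)
  case (single m c)
  show ?case
  proof (induction q rule: poly_mapping_single_induct)
    case (single m' c')
    have "lconst (mconst (c * c')) = lconst (mconst c) * lconst (mconst c')"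
      by (simp add: mult_single)
    then show ?case by (simp add: mult_single laurent_subst_single eval_monom_add algebra_simps)
  qed (simp_all add: distrib_left laurent_subst_add)
qed (simp_all add: distrib_right laurent_subst_add)

lemma laurent_subst_uminus: "laurent_subst v (- p) = - laurent_subst v p"
  using laurent_subst_add[of v p "- p"] by (simp add: eq_neg_iff_add_eq_0 add.commute)

lemma laurent_subst_diff: "laurent_subst v (p - q) = laurent_subst v p - laurent_subst v q"
  using laurent_subst_add[of v p "- q"] by (simp add: laurent_subst_uminus)

lemma laurent_subst_of_nat [simp]: "laurent_subst v (of_nat k) = of_nat k"
  by (induction k) (simp_all add: laurent_subst_add)

lemma laurent_subst_sum: "laurent_subst v (sum f S) = (\<Sum>x\<in>S. laurent_subst v (f x))"
  by (induction S rule: infinite_finite_induct) (simp_all add: laurent_subst_add)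

lemma laurent_subst_prod: "laurent_subst v (prod f S) = (\<Prod>x\<in>S. laurent_subst v (f x))"
  by (induction S rule: infinite_finite_induct) (simp_all add: laurent_subst_mult)

lemma lconst_add: "lconst (p + q) = lconst p + lconst q"
  by (rule single_add)

lemma lconst_mult: "lconst (p * q) = lconst p * lconst q"
  by (simp add: mult_single)

lemma lconst_sum: "lconst (sum f S) = (\<Sum>x\<in>S. lconst (f x))"
  by (induction S rule: infinite_finite_induct) (simp_all add: single_add)

lemma lconst_prod: "lconst (prod f S) = (\<Prod>x\<in>S. lconst (f x))"
  by (induction S rule: infinite_finite_induct) (simp_all add: lconst_mult)

section \<open>Derivations of Laurent polynomials\<close>

text \<open>\<open>D k\<close> acts on the coefficient at exponent \<open>k\<close>. The dependence
  on \<open>k\<close> brings the partial derivatives of the coefficients and the logarithmic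
  derivatives in Y and X, which multiply by an exponent, under one product rule.\<close>

locale graded_derivation =
  fixes D :: "int \<times> int \<Rightarrow> 'k::field mpoly \<Rightarrow> 'k mpoly"
  assumes D_add: "D k (a + b) = D k a + D k b"
    and D_mult: "D (k + l) (a * b) = D k a * b + a * D l b"
begin

lemma D_0: "D k 0 = 0"
  by (metis D_add add.right_neutral add_left_cancel)

lemma lookup: "Poly_Mapping.lookup (Poly_Mapping.mapp D f) k = D k (Poly_Mapping.lookup f k)"
  by (auto simp: lookup_mapp when_def in_keys_iff D_0)

lemma add: "Poly_Mapping.mapp D (f + g) = Poly_Mapping.mapp D f + Poly_Mapping.mapp D g"
  by (rule poly_mapping_eqI) (simp add: lookup lookup_add D_add)

lemma zero: "Poly_Mapping.mapp D 0 = 0"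
  by (rule poly_mapping_eqI) (simp add: lookup D_0)

lemma mapp_single: "Poly_Mapping.mapp D (Poly_Mapping.single k a) = Poly_Mapping.single k (D k a)"
  by (rule poly_mapping_eqI) (auto simp: lookup lookup_single when_def D_0)

lemma mult: "Poly_Mapping.mapp D (f * g) = Poly_Mapping.mapp D f * g + f * Poly_Mapping.mapp D g"
proof (induction f rule: poly_mapping_single_induct)
  case (single k c)
  show ?case
    by (induction g rule: poly_mapping_single_induct)
      (simp_all add: zero mult_single mapp_single D_mult single_add add distrib_left algebra_simps)
qed (simp_all add: zero add algebra_simps)

end

definition lderiv :: "nat \<Rightarrow> 'k::field laurent \<Rightarrow> 'k laurent" where
  "lderiv i = Poly_Mapping.mapp (\<lambda>_. pderiv_mpoly i)"

text \<open>Y d/dY, followed by X d/dX. The logarithmic form preserves exponents.\<close>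

definition ltheta1 :: "'k::field laurent \<Rightarrow> 'k laurent" where
  "ltheta1 = Poly_Mapping.mapp (\<lambda>k p. of_int (fst k) * p)"

definition ltheta2 :: "'k::field laurent \<Rightarrow> 'k laurent" where
  "ltheta2 = Poly_Mapping.mapp (\<lambda>k p. of_int (snd k) * p)"

interpretation lderiv: graded_derivation "\<lambda>_. pderiv_mpoly i" for i
  by unfold_locales (simp_all add: pderiv_mpoly_add pderiv_mpoly_mult)

interpretation ltheta1: graded_derivation "\<lambda>k p. of_int (fst k) * p"
  by unfold_locales (simp_all add: algebra_simps)

interpretation ltheta2: graded_derivation "\<lambda>k p. of_int (snd k) * p"
  by unfold_locales (simp_all add: algebra_simps)

lemmas lder_mult = lderiv.mult[folded lderiv_def] ltheta1.mult[folded ltheta1_def] ltheta2.mult[folded ltheta2_def]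
lemmas lder_add = lderiv.add[folded lderiv_def] ltheta1.add[folded ltheta1_def] ltheta2.add[folded ltheta2_def]
lemmas lder_0 = lderiv.zero[folded lderiv_def] ltheta1.zero[folded ltheta1_def] ltheta2.zero[folded ltheta2_def]
lemmas lder_single = lderiv.mapp_single[folded lderiv_def] ltheta1.mapp_single[folded ltheta1_def] ltheta2.mapp_single[folded ltheta2_def]
lemmas lder_lookup = lderiv.lookup[folded lderiv_def] ltheta1.lookup[folded ltheta1_def] ltheta2.lookup[folded ltheta2_def]

definition vector_field ::
  "nat set \<Rightarrow> (nat \<Rightarrow> 'k laurent) \<Rightarrow> 'k laurent \<Rightarrow> 'k laurent \<Rightarrow> 'k::field laurent \<Rightarrow> 'k laurent" where
  "vector_field I a b c f = (\<Sum>i\<in>I. a i * lderiv i f) + b * ltheta1 f + c * ltheta2 f"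

lemma vector_field_add:
  "vector_field I a b c (f + g) = vector_field I a b c f + vector_field I a b c g"
  by (simp add: vector_field_def lder_add distrib_left sum.distrib)

lemma vector_field_mult:
  "vector_field I a b c (f * g) = vector_field I a b c f * g + f * vector_field I a b c g"
  by (simp add: vector_field_def lder_mult distrib_left distrib_right sum.distrib sum_distrib_left
      sum_distrib_right algebra_simps)

lemma vector_field_0 [simp]: "vector_field I a b c 0 = 0"
  by (simp add: vector_field_def lder_0)

lemma vector_field_uminus: "vector_field I a b c (- f) = - vector_field I a b c f"
  using vector_field_add[of I a b c f "- f"] by (simp add: eq_neg_iff_add_eq_0 add.commute)

lemma vector_field_diff:
  "vector_field I a b c (f - g) = vector_field I a b c f - vector_field I a b c g"
  using vector_field_add[of I a b c f "- g"] by (simp add: vector_field_uminus)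

lemma single_of_int_lmono:
  "Poly_Mapping.single (m, n) (of_int j) = of_int j * (lmono m n :: 'k::field laurent)"
proof -
  have "of_int j * (lmono m n :: 'k laurent) = lconst (of_int j) * lmono m n"
    by (simp only: single_of_int)
  then show ?thesis by (simp only: mult_single add_0_left mult_1_right)
qed

lemma vector_field_lmono:
  "vector_field I a b c (lmono m n) = (of_int m * b + of_int n * c) * lmono m n"
  by (simp add: vector_field_def lder_single single_of_int_lmono algebra_simps)

lemma vector_field_mvar:
  assumes "finite I"
  shows "vector_field I a b c (lconst (mvar i)) = (if i \<in> I then a i else 0)"
proof -
  have "vector_field I a b c (lconst (mvar i)) = (\<Sum>j\<in>I. if i = j then a j else 0)"
    by (auto simp: vector_field_def lder_single pderiv_mpoly_mvar fst_zero snd_zero intro!: sum.cong)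
  then show ?thesis using assms by simp
qed

lemma vector_field_const: "vector_field I a b c (lconst (mconst r)) = 0"
  by (simp add: vector_field_def lder_single fst_zero snd_zero)

text \<open>The chain rule: such a field lifts the derivative in the variable \<open>j\<close> along
  the substitution.\<close>

lemma vector_field_subst:
  assumes "\<And>i. vector_field I a b c (v i) = (if i = j then 1 else 0)"
  shows "vector_field I a b c (laurent_subst v p) = laurent_subst v (pderiv_mpoly j p)"
proof (induction p rule: mpoly_induct)
  case (const r)
  show ?case by (simp add: laurent_subst_const vector_field_const)
next
  case (add p q)
  then show ?case by (simp add: laurent_subst_add vector_field_add pderiv_mpoly_add)
next
  case (mult p i)
  then show ?case
    by (simp add: laurent_subst_add laurent_subst_mult vector_field_mult pderiv_mpoly_mult assms pderiv_mpoly_mvar)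
qed

section \<open>Functionals annihilating total derivatives\<close>

text \<open>
  The value \<open>l k P\<close> stands for the integral of \<open>P / F\<^sup>k\<close> over a cycle in the complement of \<open>F = 0\<close>: the
  second condition says that it depends only on this fraction, the third one that it vanishes on
  \<open>\<partial>\<^sub>i (P / F\<^sup>k)\<close>.
\<close>

definition period_functional :: "(nat \<Rightarrow> 'k mpoly \<Rightarrow> 'k) \<Rightarrow> nat set \<Rightarrow> 'k::field mpoly \<Rightarrow> bool" where
  "period_functional l V F \<longleftrightarrow> (\<forall>k P Q. l k (P + Q) = l k P + l k Q) \<and>
     (\<forall>k P. l (Suc k) (F * P) = l k P) \<and>
     (\<forall>i\<in>V. \<forall>k P. l (Suc k) (F * pderiv_mpoly i P - of_nat k * P * pderiv_mpoly i F) = 0)"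

context
  fixes l :: "nat \<Rightarrow> 'k mpoly \<Rightarrow> 'k::field" and V F
  assumes l: "period_functional l V F"
begin

lemma period_add: "l k (P + Q) = l k P + l k Q"
  using l by (simp add: period_functional_def)

lemma period_0: "l k 0 = 0"
  by (metis period_add add.right_neutral add_left_cancel)

lemma period_sum: "l k (sum f S) = (\<Sum>x\<in>S. l k (f x))"
  by (induction S rule: infinite_finite_induct) (simp_all add: period_add period_0)

lemma period_mult: "l (Suc k) (F * P) = l k P"
  using l by (simp add: period_functional_def)

lemma period_mult_power: "l (k + m) (F ^ m * P) = l k P"
  by (induction m) (simp_all add: period_mult mult.assoc)

lemma period_deriv:
  "i \<in> V \<Longrightarrow> l (Suc k) (F * pderiv_mpoly i P - of_nat k * P * pderiv_mpoly i F) = 0"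
  using l by (simp add: period_functional_def)

text \<open>
  The condition \<open>div\<close> says that the vector field preserves the form \<open>(Y / X) dY dX \<and> (dA\<^sub>i)\<^sub>i\<close> in the
  coordinates \<open>Y\<close>, \<open>X\<close>, \<open>A\<^sub>i\<close>, the integral over \<open>Y\<close> and \<open>X\<close> being a residue.
\<close>

lemma period_vector_field:
  fixes a :: "nat \<Rightarrow> 'k laurent" and r :: int
  assumes I: "I \<subseteq> V"
    and div: "2 * b + ltheta1 b + ltheta2 c + (\<Sum>i\<in>I. lderiv i (a i)) = 0"
    and r: "r = 0 \<or> c = 0"
  defines "G \<equiv> lmono 1 0 * lconst F"
  shows "l (Suc k) (Poly_Mapping.lookup
    (G * vector_field I a b c p - of_nat k * p * vector_field I a b c G) (int k - 1, r)) = 0"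
proof -
  \<comment> \<open>Since (Y / X) dY dX = Y^2 dlog Y dlog X, the logarithmic divergence in
    \<open>div\<close> contains the extra term \<open>2 * b\<close>. The factor Y of
    \<open>G\<close> shifts the index \<open>int k - 1\<close> to \<open>int k - 2\<close>.\<close>
  let ?Y = "lmono 1 0 :: 'k laurent" and ?F = "lconst F" and ?n = "(int k - 2, r)"
  let ?S = "\<Sum>i\<in>I. ?F * lderiv i (a i * p) - of_nat k * (a i * p) * lconst (pderiv_mpoly i F)"
  let ?R = "ltheta1 (b * p) + ltheta2 (c * p) - (of_nat k - 2) * (b * p)"
  have G: "vector_field I a b c G = ?Y * ((\<Sum>i\<in>I. a i * lconst (pderiv_mpoly i F)) + b * ?F)"
    by (simp add: G_def vector_field_def mult_single lder_single distrib_left sum_distrib_left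
        mult.left_commute[of ?Y] flip: mult.assoc) (simp add: mult_single mult.assoc algebra_simps)
  have 1: "?S = ?F * (\<Sum>i\<in>I. a i * lderiv i p) + ?F * p * (\<Sum>i\<in>I. lderiv i (a i))
      - of_nat k * p * (\<Sum>i\<in>I. a i * lconst (pderiv_mpoly i F))"
    by (simp add: lder_mult sum_distrib_left sum_subtractf sum.distrib algebra_simps)
  have "G * vector_field I a b c p - of_nat k * p * vector_field I a b c G =
    ?Y * (?S + ?F * ?R - ?F * p * (2 * b + ltheta1 b + ltheta2 c + (\<Sum>i\<in>I. lderiv i (a i))))"
    unfolding 1 G unfolding G_def vector_field_def lder_mult by (simp add: algebra_simps)
  then have E: "G * vector_field I a b c p - of_nat k * p * vector_field I a b c G = ?Y * (?S + ?F * ?R)"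
    unfolding div by simp
  have nat: "Poly_Mapping.lookup (of_nat k * f) n = of_nat k * Poly_Mapping.lookup f n"
    for f :: "'k laurent" and n
    using lookup_single_mult[of 0 "of_nat k" f n] by simp
  \<comment> \<open>At this index \<open>ltheta1\<close> multiplies by \<open>int k - 2\<close>,
    which cancels the last term of \<open>?R\<close>, and \<open>ltheta2\<close> multiplies by
    \<open>r\<close>, where \<open>r\<close> or \<open>c\<close> is 0.\<close>
  have "Poly_Mapping.lookup ?R ?n = 0"
  proof -
    have "(of_nat k - 2) * (b * p) = of_nat k * (b * p) - (b * p + b * p)"
      by (simp add: algebra_simps)
    moreover have "of_int (snd ?n) * Poly_Mapping.lookup (c * p) ?n = 0" using r by auto
    ultimately show ?thesis
      by (simp only: lookup_add lookup_minus lder_lookup nat fst_conv) (simp add: algebra_simps)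
  qed
  then have "Poly_Mapping.lookup (?F * ?R) ?n = 0" by (simp only: lookup_single_mult) simp
  moreover have "Poly_Mapping.lookup (?F * lderiv i (a i * p) - of_nat k * (a i * p) * lconst (pderiv_mpoly i F)) ?n =
    F * pderiv_mpoly i (Poly_Mapping.lookup (a i * p) ?n) -
    of_nat k * Poly_Mapping.lookup (a i * p) ?n * pderiv_mpoly i F" for i
    using lookup_single_mult[of 0 "pderiv_mpoly i F" "a i * p" ?n]
    by (simp add: lookup_minus lookup_single_mult lder_lookup nat mult.assoc mult.commute[of "lconst (pderiv_mpoly i F)"])
  ultimately have "Poly_Mapping.lookup (?Y * (?S + ?F * ?R)) (int k - 1, r) =
    (\<Sum>i\<in>I. F * pderiv_mpoly i (Poly_Mapping.lookup (a i * p) ?n) -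
      of_nat k * Poly_Mapping.lookup (a i * p) ?n * pderiv_mpoly i F)"
    by (simp add: lookup_single_mult lookup_add lookup_sum)
  then show ?thesis unfolding E using I by (auto simp: period_sum period_deriv intro!: sum.neutral)
qed

end

text \<open>
  The star-triangle move: \<open>Y = A\<^sub>x + A\<^sub>y + A\<^sub>t\<close> and \<open>X = A\<^sub>y\<close> become units, and \<open>A\<^sub>x A\<^sub>y / Y\<close>,
  \<open>A\<^sub>s + A\<^sub>y A\<^sub>t / Y\<close>, \<open>A\<^sub>e + A\<^sub>x A\<^sub>t / Y\<close> are the new variables \<open>A\<^sub>x\<close>, \<open>A\<^sub>s\<close>, \<open>A\<^sub>e\<close>.
\<close>

definition star_triangle_subst :: "nat \<Rightarrow> nat \<Rightarrow> nat \<Rightarrow> nat \<Rightarrow> nat \<Rightarrow> nat \<Rightarrow> 'k::field laurent" where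
  "star_triangle_subst x y t s e =
    (let T = lmono 1 0 - lmono 0 1 - lmono 1 0 * lmono 0 (- 1) * lconst (mvar x)
     in (\<lambda>i. lconst (mvar i))
      (x := lmono 1 0 * lmono 0 (- 1) * lconst (mvar x),
       y := lmono 0 1,
       t := T,
       s := lconst (mvar s) - lmono 0 1 * lmono (- 1) 0 * T,
       e := lconst (mvar e) - lmono 0 (- 1) * lconst (mvar x) * T))"

lemma lmono_inverse: "lmono 1 0 * lmono (- 1) 0 = (1 :: 'k::field laurent)"
    "lmono 0 1 * lmono 0 (- 1) = (1 :: 'k::field laurent)"
  by (simp_all add: mult_single flip: zero_prod_def)

section \<open>Derivations and functionals under the star-triangle substitution\<close>

locale star_triangle =
  fixes x y t s e :: nat
  assumes dist: "distinct [x, y, t, s, e]"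
begin

lemma ne: "x \<noteq> y" "x \<noteq> t" "x \<noteq> s" "x \<noteq> e" "y \<noteq> t" "y \<noteq> s" "y \<noteq> e" "t \<noteq> s" "t \<noteq> e" "s \<noteq> e"
  using dist by auto

lemma vector_field_shift:
  assumes "j \<notin> {x, y, t}"
  shows "vector_field {j} (\<lambda>_. 1) 0 0 (star_triangle_subst x y t s e i :: 'k::field laurent) =
    (if i = j then 1 else 0)"
  using assms ne
  by (auto simp: star_triangle_subst_def Let_def vector_field_diff vector_field_mult
      vector_field_lmono vector_field_mvar)

text \<open>The components along \<open>x\<close>, \<open>s\<close>, \<open>e\<close> of the lift of
  d/dA_j: the A_j-derivatives of A_x A_y / Y, A_s + A_y A_t / Y and A_e + A_x A_t / Y, rewritten in
  the new coordinates. \<open>T\<close> is A_t.\<close>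

definition coef :: "nat \<Rightarrow> nat \<Rightarrow> 'k::field laurent" where
  "coef j = (let Y = lmono 1 0; Y' = lmono (- 1) 0; X = lmono 0 1; X' = lmono 0 (- 1);
      A = lconst (mvar x); T = Y - X - Y * X' * A
    in if j = x then (\<lambda>_. 0)(x := X * Y' - A * Y', s := - X * T * Y' * Y', e := T * Y' - A * T * X' * Y')
    else if j = t then (\<lambda>_. 0)(x := - A * Y', s := X * Y' - X * T * Y' * Y', e := A * X' - A * T * X' * Y')
    else (\<lambda>_. 0)(x := A * X' - A * Y', s := T * Y' - X * T * Y' * Y', e := - A * T * X' * Y'))"

text \<open>Y has derivative 1 in each of A_x, A_y, A_t, and X = A_y only in A_y. Dividing these
  values by Y and X gives the two logarithmic components.\<close>

lemma vector_field_coef: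
  assumes "j \<in> {x, y, t}"
  shows "vector_field {x, s, e} (coef j) (lmono (- 1) 0) (if j = y then lmono 0 (- 1) else 0)
    (star_triangle_subst x y t s e i :: 'k::field laurent) = (if i = j then 1 else 0)"
proof -
  let ?Y = "lmono 1 0 :: 'k laurent" and ?Yi = "lmono (- 1) 0 :: 'k laurent"
    and ?X = "lmono 0 1 :: 'k laurent" and ?Xi = "lmono 0 (- 1) :: 'k laurent"
    and ?A = "lconst (mvar x) :: 'k laurent"
  let ?c = "if j = y then ?Xi else 0"
  let ?D = "vector_field {x, s, e} (coef j) ?Yi ?c"
  note inv = lmono_inverse[where 'k = 'k]
  have inv': "?Yi * ?Y = 1" "?Xi * ?X = 1" using inv by (simp_all only: mult.commute)
  have DY: "?D ?Y = 1" "?D ?Yi = - ?Yi * ?Yi"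
    by (simp_all add: vector_field_lmono inv')
  have DX: "?D ?X = (if j = y then 1 else 0)" "?D ?Xi = - ?c * ?Xi"
    by (simp_all add: vector_field_lmono inv')
  have DA: "?D (lconst (mvar m)) = (if m \<in> {x, s, e} then coef j m else 0)" for m
    by (rule vector_field_mvar) simp
  consider "i \<notin> {x, y, t, s, e}" | "i \<in> {x, y, t, s, e}" by blast
  then show ?thesis
  proof cases
    case 1
    then show ?thesis using DA[of i] assms by (auto simp: star_triangle_subst_def Let_def)
  next
    case 2
    \<comment> \<open>Opaque letters hide the monomials, so that only \<open>u * v = 1\<close> and
      \<open>w * z = 1\<close> enter and the claim becomes a polynomial identity.\<close>
    define u v w z A B C where "u = ?Y" and "v = ?Yi" and "w = ?X" and "z = ?Xi" and "A = ?A"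
      and "B = (lconst (mvar s) :: 'k laurent)" and "C = (lconst (mvar e) :: 'k laurent)"
    have uv: "u * v = 1" "w * z = 1" using inv by (simp_all add: u_def v_def w_def z_def)
    have uv': "u * (v * f) = f" "w * (z * f) = f" for f
      using uv by (simp_all flip: mult.assoc)
    define D where "D = ?D"
    have D_rules: "D (f - g) = D f - D g" "D (f * g) = D f * g + f * D g" for f g
      by (simp_all add: D_def vector_field_diff vector_field_mult)
    have D1: "D u = 1" "D w = (if j = y then 1 else 0)" "D z = (if j = y then - z * z else 0)" "D v = - v * v"
      using DY DX by (simp_all add: D_def u_def v_def w_def z_def)
    have D2: "D A = coef j x" "D B = coef j s" "D C = coef j e"
      using DA by (simp_all add: D_def A_def B_def C_def)
    have coef: "coef j = (let T = u - w - u * z * A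
      in if j = x then (\<lambda>_. 0)(x := w * v - A * v, s := - w * T * v * v, e := T * v - A * T * z * v)
      else if j = t then (\<lambda>_. 0)(x := - A * v, s := w * v - w * T * v * v, e := A * z - A * T * z * v)
      else (\<lambda>_. 0)(x := A * z - A * v, s := T * v - w * T * v * v, e := - A * T * z * v))"
      by (simp only: coef_def Let_def u_def v_def w_def z_def A_def)
    have S: "star_triangle_subst x y t s e = (let T = u - w - u * z * A
      in (\<lambda>i. lconst (mvar i))(x := u * z * A, y := w, t := T, s := B - w * v * T, e := C - z * A * T))"
      by (simp only: star_triangle_subst_def Let_def u_def v_def w_def z_def A_def B_def C_def)
    have "D (star_triangle_subst x y t s e i) = (if i = j then 1 else 0)"
      unfolding S using 2 assms ne
      by (auto simp: Let_def D_rules D1 D2[unfolded coef Let_def]; simp add: algebra_simps uv uv')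
    then show ?thesis by (simp add: D_def)
  qed
qed

text \<open>A coordinate derivation preserves the volume form in the old variables, which up to sign
  is (Y / X) dY dX times the new differentials; so its lift has divergence 0 for that form.\<close>

lemma divergence_coef:
  assumes "j \<in> {x, y, t}"
  shows "2 * lmono (- 1) 0 + ltheta1 (lmono (- 1) 0) + ltheta2 (if j = y then lmono 0 (- 1) else 0) +
    (\<Sum>i\<in>{x, s, e}. lderiv i (coef j i :: 'k::field laurent)) = 0"
proof -
  have m: "ltheta1 (lmono (- 1) 0 :: 'k laurent) = - lmono (- 1) 0" "ltheta2 (lmono 0 (- 1) :: 'k laurent) = - lmono 0 (- 1)"
    by (simp_all add: lder_single single_uminus)
  have d: "lderiv i (lmono a b :: 'k laurent) = 0" for i a b by (simp add: lder_single)
  have A: "lderiv i (lconst (mvar m) :: 'k laurent) = (if m = i then 1 else 0)" for i m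
    by (simp add: lder_single pderiv_mpoly_mvar)
  have diff: "lderiv i (f - g) = lderiv i f - lderiv i g" for i and f g :: "'k laurent"
    using lder_add(1)[of i "f - g" g] by (simp add: algebra_simps)
  have neg: "lderiv i (- f) = - lderiv i f" for i and f :: "'k laurent"
    using diff[of i 0 f] by (simp add: lder_0)
  show ?thesis using assms ne
    by (auto simp: coef_def Let_def lder_mult diff neg d A m lder_0)
qed

text \<open>The Jacobian Y / X and F' = Y F turn P / F'^k into Y^(1 - k) P / (X F^k), whose residue
  in Y and X is the coefficient of Y^(k - 2) X^0. Another exponent \<open>r\<close> of X is possible
  when A_y, hence X, is constant for all derivations in \<open>V'\<close>.\<close>

lemma period_functional_transfer:
  fixes l :: "nat \<Rightarrow> 'k mpoly \<Rightarrow> 'k::field"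
  assumes l: "period_functional l V F" and V: "{x, s, e} \<subseteq> V" "V' \<subseteq> insert y (insert t V)"
    and F': "laurent_subst (star_triangle_subst x y t s e) F' = lmono 1 0 * lconst F"
    and r: "r = 0 \<or> y \<notin> V'"
  shows "period_functional
    (\<lambda>k P. l k (Poly_Mapping.lookup (laurent_subst (star_triangle_subst x y t s e) P) (int k - 2, r))) V' F'"
proof -
  let ?\<sigma> = "laurent_subst (star_triangle_subst x y t s e) :: 'k mpoly \<Rightarrow> 'k laurent"
  have 1: "Poly_Mapping.lookup (?\<sigma> (F' * P)) (int (Suc k) - 2, r) = F * Poly_Mapping.lookup (?\<sigma> P) (int k - 2, r)" for k P
    by (simp add: laurent_subst_mult F' mult.assoc lookup_single_mult)
  have 2: "l (Suc k) (Poly_Mapping.lookup (?\<sigma> (F' * pderiv_mpoly j P - of_nat k * P * pderiv_mpoly j F'))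
      (int (Suc k) - 2, r)) = 0" if j: "j \<in> V'" for j k P
  proof -
    have "\<exists>I a b c. I \<subseteq> V \<and> 2 * b + ltheta1 b + ltheta2 c + (\<Sum>i\<in>I. lderiv i (a i)) = 0 \<and> (r = 0 \<or> c = 0) \<and>
      (\<forall>i. vector_field I a b c (star_triangle_subst x y t s e i :: 'k laurent) = (if i = j then 1 else 0))"
    proof (cases "j \<in> {x, y, t}")
      case True
      then show ?thesis using V r j vector_field_coef[OF True, where 'k = 'k] divergence_coef[OF True, where 'k = 'k]
        by (intro exI[of _ "{x, s, e}"] exI[of _ "coef j"] exI[of _ "lmono (- 1) 0"]
            exI[of _ "if j = y then lmono 0 (- 1) else 0"] conjI allI) auto
    next
      case False
      moreover have "lderiv j 1 = (0 :: 'k laurent)"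
        using lder_single(1)[of j 0 1] by simp
      ultimately show ?thesis using V j vector_field_shift[OF False, where 'k = 'k]
        by (intro exI[of _ "{j}"] exI[of _ "\<lambda>_. 1"] exI[of _ 0] conjI allI) (auto simp: lder_0)
    qed
    then obtain I a b c where I: "I \<subseteq> V" "2 * b + ltheta1 b + ltheta2 c + (\<Sum>i\<in>I. lderiv i (a i)) = 0"
        "r = 0 \<or> c = 0"
      and D: "\<And>i. vector_field I a b c (star_triangle_subst x y t s e i :: 'k laurent) = (if i = j then 1 else 0)"
      by blast
    have "?\<sigma> (F' * pderiv_mpoly j P - of_nat k * P * pderiv_mpoly j F') =
      lmono 1 0 * lconst F * vector_field I a b c (?\<sigma> P) - of_nat k * ?\<sigma> P * vector_field I a b c (lmono 1 0 * lconst F)"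
      by (simp add: laurent_subst_diff laurent_subst_mult F'[symmetric] vector_field_subst[OF D])
    then show ?thesis using period_vector_field[OF l I, of k "?\<sigma> P"] by simp
  qed
  show ?thesis unfolding period_functional_def
    using 1 2 by (simp add: laurent_subst_add lookup_add period_add[OF l] period_mult[OF l])
qed

end

section \<open>The apolar pairing\<close>

definition exponent_fact :: "(nat \<Rightarrow>\<^sub>0 nat) \<Rightarrow> 'k::field_char_0" where
  "exponent_fact m = (\<Prod>i\<in>Poly_Mapping.keys m. fact (Poly_Mapping.lookup m i))"

lemma exponent_fact_superset:
  "finite S \<Longrightarrow> Poly_Mapping.keys m \<subseteq> S \<Longrightarrow>
    exponent_fact m = (\<Prod>i\<in>S. fact (Poly_Mapping.lookup m i))"
  unfolding exponent_fact_def by (intro prod.mono_neutral_left) (auto simp: in_keys_iff)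

lemma exponent_fact_add_single:
  "exponent_fact (m + Poly_Mapping.single i 1) =
    (of_nat (Poly_Mapping.lookup m i + 1) * exponent_fact m :: 'k::field_char_0)"
proof -
  let ?S = "insert i (Poly_Mapping.keys m)" and ?m = "m + Poly_Mapping.single i 1"
  have "Poly_Mapping.keys ?m \<subseteq> ?S"
    using Poly_Mapping.keys_add[of m "Poly_Mapping.single i 1"] by auto
  then have "exponent_fact ?m = (\<Prod>j\<in>?S. fact (Poly_Mapping.lookup ?m j) :: 'k)"
    by (intro exponent_fact_superset) auto
  also have "\<dots> = fact (Poly_Mapping.lookup m i + 1) * (\<Prod>j\<in>?S - {i}. fact (Poly_Mapping.lookup ?m j))"
    by (subst prod.remove[of _ i]) (simp_all add: lookup_add)
  also have "(\<Prod>j\<in>?S - {i}. fact (Poly_Mapping.lookup ?m j)) =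
      (\<Prod>j\<in>?S - {i}. fact (Poly_Mapping.lookup m j) :: 'k)"
    by (intro prod.cong) (auto simp: lookup_add lookup_single when_def)
  also have "fact (Poly_Mapping.lookup m i + 1) * \<dots> = of_nat (Poly_Mapping.lookup m i + 1) *
      (fact (Poly_Mapping.lookup m i) * (\<Prod>j\<in>?S - {i}. fact (Poly_Mapping.lookup m j)))"
    by (simp add: algebra_simps)
  also have "fact (Poly_Mapping.lookup m i) * (\<Prod>j\<in>?S - {i}. fact (Poly_Mapping.lookup m j)) =
      (\<Prod>j\<in>?S. fact (Poly_Mapping.lookup m j) :: 'k)"
    by (subst prod.remove[of ?S i]) auto
  also have "\<dots> = exponent_fact m" by (rule exponent_fact_superset[symmetric]) auto
  finally show ?thesis .
qed

text \<open>The value at the origin of P(d/dA) G; multiplication by a variable is adjoint to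
  differentiation in it.\<close>

definition apolar :: "'k::field_char_0 mpoly \<Rightarrow> 'k mpoly \<Rightarrow> 'k" where
  "apolar P G = (\<Sum>m\<in>Poly_Mapping.keys P. Poly_Mapping.lookup P m * Poly_Mapping.lookup G m * exponent_fact m)"

lemma apolar_superset:
  "finite S \<Longrightarrow> Poly_Mapping.keys P \<subseteq> S \<Longrightarrow>
    apolar P G = (\<Sum>m\<in>S. Poly_Mapping.lookup P m * Poly_Mapping.lookup G m * exponent_fact m)"
  unfolding apolar_def by (intro sum.mono_neutral_left) (auto simp: in_keys_iff)

lemma apolar_add: "apolar (P + Q) G = apolar P G + apolar Q G"
proof -
  let ?S = "Poly_Mapping.keys P \<union> Poly_Mapping.keys Q"
  have "Poly_Mapping.keys (P + Q) \<subseteq> ?S" by (rule Poly_Mapping.keys_add)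
  then show ?thesis by (simp add: apolar_superset[of ?S] lookup_add algebra_simps sum.distrib)
qed

lemma apolar_commute: "apolar P G = apolar G P"
proof -
  let ?S = "Poly_Mapping.keys P \<union> Poly_Mapping.keys G"
  show ?thesis by (simp add: apolar_superset[of ?S] mult.commute)
qed

lemma apolar_0 [simp]: "apolar 0 G = 0" "apolar P 0 = 0"
  by (simp_all add: apolar_def)

lemma apolar_add_right: "apolar P (G + H) = apolar P G + apolar P H"
  by (metis apolar_add apolar_commute)

lemma apolar_sum_right: "apolar P (sum f S) = (\<Sum>x\<in>S. apolar P (f x))"
  by (induction S rule: infinite_finite_induct) (simp_all add: apolar_add_right)

lemma apolar_of_nat_right: "apolar P (of_nat k * G) = of_nat k * apolar P G"
  by (induction k) (simp_all add: apolar_add_right algebra_simps)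

lemma apolar_of_nat_left: "apolar (of_nat k * P) G = of_nat k * apolar P G"
  by (metis apolar_commute apolar_of_nat_right)

lemma apolar_diff: "apolar (P - Q) G = apolar P G - apolar Q G"
  using apolar_add[of "P - Q" Q G] by simp

lemma apolar_1_1: "apolar 1 (1 :: 'k::field_char_0 mpoly) = 1"
proof -
  have "apolar (1 :: 'k mpoly) 1 = (\<Sum>m\<in>{0}. Poly_Mapping.lookup (1 :: 'k mpoly) m * Poly_Mapping.lookup (1 :: 'k mpoly) m * exponent_fact m)"
    by (intro apolar_superset) (auto simp: in_keys_iff lookup_one when_def split: if_splits)
  then show ?thesis by (simp add: lookup_one exponent_fact_def)
qed

lemma lookup_pderiv_mpoly:
  "Poly_Mapping.lookup (pderiv_mpoly i G) m =
    of_nat (Poly_Mapping.lookup m i + 1) * Poly_Mapping.lookup G (m + Poly_Mapping.single i 1)"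
proof (induction G rule: poly_mapping_single_induct)
  case (single k c)
  have eq: "k - Poly_Mapping.single i 1 = m \<longleftrightarrow> k = m + Poly_Mapping.single i 1"
    if "Poly_Mapping.lookup k i \<noteq> 0"
  proof -
    have "k - Poly_Mapping.single i 1 + Poly_Mapping.single i 1 = k"
      using that by (intro poly_mapping_eqI) (auto simp: lookup_add lookup_minus lookup_single when_def)
    then show ?thesis by (metis add_diff_cancel_right')
  qed
  show ?case
  proof (cases "Poly_Mapping.lookup k i = 0")
    case True
    then have "k \<noteq> m + Poly_Mapping.single i 1" by (auto simp: lookup_add)
    with True show ?thesis by (simp add: pderiv_mpoly_single lookup_single)
  next
    case False
    show ?thesis
    proof (cases "k = m + Poly_Mapping.single i 1")
      case True
      then show ?thesis by (simp add: pderiv_mpoly_single lookup_add algebra_simps)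
    next
      case neq: False
      with eq[OF False] have "k - Poly_Mapping.single i 1 \<noteq> m" by blast
      with neq show ?thesis by (simp add: pderiv_mpoly_single lookup_single)
    qed
  qed
qed (simp_all add: lookup_add pderiv_mpoly_add algebra_simps)

lemma apolar_mvar_mult: "apolar (mvar i * P) G = apolar P (pderiv_mpoly i G)"
proof (induction P rule: poly_mapping_single_induct)
  case (single m c)
  have *: "apolar (Poly_Mapping.single m c) H = c * Poly_Mapping.lookup H m * exponent_fact m"
    for m and c :: 'a and H
    by (subst apolar_superset[of "{m}"]) auto
  show ?case
    by (simp add: mvar_def mult_single * lookup_pderiv_mpoly exponent_fact_add_single[simplified]
        add.commute[of "Poly_Mapping.single i (Suc 0)"] algebra_simps)
qed (simp_all add: apolar_add distrib_left)

lemma apolar_pderiv: "apolar (pderiv_mpoly i P) G = apolar P (mvar i * G)"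
  by (metis apolar_commute apolar_mvar_mult)

lemma apolar_quadratic:
  "apolar ((\<Sum>(a, b)\<leftarrow>ps. mvar a * mvar b) * P) G = apolar P (\<Sum>(a, b)\<leftarrow>ps. pderiv_mpoly b (pderiv_mpoly a G))"
proof (induction ps)
  case (Cons p ps)
  then show ?case
    by (cases p) (simp add: distrib_right apolar_add apolar_add_right mult.assoc apolar_mvar_mult)
qed simp

text \<open>Reduces the action of a second-order operator on powers of \<open>g\<close> to its value
  on \<open>g\<close> and its symbol at the gradient of \<open>g\<close>.\<close>

lemma quadratic_pderiv_power:
  "(\<Sum>(a, b)\<leftarrow>ps. pderiv_mpoly b (pderiv_mpoly a (g ^ Suc s))) =
    of_nat (Suc s) * (g ^ s * (\<Sum>(a, b)\<leftarrow>ps. pderiv_mpoly b (pderiv_mpoly a g)) +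
      of_nat s * g ^ (s - 1) * (\<Sum>(a, b)\<leftarrow>ps. pderiv_mpoly a g * pderiv_mpoly b g))"
proof (induction ps)
  case (Cons p ps)
  have "pderiv_mpoly b (pderiv_mpoly a (g ^ Suc s)) =
    of_nat (Suc s) * (g ^ s * pderiv_mpoly b (pderiv_mpoly a g) +
      of_nat s * g ^ (s - 1) * (pderiv_mpoly a g * pderiv_mpoly b g))" for a b
    by (simp only: pderiv_mpoly_power pderiv_mpoly_mult pderiv_mpoly_of_nat diff_Suc_1)
      (simp add: algebra_simps)
  with Cons show ?case by (cases p) (simp only: list.map sum_list.Cons prod.case distrib_left add_ac)
qed simp

section \<open>The complete graph on four vertices\<close>

text \<open>
  For \<open>K\<^sub>4\<close> the graph polynomial is the determinant of the generic symmetric \<open>3 \<times> 3\<close> matrix.  With respect to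
  the apolar pairing the dual matrix has diagonal \<open>b\<^sub>1, b\<^sub>2, b\<^sub>3\<close> and off-diagonal entries
  \<open>(b\<^sub>1 + b\<^sub>2 - a\<^sub>3) / 2\<close> etc.; \<open>k4_dual\<close> is four times its determinant, and the functional pairs with its
  powers (this is the invariant integral over \<open>SU(3) / SO(3)\<close>).
\<close>

lemma adjugate_identities:
  fixes A1 A2 A3 B1 B2 B3 :: "'a::idom"
  defines "p \<equiv> B1 + B2 - A3" and "q \<equiv> B1 + B3 - A2" and "r \<equiv> B2 + B3 - A1"
  defines "g \<equiv> 4 * B1 * B2 * B3 + p * q * r - B3 * p * p - B2 * q * q - B1 * r * r"
  defines "Da1 \<equiv> 2 * B1 * r - p * q" and "Da2 \<equiv> 2 * B2 * q - p * r" and "Da3 \<equiv> 2 * B3 * p - q * r"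
    and "Db1 \<equiv> 4 * B2 * B3 + q * r + p * r - 2 * B3 * p - 2 * B2 * q - r * r"
    and "Db2 \<equiv> 4 * B1 * B3 + q * r + p * q - 2 * B3 * p - 2 * B1 * r - q * q"
    and "Db3 \<equiv> 4 * B1 * B2 + p * r + p * q - 2 * B2 * q - 2 * B1 * r - p * p"
  shows "Da2 * Db1 + Da2 * Db2 + Da2 * Db3 + Da3 * Db1 + Da3 * Db2 + Da3 * Db3 + Db1 * Db2 + Db1 * Db3 = 4 * (A1 * g)"
    and "Da1 * Db1 + Da1 * Db2 + Da1 * Db3 + Da3 * Db1 + Da3 * Db2 + Da3 * Db3 + Db1 * Db2 + Db2 * Db3 = 4 * (A2 * g)"
    and "Da1 * Db1 + Da1 * Db2 + Da1 * Db3 + Da2 * Db1 + Da2 * Db2 + Da2 * Db3 + Db1 * Db3 + Db2 * Db3 = 4 * (A3 * g)"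
    and "Da1 * Da2 + Da1 * Da3 + Da1 * Db2 + Da1 * Db3 + Da2 * Da3 + Da2 * Db2 + Da3 * Db3 + Db2 * Db3 = 4 * (B1 * g)"
    and "Da1 * Da2 + Da1 * Da3 + Da1 * Db1 + Da2 * Da3 + Da2 * Db1 + Da2 * Db3 + Da3 * Db3 + Db1 * Db3 = 4 * (B2 * g)"
    and "Da1 * Da2 + Da1 * Da3 + Da1 * Db1 + Da2 * Da3 + Da2 * Db2 + Da3 * Db1 + Da3 * Db2 + Db1 * Db2 = 4 * (B3 * g)"
  unfolding assms by algebra+

locale k4 =
  fixes a1 a2 a3 b1 b2 b3 :: nat
  assumes dist: "distinct [a1, a2, a3, b1, b2, b3]"
begin

definition k4_poly :: "'k::field_char_0 mpoly" where
  "k4_poly = mvar a1 * mvar a2 * mvar b1 + mvar a1 * mvar a2 * mvar b2 + mvar a1 * mvar a2 * mvar b3 + mvar a1 * mvar a3 * mvar b1 + mvar a1 * mvar a3 * mvar b2 + mvar a1 * mvar a3 * mvar b3 + mvar a1 * mvar b1 * mvar b2 + mvar a1 * mvar b1 * mvar b3 + mvar a2 * mvar a3 * mvar b1 + mvar a2 * mvar a3 * mvar b2 + mvar a2 * mvar a3 * mvar b3 + mvar a2 * mvar b1 * mvar b2 + mvar a2 * mvar b2 * mvar b3 + mvar a3 * mvar b1 * mvar b3 + mvar a3 * mvar b2 * mvar b3 + mvar b1 * mvar b2 * mvar b3"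

text \<open>\<open>k4_poly\<close> is the determinant of M(A), the sum of A_e c_e c_e^T with c_e the
  unit vector e_i for the edge b_i and e_i - e_j for the edge a_k. Requiring tr(M(A) N) to be the
  sum of A_e B_e gives a symmetric N the coordinates B_e = c_e^T N c_e; solving for N yields the
  dual matrix, with \<open>p\<close>, \<open>q\<close>, \<open>r\<close> twice its off-diagonal
  entries.\<close>

definition k4_dual :: "'k::field_char_0 mpoly" where
  "k4_dual = (let A1 = mvar a1; A2 = mvar a2; A3 = mvar a3; B1 = mvar b1; B2 = mvar b2; B3 = mvar b3;
     p = B1 + B2 - A3; q = B1 + B3 - A2; r = B2 + B3 - A1
     in 4 * B1 * B2 * B3 + p * q * r - B3 * p * p - B2 * q * q - B1 * r * r)"

text \<open>The monomials of the partial derivatives of \<open>k4_poly\<close>, all with coefficient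
  1. As pairs they serve both as quadratic forms and as second-order operators.\<close>

definition k4_pairs :: "nat \<Rightarrow> (nat \<times> nat) list" where
  "k4_pairs = (\<lambda>_. [])(a1 := [(a2, b1), (a2, b2), (a2, b3), (a3, b1), (a3, b2), (a3, b3), (b1, b2), (b1, b3)], a2 := [(a1, b1), (a1, b2), (a1, b3), (a3, b1), (a3, b2), (a3, b3), (b1, b2), (b2, b3)], a3 := [(a1, b1), (a1, b2), (a1, b3), (a2, b1), (a2, b2), (a2, b3), (b1, b3), (b2, b3)], b1 := [(a1, a2), (a1, a3), (a1, b2), (a1, b3), (a2, a3), (a2, b2), (a3, b3), (b2, b3)], b2 := [(a1, a2), (a1, a3), (a1, b1), (a2, a3), (a2, b1), (a2, b3), (a3, b3), (b1, b3)], b3 := [(a1, a2), (a1, a3), (a1, b1), (a2, a3), (a2, b2), (a3, b1), (a3, b2), (b1, b2)])"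

lemma neqs: "a1 \<noteq> a2" "a1 \<noteq> a3" "a2 \<noteq> a3" "b1 \<noteq> b2" "b1 \<noteq> b3" "b2 \<noteq> b3"
  "a1 \<noteq> b1" "a1 \<noteq> b2" "a1 \<noteq> b3" "a2 \<noteq> b1" "a2 \<noteq> b2" "a2 \<noteq> b3" "a3 \<noteq> b1" "a3 \<noteq> b2" "a3 \<noteq> b3"
  using dist by auto

lemmas neqs' = neqs neqs[symmetric]

abbreviation vars :: "nat set" where
  "vars \<equiv> {a1, a2, a3, b1, b2, b3}"

lemma pderiv_numeral: "pderiv_mpoly j (numeral n :: 'k::field_char_0 mpoly) = 0"
  using pderiv_mpoly_of_nat[of j "numeral n"] by simp

lemmas pd = pderiv_mpoly_add pderiv_mpoly_diff pderiv_mpoly_mult pderiv_mpoly_mvar pderiv_numeral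
  pderiv_mpoly_uminus

lemma pderiv_k4_poly:
  assumes "i \<in> vars"
  shows "pderiv_mpoly i (k4_poly :: 'k::field_char_0 mpoly) = (\<Sum>(a, b)\<leftarrow>k4_pairs i. mvar a * mvar b)"
  using assms unfolding k4_poly_def k4_pairs_def
  by (elim insertE emptyE; simp add: pd neqs' algebra_simps)

lemma euler_k4_poly:
  "of_nat 3 * (k4_poly :: 'k::field_char_0 mpoly) = (\<Sum>i\<in>vars. mvar i * (\<Sum>(a, b)\<leftarrow>k4_pairs i. mvar a * mvar b))"
  unfolding k4_poly_def k4_pairs_def by (simp add: neqs' algebra_simps)

lemma pderiv_k4_dual:
  defines "A1 \<equiv> mvar a1 :: 'k::field_char_0 mpoly" and "A2 \<equiv> mvar a2" and "A3 \<equiv> mvar a3"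
    and "B1 \<equiv> mvar b1" and "B2 \<equiv> mvar b2" and "B3 \<equiv> mvar b3"
  defines "p \<equiv> B1 + B2 - A3" and "q \<equiv> B1 + B3 - A2" and "r \<equiv> B2 + B3 - A1"
  shows "pderiv_mpoly a1 k4_dual = 2 * B1 * r - p * q"
    and "pderiv_mpoly a2 k4_dual = 2 * B2 * q - p * r"
    and "pderiv_mpoly a3 k4_dual = 2 * B3 * p - q * r"
    and "pderiv_mpoly b1 k4_dual = 4 * B2 * B3 + q * r + p * r - 2 * B3 * p - 2 * B2 * q - r * r"
    and "pderiv_mpoly b2 k4_dual = 4 * B1 * B3 + q * r + p * q - 2 * B3 * p - 2 * B1 * r - q * q"
    and "pderiv_mpoly b3 k4_dual = 4 * B1 * B2 + p * r + p * q - 2 * B2 * q - 2 * B1 * r - p * p"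
  unfolding k4_dual_def Let_def assms by (simp_all add: pd neqs' algebra_simps)

lemma quadratic_k4_dual:
  assumes "i \<in> vars"
  shows "(\<Sum>(a, b)\<leftarrow>k4_pairs i. pderiv_mpoly b (pderiv_mpoly a (k4_dual :: 'k::field_char_0 mpoly))) = 6 * mvar i"
  using assms unfolding k4_pairs_def
  by (elim insertE emptyE; simp add: pderiv_k4_dual; simp add: pd neqs' algebra_simps)

text \<open>This is adj(adj N) = det(N) N for the dual matrix N: the gradient of det N corresponds
  to adj N, and the derivatives of \<open>k4_poly\<close> are read off from the adjugate of M(A).
  With \<open>k4_dual\<close> equal to 4 det N, the left side is 16 det(N) times the
  coordinate.\<close>

lemma adjugate_k4_dual:
  assumes "i \<in> vars"
  shows "(\<Sum>(a, b)\<leftarrow>k4_pairs i. pderiv_mpoly a (k4_dual :: 'k::field_char_0 mpoly) * pderiv_mpoly b k4_dual) =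
    4 * (mvar i * k4_dual)"
  using assms unfolding k4_pairs_def
  by (elim insertE emptyE; simp only:; simp add: neqs' pderiv_k4_dual add.assoc[symmetric];
      simp only: k4_dual_def Let_def adjugate_identities)

lemma euler_k4_dual:
  "(\<Sum>i\<in>vars. mvar i * pderiv_mpoly i (k4_dual :: 'k::field_char_0 mpoly)) = 3 * k4_dual"
  by (simp add: neqs' pderiv_k4_dual) (simp add: k4_dual_def Let_def; algebra)

text \<open>The factor \<open>4 * s + 6\<close> collects 6 from the second derivatives of
  \<open>k4_dual\<close> and \<open>4 * s\<close> from the products of its first
  derivatives.\<close>

lemma capelli_k4_dual:
  assumes "i \<in> vars"
  shows "(\<Sum>(a, b)\<leftarrow>k4_pairs i. pderiv_mpoly b (pderiv_mpoly a (k4_dual ^ Suc s :: 'k::field_char_0 mpoly))) =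
    of_nat (Suc s * (4 * s + 6)) * (mvar i * k4_dual ^ s)"
proof (cases s)
  case 0
  then show ?thesis using quadratic_k4_dual[OF assms] by simp
next
  case (Suc m)
  show ?thesis
    unfolding quadratic_pderiv_power quadratic_k4_dual[OF assms] adjugate_k4_dual[OF assms]
    using Suc by (simp add: algebra_simps)
qed

text \<open>Euler's formula reduces the cubic operator to the quadratic ones. The last factor is (6
  + 3 s) / 3, from six variables and the degree 3 s. The product is 4 (s + 1)(s + 3/2)(s + 2): the
  Capelli factor of symmetric 3 x 3 matrices, times 4 because \<open>k4_dual\<close> is four times a
  determinant.\<close>

lemma apolar_k4_poly:
  "apolar (k4_poly * P) (k4_dual ^ Suc s :: 'k::field_char_0 mpoly) =
    of_nat (Suc s * (4 * s + 6) * (s + 2)) * apolar P (k4_dual ^ s)"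
proof -
  let ?g = "k4_dual :: 'k mpoly"
  have e: "(\<Sum>i\<in>vars. pderiv_mpoly i (mvar i * ?g ^ s)) = of_nat (6 + 3 * s) * ?g ^ s"
  proof -
    have "(\<Sum>i\<in>vars. pderiv_mpoly i (mvar i * ?g ^ s)) =
      (\<Sum>i\<in>vars. ?g ^ s) + of_nat s * ?g ^ (s - 1) * (\<Sum>i\<in>vars. mvar i * pderiv_mpoly i ?g)"
      by (simp only: sum_distrib_left sum.distrib[symmetric])
        (intro sum.cong, simp_all add: pderiv_mpoly_mult pderiv_mpoly_mvar pderiv_mpoly_power algebra_simps)
    also have "(\<Sum>i\<in>vars. ?g ^ s) = 6 * ?g ^ s" using neqs' by simp
    also have "of_nat s * ?g ^ (s - 1) * (\<Sum>i\<in>vars. mvar i * pderiv_mpoly i ?g) = of_nat (3 * s) * ?g ^ s"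
      unfolding euler_k4_dual by (cases s) (simp_all add: algebra_simps)
    finally show ?thesis by (simp add: algebra_simps)
  qed
  have "of_nat 3 * apolar (k4_poly * P) (?g ^ Suc s) = apolar (of_nat 3 * k4_poly * P) (?g ^ Suc s)"
    by (simp only: apolar_of_nat_left mult.assoc)
  also have "\<dots> = (\<Sum>i\<in>vars. apolar ((\<Sum>(a, b)\<leftarrow>k4_pairs i. mvar a * mvar b) * (mvar i * P)) (?g ^ Suc s))"
    unfolding euler_k4_poly sum_distrib_right
    by (subst (1 2) apolar_commute) (simp only: apolar_sum_right apolar_commute mult_ac)
  also have "\<dots> = (\<Sum>i\<in>vars. of_nat (Suc s * (4 * s + 6)) * apolar P (pderiv_mpoly i (mvar i * ?g ^ s)))"
    by (intro sum.cong refl) (simp only: apolar_quadratic capelli_k4_dual apolar_of_nat_right apolar_mvar_mult)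
  also have "\<dots> = of_nat (Suc s * (4 * s + 6)) * apolar P (\<Sum>i\<in>vars. pderiv_mpoly i (mvar i * ?g ^ s))"
    by (simp only: apolar_sum_right sum_distrib_left)
  also have "\<dots> = of_nat (Suc s * (4 * s + 6)) * (of_nat (6 + 3 * s) * apolar P (?g ^ s))"
    unfolding e apolar_of_nat_right ..
  also have "\<dots> = of_nat 3 * (of_nat (Suc s * (4 * s + 6) * (s + 2)) * apolar P (?g ^ s))"
    by (simp add: algebra_simps)
  finally show ?thesis by simp
qed

fun k4_const :: "nat \<Rightarrow> 'k::field_char_0" where
  "k4_const 0 = 1"
| "k4_const (Suc s) = k4_const s / of_nat (Suc s * (4 * s + 6) * (s + 2))"

lemma k4_const_Suc: "k4_const (Suc s) * of_nat (Suc s * (4 * s + 6) * (s + 2)) = (k4_const s :: 'k::field_char_0)"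
proof -
  have "of_nat (Suc s * (4 * s + 6) * (s + 2)) \<noteq> (0 :: 'k)" by (subst of_nat_eq_0_iff) simp
  then show ?thesis by simp
qed

text \<open>The pairing sees the degree 3 k - 6 part of P, which makes P dA / F^k of degree 0 in six
  variables. For \<open>k < 2\<close> the value 0 is forced, since multiples of
  \<open>k4_poly\<close> pair to 0 with 1.\<close>

definition k4_functional :: "nat \<Rightarrow> 'k mpoly \<Rightarrow> 'k::field_char_0" where
  "k4_functional k P = (if k < 2 then 0 else k4_const (k - 2) * apolar P (k4_dual ^ (k - 2)))"

lemma apolar_k4_poly_1: "apolar (k4_poly * P) (1 :: 'k::field_char_0 mpoly) = 0"
  unfolding k4_poly_def by (simp add: distrib_right apolar_add mult.assoc apolar_mvar_mult)

lemma period_functional_k4: "period_functional k4_functional vars (k4_poly :: 'k::field_char_0 mpoly)"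
proof -
  have A: "k4_functional (Suc k) (k4_poly * P) = (k4_functional k P :: 'k)" for k P
  proof (cases "k < 2")
    case True
    then have "k = 0 \<or> k = 1" by auto
    then show ?thesis by (auto simp: k4_functional_def apolar_k4_poly_1)
  next
    case False
    then obtain s where s: "k = s + 2" by (metis add.commute le_Suc_ex not_less)
    have "k4_const (Suc s) * apolar (k4_poly * P) (k4_dual ^ Suc s) = (k4_const s * apolar P (k4_dual ^ s) :: 'k)"
      unfolding apolar_k4_poly mult.assoc[symmetric] k4_const_Suc ..
    then show ?thesis by (simp add: s k4_functional_def del: k4_const.simps power_Suc)
  qed
  have B: "k4_functional (Suc k) (of_nat k * P * pderiv_mpoly i k4_poly) = (k4_functional k (pderiv_mpoly i P) :: 'k)"
    if i: "i \<in> vars" for i k P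
  proof (cases "k < 2")
    case True
    then have "k = 0 \<or> k = 1" by auto
    moreover have "apolar (P * (\<Sum>(a, b)\<leftarrow>k4_pairs i. mvar a * mvar b)) 1 = (0 :: 'k)"
    proof -
      have "(\<Sum>(a, b)\<leftarrow>ps. pderiv_mpoly b (pderiv_mpoly a 1)) = (0 :: 'k mpoly)" for ps
        by (induction ps) auto
      then show ?thesis by (simp add: mult.commute[of P] apolar_quadratic)
    qed
    ultimately show ?thesis by (auto simp: k4_functional_def pderiv_k4_poly[OF i])
  next
    case False
    then obtain s where s: "k = s + 2" by (metis add.commute le_Suc_ex not_less)
    have eq: "of_nat k * P * pderiv_mpoly i k4_poly = of_nat k * ((\<Sum>(a, b)\<leftarrow>k4_pairs i. mvar a * mvar b) * P)"
      by (simp only: pderiv_k4_poly[OF i] mult_ac)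
    \<comment> \<open>Here \<open>k = s + 2\<close> supplies the last Capelli factor, so one
      normalisation serves both conditions on the functional.\<close>
    have *: "apolar (of_nat k * P * pderiv_mpoly i k4_poly) (k4_dual ^ Suc s) =
      (of_nat (Suc s * (4 * s + 6) * (s + 2)) * apolar (pderiv_mpoly i P) (k4_dual ^ s) :: 'k)"
      unfolding eq apolar_of_nat_left apolar_quadratic capelli_k4_dual[OF i] apolar_of_nat_right
        apolar_pderiv by (simp add: s algebra_simps)
    have "k4_const (Suc s) * apolar (of_nat k * P * pderiv_mpoly i k4_poly) (k4_dual ^ Suc s) =
      (k4_const s * apolar (pderiv_mpoly i P) (k4_dual ^ s) :: 'k)"
      unfolding * mult.assoc[symmetric] k4_const_Suc ..
    then show ?thesis by (simp add: s k4_functional_def del: k4_const.simps power_Suc)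
  qed
  have add: "k4_functional k (P + Q) = k4_functional k P + (k4_functional k Q :: 'k)" for k P Q
    by (simp add: k4_functional_def apolar_add algebra_simps)
  have diff: "k4_functional k (P - Q) = k4_functional k P - (k4_functional k Q :: 'k)" for k P Q
    by (simp add: k4_functional_def apolar_diff algebra_simps)
  show ?thesis unfolding period_functional_def using A B by (simp add: add diff)
qed

lemma k4_functional_2_1: "k4_functional 2 1 = 1"
  by (simp add: k4_functional_def apolar_1_1)

end

section \<open>Lifting nonzero periods along a star-triangle move\<close>

definition has_period :: "nat set \<Rightarrow> 'k::field mpoly \<Rightarrow> bool" where
  "has_period E F \<longleftrightarrow> (\<exists>l. period_functional l E F \<and> l 2 1 \<noteq> 0)"

context star_triangle
begin

lemma laurent_subst_tree_poly:
  assumes "E \<inter> {x, y, t, s, e} = {}"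
  shows "laurent_subst (star_triangle_subst x y t s e) (tree_poly V E ends :: 'k::field mpoly) =
    lconst (tree_poly V E ends)"
proof -
  have "laurent_subst (star_triangle_subst x y t s e) (\<Prod>i\<in>E - T. mvar i :: 'k mpoly) =
    lconst (\<Prod>i\<in>E - T. mvar i)" for T
    unfolding laurent_subst_prod lconst_prod laurent_subst_mvar
    using assms by (intro prod.cong) (auto simp: star_triangle_subst_def Let_def)
  then show ?thesis by (simp add: tree_poly_def laurent_subst_sum lconst_sum)
qed

text \<open>Divided by Y, the coefficient of each partition of the terminals is that of the star in
  the new variables. For the discrete partition this uses (x + y) x y t / Y + x y t^2 / Y = x y
  t.\<close>

lemma laurent_subst_triangle:
  fixes ends :: "nat \<Rightarrow> 'v set"
  assumes inc: "incident W H ends"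
    and W: "h \<in> W" "p' \<in> W" "q' \<in> W" "p \<notin> W" "q \<notin> W" "p \<noteq> q" "h \<noteq> p'" "h \<noteq> q'" "p' \<noteq> q'"
    and H: "H \<inter> {x, y, t, s, e} = {}"
    and ends: "ends t = {p, q}" "ends x = {p, h}" "ends y = {q, h}" "ends e = {p, p'}" "ends s = {q, q'}"
  shows "laurent_subst (star_triangle_subst x y t s e)
      (tree_poly (insert p (insert q W)) (insert t (insert x (insert y (insert e (insert s H))))) ends) =
    lmono 1 0 * lconst (tree_poly (insert p W) (insert x (insert e (insert s H))) (ends(s := {p, q'})) :: 'k::field mpoly)"
proof -
  let ?ends = "ends(s := {p, q'})"
  have same: "\<And>i. i \<in> H \<Longrightarrow> ?ends i = ends i" using H by auto
  then have inc': "incident W H ?ends" using inc unfolding incident_def by simp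
  have Z: "label_poly W H ?ends f = label_poly W H ends f" for f
    unfolding label_poly_def using same by (intro tree_poly_cong) auto
  have \<sigma>Z: "laurent_subst (star_triangle_subst x y t s e) (label_poly W H ends f) = lconst (label_poly W H ends f)" for f
    unfolding label_poly_def by (rule laurent_subst_tree_poly[OF H])
  have T: "tree_poly (insert p (insert q W)) (insert t (insert x (insert y (insert e (insert s H))))) ends =
    (mvar x + mvar y + mvar t) * label_poly W H ends (id(p' := h, q' := h)) +
    ((mvar x + mvar y + mvar t) * mvar s + mvar y * mvar t) * label_poly W H ends (id(p' := h)) +
    ((mvar x + mvar y + mvar t) * mvar e + mvar x * mvar t) * label_poly W H ends (id(q' := h)) +
    mvar x * mvar y * label_poly W H ends (id(q' := p')) +
    (mvar x * mvar y * (mvar e + mvar s + mvar t) + (mvar x + mvar y + mvar t) * mvar e * mvar s +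
      mvar e * mvar y * mvar t + mvar s * mvar x * mvar t) * (label_poly W H ends id :: 'k mpoly)"
    using H ne by (intro tree_poly_triangle[OF inc W(1-6)] W ends) auto
  have S: "tree_poly (insert p W) (insert x (insert e (insert s H))) ?ends =
    label_poly W H ends (id(p' := h, q' := h)) + mvar s * label_poly W H ends (id(p' := h)) +
    mvar e * label_poly W H ends (id(q' := h)) + mvar x * label_poly W H ends (id(q' := p')) +
    (mvar x * mvar e + mvar x * mvar s + mvar e * mvar s) * (label_poly W H ends id :: 'k mpoly)"
    unfolding Z[symmetric] using H ne ends by (intro tree_poly_star[OF inc' W(1-4)] W) auto
  define u v w z A B C where "u = (lmono 1 0 :: 'k laurent)" and "v = (lmono (- 1) 0 :: 'k laurent)"
    and "w = (lmono 0 1 :: 'k laurent)" and "z = (lmono 0 (- 1) :: 'k laurent)"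
    and "A = (lconst (mvar x) :: 'k laurent)" and "B = (lconst (mvar s) :: 'k laurent)"
    and "C = (lconst (mvar e) :: 'k laurent)"
  have uv: "u * v = 1" "w * z = 1"
    using lmono_inverse[where 'k = 'k] by (simp_all add: u_def v_def w_def z_def)
  have uv': "u * (v * f) = f" "w * (z * f) = f" for f
    using uv by (simp_all flip: mult.assoc)
  have \<sigma>: "(star_triangle_subst x y t s e :: nat \<Rightarrow> 'k laurent) = (let T = u - w - u * z * A
    in (\<lambda>i. lconst (mvar i))(x := u * z * A, y := w, t := T, s := B - w * v * T, e := C - z * A * T))"
    by (simp only: star_triangle_subst_def Let_def u_def v_def w_def z_def A_def B_def C_def)
  define Z0 Z1 Z2 Z3 Z4 where "Z0 = (lconst (label_poly W H ends id) :: 'k laurent)"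
    and "Z1 = (lconst (label_poly W H ends (id(p' := h, q' := h))) :: 'k laurent)"
    and "Z2 = (lconst (label_poly W H ends (id(p' := h))) :: 'k laurent)"
    and "Z3 = (lconst (label_poly W H ends (id(q' := h))) :: 'k laurent)"
    and "Z4 = (lconst (label_poly W H ends (id(q' := p'))) :: 'k laurent)"
  have v: "star_triangle_subst x y t s e x = u * z * A" "star_triangle_subst x y t s e y = w"
    "star_triangle_subst x y t s e t = u - w - u * z * A"
    "star_triangle_subst x y t s e s = B - w * v * (u - w - u * z * A)"
    "star_triangle_subst x y t s e e = C - z * A * (u - w - u * z * A)"
    using ne by (simp_all add: \<sigma> Let_def)
  show ?thesis
    unfolding T S laurent_subst_add laurent_subst_mult laurent_subst_mvar \<sigma>Z lconst_add lconst_mult v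
      Z0_def[symmetric] Z1_def[symmetric] Z2_def[symmetric] Z3_def[symmetric] Z4_def[symmetric]
      A_def[symmetric] B_def[symmetric] C_def[symmetric] u_def[symmetric]
    by (simp add: algebra_simps uv uv')
qed

text \<open>The first conclusion is iterated along the reduction; the second serves the move that
  ends at the full graph. There A_y becomes X, whose coefficient at exponent (0, 1) is 1.\<close>

lemma has_period_move:
  fixes F F' :: "'k::field mpoly"
  assumes "has_period V F" "{x, s, e} \<subseteq> V" "V' \<subseteq> insert y (insert t V)"
    and "laurent_subst (star_triangle_subst x y t s e) F' = lmono 1 0 * lconst F"
  shows "has_period V' F'"
    and "\<exists>l. period_functional l (V' - {y}) F' \<and> l 2 (mvar y) \<noteq> 0"
proof -
  let ?\<sigma> = "laurent_subst (star_triangle_subst x y t s e) :: 'k mpoly \<Rightarrow> 'k laurent"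
  obtain l where l: "period_functional l V F" "l 2 1 \<noteq> 0" using assms(1) by (auto simp: has_period_def)
  have "Poly_Mapping.lookup (?\<sigma> 1) (int 2 - 2, 0) = 1"
    by (simp add: lookup_one flip: zero_prod_def)
  then show "has_period V' F'"
    unfolding has_period_def
    using period_functional_transfer[OF l(1) assms(2-4), of 0] l(2)
    by (intro exI[of _ "\<lambda>k P. l k (Poly_Mapping.lookup (?\<sigma> P) (int k - 2, 0))"]) auto
  have "Poly_Mapping.lookup (?\<sigma> (mvar y)) (int 2 - 2, 1) = 1"
    using ne by (simp add: star_triangle_subst_def Let_def)
  moreover have "V' - {y} \<subseteq> insert y (insert t V)" using assms(3) by blast
  ultimately show "\<exists>l. period_functional l (V' - {y}) F' \<and> l 2 (mvar y) \<noteq> 0"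
    using period_functional_transfer[OF l(1) assms(2) _ assms(4), of "V' - {y}" 1] l(2)
    by (intro exI[of _ "\<lambda>k P. l k (Poly_Mapping.lookup (?\<sigma> P) (int k - 2, 1))"]) auto
qed

end

section \<open>The graph polynomial of K4 by deletion and contraction\<close>

lemma label_poly_empty: "label_poly V {} ends f = (if card (f ` V) = 1 then 1 else 0)"
proof -
  let ?S = "{T. T \<subseteq> {} \<and> (\<forall>x\<in>f ` V. \<forall>y\<in>f ` V. gconn (\<lambda>e. f ` ends e) T x y) \<and> card T + 1 = card (f ` V)}"
  have "?S = {{}}" if c: "card (f ` V) = 1"
  proof -
    obtain a where "f ` V = {a}" using c by (rule card_1_singletonE)
    then show ?thesis by auto
  qed
  moreover have "?S = {}" if "card (f ` V) \<noteq> 1" using that by auto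
  ultimately show ?thesis unfolding label_poly_def tree_poly_def
    by (cases "card (f ` V) = 1") (simp_all only: if_True if_False simp_thms sum.empty, simp_all)
qed

lemma tree_poly_k4:
  assumes D: "distinct [h, p', q', p]" "distinct [x, e, s, b1, b2, b3]"
    and ends: "ends x = {p, h}" "ends e = {p, p'}" "ends s = {p, q'}"
      "ends b1 = {p', q'}" "ends b2 = {h, q'}" "ends b3 = {h, p'}"
  shows "tree_poly (insert p {h, p', q'}) (insert x (insert e (insert s {b1, b2, b3}))) ends =
    k4.k4_poly x e s b1 b2 b3"
proof -
  let ?W = "{h, p', q'}"
  have inc: "incident ?W {b1, b2, b3} ends"
    using ends unfolding incident_def by auto
  have L1: "label_poly ?W {b1, b2, b3} ends f = mvar b1 * label_poly ?W {b2, b3} ends f +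
    (if f p' = f q' then 0 else label_poly ?W {b2, b3} ends (\<lambda>v. if f v = f q' then f p' else f v))" for f
    using D by (intro label_poly_insert[OF inc] ends) auto
  have L2: "label_poly ?W {b2, b3} ends f = mvar b2 * label_poly ?W {b3} ends f +
    (if f h = f q' then 0 else label_poly ?W {b3} ends (\<lambda>v. if f v = f q' then f h else f v))" for f
    using D by (intro label_poly_insert ends incident_subset[OF inc]) auto
  have L3: "label_poly ?W {b3} ends f = mvar b3 * label_poly ?W {} ends f +
    (if f h = f p' then 0 else label_poly ?W {} ends (\<lambda>v. if f v = f p' then f h else f v))" for f
    using D by (intro label_poly_insert ends incident_subset[OF inc]) auto
  have ne: "h \<noteq> p'" "h \<noteq> q'" "p' \<noteq> q'" using D by auto
  note ne' = ne ne[symmetric]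
  have Z1: "label_poly ?W {b1, b2, b3} ends (id(p' := h, q' := h)) = mvar b1 * mvar b2 * mvar b3"
    using ne' by (simp add: L1 L2 L3 label_poly_empty card_insert_if)
  have Z2: "label_poly ?W {b1, b2, b3} ends (id(p' := h)) = mvar b3 * mvar b1 + mvar b3 * mvar b2"
    using ne' by (simp add: L1 L2 L3 label_poly_empty card_insert_if algebra_simps)
  have Z3: "label_poly ?W {b1, b2, b3} ends (id(q' := h)) = mvar b2 * mvar b1 + mvar b2 * mvar b3"
    using ne' by (simp add: L1 L2 L3 label_poly_empty card_insert_if algebra_simps)
  have Z4: "label_poly ?W {b1, b2, b3} ends (id(q' := p')) = mvar b1 * mvar b2 + mvar b1 * mvar b3"
    using ne' by (simp add: L1 L2 L3 label_poly_empty card_insert_if algebra_simps)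
  have Z0: "label_poly ?W {b1, b2, b3} ends id = mvar b1 + mvar b2 + mvar b3"
    using ne' by (simp add: L1 L2 L3 label_poly_empty card_insert_if algebra_simps)
  have "k4 x e s b1 b2 b3" using D by unfold_locales
  then show ?thesis
    using D ends
    by (subst tree_poly_star[OF inc, where h = h and p' = p' and q' = q'])
      (auto simp: Z0 Z1 Z2 Z3 Z4 k4.k4_poly_def algebra_simps)
qed

section \<open>Reduction of the zigzag graphs\<close>

definition rim :: "nat \<Rightarrow> nat \<Rightarrow> gzz_vertex" where
  "rim n j = (if j = 0 then UVert 1 else if j < n then VVert 1 j else UVert 3)"

text \<open>
  After \<open>k\<close> star-triangle moves the vertices \<open>v\<^sub>1\<^sub>,\<^sub>1, \<dots>, v\<^sub>1\<^sub>,\<^sub>k\<close> are gone and \<open>u\<^sub>1\<close> is joined to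
  \<open>v\<^sub>1\<^sub>,\<^sub>k\<^sub>+\<^sub>1\<close>; the remaining edges keep their numbers.
\<close>

definition red_verts :: "nat \<Rightarrow> nat \<Rightarrow> gzz_vertex set" where
  "red_verts n k = {UVert 1, UVert 2, UVert 3, UVert 4, VVert 2 1} \<union> VVert 1 ` {k + 1..<n}"

definition red_edges :: "nat \<Rightarrow> nat \<Rightarrow> nat set" where
  "red_edges n k = {1, 2, 3} \<union> {k + 4..n + 3} \<union> {n + 4 + k..2 * n + 2} \<union> {2 * n + 3..2 * n + 6}"

definition red_ends :: "nat \<Rightarrow> nat \<Rightarrow> nat \<Rightarrow> gzz_vertex set" where
  "red_ends n k i = (if i = 1 then {UVert 1, UVert 2} else if i = 2 then {UVert 2, UVert 3}
     else if i = 3 then {UVert 3, UVert 4} else if i = k + 4 then {UVert 1, rim n (k + 1)}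
     else if i \<le> n + 3 then {rim n (i - 4), rim n (i - 3)}
     else if i \<le> 2 * n + 2 then {VVert 1 (i - n - 3), UVert 2}
     else if i = 2 * n + 3 then {UVert 2, VVert 2 1} else if i = 2 * n + 4 then {VVert 2 1, UVert 4}
     else if i = 2 * n + 5 then {VVert 2 1, UVert 3} else {UVert 1, UVert 4})"

lemma length_path_edges: "length (path_edges xs) = length xs - 1"
  by (simp add: path_edges_def)

lemma nth_path_edges: "Suc i < length xs \<Longrightarrow> path_edges xs ! i = {xs ! i, xs ! Suc i}"
  by (simp add: path_edges_def nth_tl)

lemma gzz2_ends:
  assumes n: "n \<ge> 1" and i: "i \<in> {1..2 * n + 6}"
  shows "mends (gzz2 n) i = red_ends n 0 i"
proof -
  let ?xs = "[UVert 1] @ map (VVert 1) [1..<n] @ [UVert 3]"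
  have xs: "?xs ! j = rim n j" if "j \<le> n" for j
    using that n by (auto simp: rim_def nth_append nth_Cons' split: if_splits)
  have len: "length (path_edges ?xs) = n" using n by (simp add: length_path_edges)
  have P: "path_edges ?xs ! j = {rim n j, rim n (Suc j)}" if "j < n" for j
    using nth_path_edges[of j ?xs] xs[of j] xs[of "Suc j"] that n by simp
  have Q: "path_edges [UVert 2, VVert 2 1, UVert 4] = [{UVert 2, VVert 2 1}, {VVert 2 1, UVert 4}]"
    by (simp add: path_edges_def)
  define L M where "L = path_edges ?xs" and "M = map (\<lambda>j. {VVert 1 j, UVert 2}) [1..<n]"
  define R where "R = [{UVert 2, VVert 2 1}, {VVert 2 1, UVert 4}, {VVert 2 1, UVert 3}, {UVert 1, UVert 4}]"
  have lens: "length L = n" "length M = n - 1" using len by (simp_all add: L_def M_def)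
  have E: "gzz2_edges n = [{UVert 1, UVert 2}, {UVert 2, UVert 3}, {UVert 3, UVert 4}] @ L @ M @ R"
    unfolding gzz2_edges_def Q L_def M_def R_def by simp
  have E3: "gzz2_edges n ! (3 + j) = (L @ M @ R) ! j" for j
    unfolding E by (simp add: numeral_eq_Suc)
  have m: "mends (gzz2 n) i = gzz2_edges n ! (i - 1)" by (simp add: gzz2_def)
  consider "i = 1" | "i = 2" | "i = 3" | "4 \<le> i" "i < n + 4" | "n + 4 \<le> i" "i < 2 * n + 3" | "2 * n + 3 \<le> i"
    using i by fastforce
  then show ?thesis
  proof cases
    case 1
    then show ?thesis unfolding m E by (simp add: red_ends_def)
  next
    case 2
    then show ?thesis unfolding m E by (simp add: red_ends_def)
  next
    case 3
    then show ?thesis unfolding m E by (simp add: red_ends_def)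
  next
    case 4
    then obtain j where j: "i = 4 + j" "j < n" by (metis add.commute add_less_cancel_right le_Suc_ex)
    have "gzz2_edges n ! (i - 1) = {rim n j, rim n (Suc j)}"
      using E3[of j] P[of j, folded L_def] j by (simp add: nth_append lens)
    then show ?thesis unfolding m using j by (simp add: red_ends_def rim_def)
  next
    case 5
    then obtain j where j: "i = n + 4 + j" by (metis le_Suc_ex)
    with 5 have j': "j < n - 1" "j + 2 \<le> n" by simp_all
    have "gzz2_edges n ! (i - 1) = {VVert 1 (Suc j), UVert 2}"
      using E3[of "n + j"] j j' by (simp add: nth_append lens) (simp add: M_def)
    then show ?thesis unfolding m using j j' by (auto simp: red_ends_def)
  next
    case 6
    then obtain j where j: "i = 2 * n + 3 + j" by (metis le_Suc_ex)
    with i have j': "j < 4" by simp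
    have "i - 1 = 3 + (n + (n - 1 + j))" using n j by simp
    then have "gzz2_edges n ! (i - 1) = R ! j"
      using E3[of "n + (n - 1 + j)"] by (simp add: nth_append lens)
    moreover from j' have "j = 0 \<or> j = 1 \<or> j = 2 \<or> j = 3" by linarith
    ultimately show ?thesis unfolding m using j n
      by (elim disjE) (simp_all add: red_ends_def R_def)
  qed
qed

lemma incident_red:
  assumes "n \<ge> 1" "k < n"
  shows "incident (red_verts n k) (red_edges n k) (red_ends n k)"
proof -
  have r: "rim n j \<in> red_verts n k" if "j = 0 \<or> k < j" for j
    using that by (auto simp: rim_def red_verts_def)
  have "\<exists>c\<in>red_verts n k. \<exists>d\<in>red_verts n k. red_ends n k i = {c, d}" if i: "i \<in> red_edges n k" for i
  proof -
    have u: "UVert 1 \<in> red_verts n k" "UVert 2 \<in> red_verts n k" "UVert 3 \<in> red_verts n k"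
      "UVert 4 \<in> red_verts n k" "VVert 2 1 \<in> red_verts n k" by (simp_all add: red_verts_def)
    have pr: "\<exists>c\<in>red_verts n k. \<exists>d\<in>red_verts n k. {a, b} = {c, d}"
      if "a \<in> red_verts n k" "b \<in> red_verts n k" for a b using that by blast
    consider "i = 1 \<or> i = 2 \<or> i = 3" | "i = k + 4" | "k + 4 < i" "i \<le> n + 3" | "n + 4 + k \<le> i" "i \<le> 2 * n + 2" | "2 * n + 3 \<le> i"
      using i by (cases "i = k + 4") (auto simp: red_edges_def)
    then show ?thesis
    proof cases
      case 1
      then show ?thesis by (elim disjE) (simp_all only: red_ends_def if_True if_False simp_thms pr u, simp_all add: pr u)
    next
      case 2
      then have "red_ends n k i = {UVert 1, rim n (k + 1)}" by (simp add: red_ends_def)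
      moreover have "rim n (k + 1) \<in> red_verts n k" by (rule r) simp
      ultimately show ?thesis using u by (simp only: pr)
    next
      case 3
      then have "red_ends n k i = {rim n (i - 4), rim n (i - 3)}" by (simp add: red_ends_def)
      moreover have "rim n (i - 4) \<in> red_verts n k" "rim n (i - 3) \<in> red_verts n k" using 3 by (auto intro!: r)
      ultimately show ?thesis by (simp only: pr)
    next
      case 4
      then have "red_ends n k i = {VVert 1 (i - n - 3), UVert 2}" by (simp add: red_ends_def)
      moreover have "VVert 1 (i - n - 3) \<in> red_verts n k"
        unfolding red_verts_def by (intro UnI2 imageI) (use 4 in auto)
      ultimately show ?thesis using u by (simp only: pr)
    next
      case 5
      then have "red_ends n k i \<in> {{UVert 2, VVert 2 1}, {VVert 2 1, UVert 4}, {VVert 2 1, UVert 3}, {UVert 1, UVert 4}}"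
        using assms by (simp add: red_ends_def)
      then show ?thesis unfolding insert_iff empty_iff using u by (elim disjE) (simp_all only: pr)
    qed
  qed
  moreover have "finite (red_verts n k)" "finite (red_edges n k)" by (simp_all add: red_verts_def red_edges_def)
  ultimately show ?thesis by (simp only: incident_def) blast
qed

abbreviation red_poly :: "nat \<Rightarrow> nat \<Rightarrow> 'k::field mpoly" where
  "red_poly n k \<equiv> tree_poly (red_verts n k) (red_edges n k) (red_ends n k)"

lemma graph_poly_gzz2:
  assumes "n \<ge> 1"
  shows "graph_poly (gzz2 n) = red_poly n 0"
proof -
  have V: "mverts (gzz2 n) = red_verts n 0"
  proof -
    have "{1..4} = {1, 2, 3, 4 :: nat}" by auto
    moreover have "{1..n - 1} = {1..<n}" using assms by auto
    ultimately show ?thesis by (auto simp: gzz2_def red_verts_def)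
  qed
  have E: "medges (gzz2 n) = red_edges n 0"
    using assms by (auto simp: gzz2_def red_edges_def)
  have E': "red_edges n 0 = {1..2 * n + 6}"
    using assms by (auto simp: red_edges_def)
  have inc: "incident (mverts (gzz2 n)) (medges (gzz2 n)) (mends (gzz2 n))"
    using incident_red[of n 0] gzz2_ends[OF assms] assms unfolding V E unfolding E' incident_def
    by simp
  show ?thesis unfolding graph_poly_eq_tree_poly[OF inc] unfolding V E
    using gzz2_ends[OF assms] unfolding E' by (rule tree_poly_cong)
qed

text \<open>The move merges v_(1,k+1) into u_1. Both have degree 3 and lie on a triangle with u_2;
  the outer edges lead to the next vertex of the path and to u_4.\<close>

lemma red_move:
  assumes k: "k + 1 < n"
  shows "star_triangle 1 (n + 4 + k) (k + 4) (k + 5) (2 * n + 6)"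
    and "laurent_subst (star_triangle_subst 1 (n + 4 + k) (k + 4) (k + 5) (2 * n + 6)) (red_poly n k) =
      lmono 1 0 * lconst (red_poly n (k + 1) :: 'k::field mpoly)"
proof -
  show st: "star_triangle 1 (n + 4 + k) (k + 4) (k + 5) (2 * n + 6)"
    using k by unfold_locales auto
  define W where "W = {UVert 2, UVert 3, UVert 4, VVert 2 1} \<union> VVert 1 ` {k + 2..<n}"
  define H where "H = {2, 3} \<union> {k + 6..n + 3} \<union> {n + 5 + k..2 * n + 2} \<union> {2 * n + 3..2 * n + 5}"
  let ?q = "VVert 1 (k + 1)" and ?q' = "rim n (k + 2)" and ?p = "UVert 1"
  have V: "red_verts n k = insert ?p (insert ?q W)"
    using k by (auto simp: red_verts_def W_def)
  have V': "red_verts n (k + 1) = insert ?p W"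
    by (auto simp: red_verts_def W_def)
  have E: "red_edges n k = insert (k + 4) (insert 1 (insert (n + 4 + k) (insert (2 * n + 6) (insert (k + 5) H))))"
    using k by (auto simp: red_edges_def H_def)
  have E': "red_edges n (k + 1) = insert 1 (insert (2 * n + 6) (insert (k + 5) H))"
    using k by (auto simp: red_edges_def H_def)
  have ends': "red_ends n (k + 1) i = ((red_ends n k)(k + 5 := {?p, ?q'})) i" if "i \<in> red_edges n (k + 1)" for i
    using that k by (auto simp: red_ends_def red_edges_def numeral_eq_Suc)
  have inc: "incident W H (red_ends n k)"
  proof -
    have "\<exists>c\<in>W. \<exists>d\<in>W. red_ends n k i = {c, d}" if i: "i \<in> H" for i
    proof -
      have "i \<in> red_edges n k" using i E by auto
      then obtain c d where cd: "c \<in> red_verts n k" "d \<in> red_verts n k" "red_ends n k i = {c, d}"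
        using incident_red[of n k] k unfolding incident_def by fastforce
      moreover have "?p \<notin> red_ends n k i" "?q \<notin> red_ends n k i"
        using i k by (auto simp: H_def red_ends_def rim_def)
      ultimately show ?thesis unfolding V by auto
    qed
    then show ?thesis by (auto simp: incident_def W_def H_def)
  qed
  have q': "?q' \<in> W" "?q' \<noteq> UVert 2" "?q' \<noteq> UVert 4" using k by (auto simp: rim_def W_def)
  have "laurent_subst (star_triangle_subst 1 (n + 4 + k) (k + 4) (k + 5) (2 * n + 6)) (red_poly n k) =
      lmono 1 0 * lconst (tree_poly (insert ?p W) (insert 1 (insert (2 * n + 6) (insert (k + 5) H)))
        ((red_ends n k)(k + 5 := {?p, ?q'})) :: 'k mpoly)"
    unfolding V E
  proof (rule star_triangle.laurent_subst_triangle[OF st inc, of "UVert 2" "UVert 4" ?q' ?p ?q])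
    show "H \<inter> {1, n + 4 + k, k + 4, k + 5, 2 * n + 6} = {}" using k by (auto simp: H_def)
    show "red_ends n k (k + 5) = {?q, ?q'}" using k by (simp add: red_ends_def rim_def)
  qed (use q' k in \<open>auto simp: W_def red_ends_def rim_def\<close>)
  also have "tree_poly (insert ?p W) (insert 1 (insert (2 * n + 6) (insert (k + 5) H)))
        ((red_ends n k)(k + 5 := {?p, ?q'})) = (red_poly n (k + 1) :: 'k mpoly)"
    unfolding V'[symmetric] E'[symmetric] using ends' by (intro tree_poly_cong) simp
  finally show "laurent_subst (star_triangle_subst 1 (n + 4 + k) (k + 4) (k + 5) (2 * n + 6)) (red_poly n k) =
      lmono 1 0 * lconst (red_poly n (k + 1) :: 'k mpoly)" .
qed

lemma red_edges_Suc:
  assumes "k + 1 < n"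
  shows "{1, k + 5, 2 * n + 6} \<subseteq> red_edges n (k + 1)"
    "red_edges n k \<subseteq> insert (n + 4 + k) (insert (k + 4) (red_edges n (k + 1)))"
  using assms by (auto simp: red_edges_def)

text \<open>With all v_(1,j) gone, u_3 is the hub of a wheel with rim u_1, u_2, v_(2,1), u_4. The
  move merges u_2 into u_1 along their triangle with the hub and leaves K4, seen as the star at u_1
  over the triangle u_3, u_4, v_(2,1).\<close>

lemma has_period_wheel:
  assumes "n \<ge> 1"
  shows "has_period (red_edges n (n - 1)) (red_poly n (n - 1) :: 'k::field_char_0 mpoly)"
proof -
  let ?p = "UVert 1" and ?q = "UVert 2" and ?W = "{UVert 3, UVert 4, VVert 2 1}"
  let ?H = "{2 * n + 4, 2 * n + 5, 3}" and ?ends = "red_ends n (n - 1)"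
  have st: "star_triangle (n + 3) 2 1 (2 * n + 3) (2 * n + 6)" using assms by unfold_locales auto
  have k4: "k4 (n + 3) (2 * n + 6) (2 * n + 3) (2 * n + 4) (2 * n + 5) 3" using assms by unfold_locales auto
  have V: "red_verts n (n - 1) = insert ?p (insert ?q ?W)" using assms by (auto simp: red_verts_def)
  have E: "red_edges n (n - 1) = insert 1 (insert (n + 3) (insert 2 (insert (2 * n + 6) (insert (2 * n + 3) ?H))))"
    using assms by (auto simp: red_edges_def)
  have r: "rim n n = UVert 3" using assms by (simp add: rim_def)
  have e: "?ends (n + 3) = {?p, UVert 3}" "?ends 1 = {?p, ?q}" "?ends 2 = {?q, UVert 3}"
    "?ends (2 * n + 6) = {?p, UVert 4}" "?ends (2 * n + 3) = {?q, VVert 2 1}" "?ends 3 = {UVert 3, UVert 4}"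
    "?ends (2 * n + 4) = {UVert 4, VVert 2 1}" "?ends (2 * n + 5) = {UVert 3, VVert 2 1}"
    using assms r by (auto simp: red_ends_def)
  have inc: "incident ?W ?H ?ends" using e by (auto simp: incident_def)
  have "laurent_subst (star_triangle_subst (n + 3) 2 1 (2 * n + 3) (2 * n + 6)) (red_poly n (n - 1)) =
    lmono 1 0 * lconst (tree_poly (insert ?p ?W) (insert (n + 3) (insert (2 * n + 6) (insert (2 * n + 3) ?H)))
      (?ends(2 * n + 3 := {?p, VVert 2 1})) :: 'k mpoly)"
    unfolding V E
  proof (rule star_triangle.laurent_subst_triangle[OF st inc, of "UVert 3" "UVert 4" "VVert 2 1" ?p ?q])
    show "?H \<inter> {n + 3, 2, 1, 2 * n + 3, 2 * n + 6} = {}" using assms by auto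
  qed (use e in simp_all)
  also have "tree_poly (insert ?p ?W) (insert (n + 3) (insert (2 * n + 6) (insert (2 * n + 3) ?H)))
      (?ends(2 * n + 3 := {?p, VVert 2 1})) = (k4.k4_poly (n + 3) (2 * n + 6) (2 * n + 3) (2 * n + 4) (2 * n + 5) 3 :: 'k mpoly)"
    using assms e by (intro tree_poly_k4) auto
  finally have *: "laurent_subst (star_triangle_subst (n + 3) 2 1 (2 * n + 3) (2 * n + 6)) (red_poly n (n - 1)) =
    lmono 1 0 * lconst (k4.k4_poly (n + 3) (2 * n + 6) (2 * n + 3) (2 * n + 4) (2 * n + 5) 3 :: 'k mpoly)" .
  have "has_period {n + 3, 2 * n + 6, 2 * n + 3, 2 * n + 4, 2 * n + 5, 3}
    (k4.k4_poly (n + 3) (2 * n + 6) (2 * n + 3) (2 * n + 4) (2 * n + 5) 3 :: 'k mpoly)"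
    unfolding has_period_def using k4.period_functional_k4[OF k4] k4.k4_functional_2_1[OF k4]
    by (metis zero_neq_one)
  then show ?thesis
    by (rule star_triangle.has_period_move(1)[OF st _ _ _ *]) (simp_all only: E, auto)
qed

lemma has_period_red:
  assumes "n \<ge> 1" "k \<le> n - 1"
  shows "has_period (red_edges n k) (red_poly n k :: 'k::field_char_0 mpoly)"
  using assms(2)
proof (induction k rule: inc_induct)
  case base
  show ?case by (rule has_period_wheel[OF assms(1)])
next
  case (step k)
  then have k: "k + 1 < n" by simp
  show ?case
    using star_triangle.has_period_move(1)[OF red_move(1)[OF k] _ red_edges_Suc[OF k] red_move(2)[OF k]] step.IH
    by simp
qed

theorem gzz2_period:
  assumes "n \<ge> 2"
  shows "\<exists>l. period_functional l ({1..2 * n + 6} - {n + 4}) (graph_poly (gzz2 n) :: 'k::field_char_0 mpoly) \<and>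
    l 2 (mvar (n + 4)) \<noteq> 0"
proof -
  \<comment> \<open>The move at \<open>k = 0\<close> ends at the full graph; its \<open>y\<close> is
    the edge \<open>n + 4\<close>, from v_(1,1) to u_2.\<close>
  have k: "0 + 1 < n" using assms by simp
  have "has_period (red_edges n (0 + 1)) (red_poly n (0 + 1) :: 'k mpoly)"
    using assms by (intro has_period_red) auto
  note * = star_triangle.has_period_move(2)[OF red_move(1)[OF k] this red_edges_Suc[OF k] red_move(2)[OF k]]
  have E: "red_edges n 0 = {1..2 * n + 6}" using assms by (auto simp: red_edges_def)
  have "n \<ge> 1" using assms by simp
  then show ?thesis using * unfolding graph_poly_gzz2[OF \<open>n \<ge> 1\<close>] E by simp
qed

lemma card_red_verts: "n \<ge> 1 \<Longrightarrow> card (red_verts n 0) = n + 4"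
proof -
  assume "n \<ge> 1"
  have "card (red_verts n 0) = card {UVert 1, UVert 2, UVert 3, UVert 4, VVert 2 1} + card (VVert 1 ` {0 + 1..<n})"
    unfolding red_verts_def by (rule card_Un_disjoint) auto
  also have "card (VVert 1 ` {0 + 1..<n}) = n - 1" by (subst card_image) (auto simp: inj_on_def)
  finally show ?thesis using \<open>n \<ge> 1\<close> by simp
qed

section \<open>Homogeneous polynomials and rational functions\<close>

lemma homogeneous_iff:
  "homogeneous N d P \<longleftrightarrow> (\<forall>m\<in>Poly_Mapping.keys P. Poly_Mapping.keys m \<subseteq> {1..N} \<and>
     (\<Sum>i\<in>{1..N}. Poly_Mapping.lookup m i) = d)"
proof -
  have "(\<Sum>i\<in>Poly_Mapping.keys m. Poly_Mapping.lookup m i) = (\<Sum>i\<in>{1..N}. Poly_Mapping.lookup m i)"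
    if "Poly_Mapping.keys m \<subseteq> {1..N}" for m :: "nat \<Rightarrow>\<^sub>0 nat"
    using that by (intro sum.mono_neutral_left) (auto simp: in_keys_iff)
  then show ?thesis unfolding homogeneous_def by metis
qed

lemma homogeneous_0: "homogeneous N d 0"
  by (simp add: homogeneous_def)

lemma homogeneous_1: "homogeneous N 0 1"
  by (auto simp: homogeneous_iff in_keys_iff lookup_one when_def split: if_splits)

lemma homogeneous_mvar: "i \<in> {1..N} \<Longrightarrow> homogeneous N 1 (mvar i)"
  by (auto simp: homogeneous_def mvar_def)

lemma homogeneous_sign_mvar: "i \<in> {1..N} \<Longrightarrow> homogeneous N 1 ((- 1) ^ c * mvar i)"
  by (cases "even c") (simp_all add: homogeneous_def mvar_def)

lemma homogeneous_add: "homogeneous N d P \<Longrightarrow> homogeneous N d Q \<Longrightarrow> homogeneous N d (P + Q)"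
  unfolding homogeneous_def using Poly_Mapping.keys_add[of P Q] by blast

lemma homogeneous_sum: "(\<And>x. x \<in> S \<Longrightarrow> homogeneous N d (f x)) \<Longrightarrow> homogeneous N d (sum f S)"
  by (induction S rule: infinite_finite_induct) (auto simp: homogeneous_0 homogeneous_add)

lemma homogeneous_mult:
  assumes "homogeneous N d P" "homogeneous N d' Q"
  shows "homogeneous N (d + d') (P * Q)"
  unfolding homogeneous_iff
proof
  fix m assume "m \<in> Poly_Mapping.keys (P * Q)"
  then obtain a b where ab: "a \<in> Poly_Mapping.keys P" "b \<in> Poly_Mapping.keys Q" "m = a + b"
    using keys_mult[of P Q] by blast
  then have "Poly_Mapping.keys m \<subseteq> {1..N}"
    using assms Poly_Mapping.keys_add[of a b] unfolding homogeneous_iff by blast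
  moreover have "(\<Sum>i\<in>{1..N}. Poly_Mapping.lookup m i) = d + d'"
    using assms ab unfolding homogeneous_iff by (simp add: lookup_add sum.distrib)
  ultimately show "Poly_Mapping.keys m \<subseteq> {1..N} \<and> (\<Sum>i\<in>{1..N}. Poly_Mapping.lookup m i) = d + d'" ..
qed

lemma homogeneous_prod_mvar:
  assumes "finite S" "S \<subseteq> {1..N}"
  shows "homogeneous N (card S) (\<Prod>i\<in>S. mvar i)"
  using assms
proof (induction S rule: finite_induct)
  case (insert i S)
  then show ?case using homogeneous_mult[OF homogeneous_mvar[of i N], of "card S" "\<Prod>i\<in>S. mvar i"] by simp
qed (simp add: homogeneous_1)

lemma euler_homogeneous:
  assumes "homogeneous N d P"
  shows "(\<Sum>i\<in>{1..N}. mvar i * pderiv_mpoly i P) = of_nat d * P"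
proof -
  have s: "mvar i * pderiv_mpoly i (Poly_Mapping.single m c) = of_nat (Poly_Mapping.lookup m i) * Poly_Mapping.single m c"
    for i m and c :: 'a
  proof (cases "Poly_Mapping.lookup m i = 0")
    case False
    then have "Poly_Mapping.single i 1 + (m - Poly_Mapping.single i 1) = m"
      by (intro poly_mapping_eqI) (auto simp: lookup_add lookup_minus lookup_single when_def)
    then have "mvar i * pderiv_mpoly i (Poly_Mapping.single m c) =
        Poly_Mapping.single m (of_nat (Poly_Mapping.lookup m i) * c)"
      by (simp add: mvar_def pderiv_mpoly_single mult_single)
    also have "\<dots> = mconst (of_nat (Poly_Mapping.lookup m i)) * Poly_Mapping.single m c"
      by (simp only: mult_single add_0_left)
    finally show ?thesis by simp
  qed (simp add: pderiv_mpoly_single)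
  let ?s = "\<lambda>m. Poly_Mapping.single m (Poly_Mapping.lookup P m)"
  have P: "P = (\<Sum>m\<in>Poly_Mapping.keys P. ?s m)" by (rule mpoly_eq_sum_single)
  have "(\<Sum>i\<in>{1..N}. mvar i * pderiv_mpoly i (\<Sum>m\<in>Poly_Mapping.keys P. ?s m)) =
    (\<Sum>m\<in>Poly_Mapping.keys P. \<Sum>i\<in>{1..N}. of_nat (Poly_Mapping.lookup m i) * ?s m)"
    unfolding pderiv_mpoly_sum sum_distrib_left s by (rule sum.swap)
  also have "\<dots> = (\<Sum>m\<in>Poly_Mapping.keys P. of_nat d * ?s m)"
  proof (intro sum.cong refl)
    fix m assume "m \<in> Poly_Mapping.keys P"
    then have "(\<Sum>i\<in>{1..N}. Poly_Mapping.lookup m i) = d" using assms by (simp add: homogeneous_iff)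
    then show "(\<Sum>i\<in>{1..N}. of_nat (Poly_Mapping.lookup m i) * ?s m) = of_nat d * ?s m"
      by (metis of_nat_sum sum_distrib_right)
  qed
  finally show ?thesis using P by (simp flip: sum_distrib_left)
qed

lemma pderiv_homogeneous_0:
  assumes "homogeneous N d P" "j \<notin> {1..N}"
  shows "pderiv_mpoly j P = 0"
  unfolding pderiv_mpoly_def
proof (rule sum.neutral, rule)
  fix m assume "m \<in> Poly_Mapping.keys P"
  then have "Poly_Mapping.lookup m j = 0" using assms unfolding homogeneous_iff by (metis in_keys_iff subsetD)
  then show "Poly_Mapping.single (m - Poly_Mapping.single j 1)
    (of_nat (Poly_Mapping.lookup m j) * Poly_Mapping.lookup P m) = 0" by simp
qed

lemma homogeneous_gzz2:
  assumes "n \<ge> 1"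
  shows "homogeneous (2 * n + 6) (n + 3) (graph_poly (gzz2 n))"
  unfolding graph_poly_gzz2[OF assms] tree_poly_def
proof (rule homogeneous_sum)
  have E: "red_edges n 0 = {1..2 * n + 6}" using assms by (auto simp: red_edges_def)
  fix T assume T: "T \<in> {T. T \<subseteq> red_edges n 0 \<and> (\<forall>x\<in>red_verts n 0. \<forall>y\<in>red_verts n 0. gconn (red_ends n 0) T x y) \<and>
    card T + 1 = card (red_verts n 0)}"
  then have "card T = n + 3" using card_red_verts[OF assms] by simp
  moreover have "finite T" using T E finite_subset[of T "{1..2 * n + 6}"] by auto
  ultimately have "card (red_edges n 0 - T) = n + 3" using T E by (simp add: card_Diff_subset)
  then show "homogeneous (2 * n + 6) (n + 3) (\<Prod>e\<in>red_edges n 0 - T. mvar e)"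
    using homogeneous_prod_mvar[of "red_edges n 0 - T" "2 * n + 6"] E by auto
qed

section \<open>Fractions over powers of F and their derivatives\<close>

lemma Fract_add_same:
  fixes d :: "'a::idom"
  assumes "d \<noteq> 0"
  shows "Fraction_Field.Fract a d + Fraction_Field.Fract b d = Fraction_Field.Fract (a + b) d"
  using assms by (simp add: eq_fract distrib_right)

lemma Fract_sum:
  fixes d :: "'a::idom"
  assumes "d \<noteq> 0"
  shows "(\<Sum>x\<in>S. Fraction_Field.Fract (f x) d) = Fraction_Field.Fract (\<Sum>x\<in>S. f x) d"
proof (induction S rule: infinite_finite_induct)
  case (insert x S)
  show ?case by (simp only: sum.insert[OF insert.hyps] insert.IH Fract_add_same[OF assms])
qed (simp_all add: fract_collapse)

lemma Fract_minus_one_power: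
  "(- 1) ^ c * Fraction_Field.Fract a (d :: 'a::idom) = Fraction_Field.Fract ((- 1) ^ c * a) d"
  by (cases "even c") simp_all

text \<open>Over the denominator \<open>F ^ Suc k\<close> the quotient rule has exactly the
  numerator on which a \<open>period_functional\<close> vanishes.\<close>

lemma pderiv_rat_Fract_power:
  fixes F :: "'k::field mpoly"
  assumes "F \<noteq> 0"
  shows "pderiv_rat j (Fraction_Field.Fract P (F ^ k)) =
    Fraction_Field.Fract (F * pderiv_mpoly j P - of_nat k * P * pderiv_mpoly j F) (F ^ Suc k)"
proof -
  have nz: "F ^ m \<noteq> 0" for m using assms by simp
  have "pderiv_rat j (Fraction_Field.Fract P (F ^ k)) = Fraction_Field.Fract
    (pderiv_mpoly j P * F ^ k - P * pderiv_mpoly j (F ^ k)) (F ^ k * F ^ k)"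
    by (rule pderiv_rat_Fract[OF nz])
  also have "\<dots> = Fraction_Field.Fract (F * pderiv_mpoly j P - of_nat k * P * pderiv_mpoly j F) (F ^ Suc k)"
  proof (cases k)
    case 0
    then show ?thesis using assms by (simp add: eq_fract algebra_simps)
  next
    case (Suc m)
    have "F ^ k * F ^ k \<noteq> 0" using assms by simp
    moreover have "pderiv_mpoly j (F ^ k) = of_nat k * F ^ m * pderiv_mpoly j F"
      by (simp only: pderiv_mpoly_power Suc diff_Suc_1)
    ultimately show ?thesis
      by (subst eq_fract(1)[OF _ nz]) (simp_all only:, simp_all add: Suc algebra_simps)
  qed
  finally show ?thesis .
qed

lemma period_functional_exact:
  fixes F :: "'k::field mpoly"
  assumes l: "period_functional l V F" and F: "F \<noteq> 0" and J: "finite J" "J \<subseteq> V"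
    and eq: "Fraction_Field.Fract A (F ^ 2) =
      (\<Sum>j\<in>J. (- 1) ^ c j * pderiv_rat j (Fraction_Field.Fract (P j) (F ^ k j)))"
  shows "l 2 A = 0"
proof -
  \<comment> \<open>A bound for every \<open>Suc (k j)\<close>: all terms can be written over
    \<open>F ^ (2 + m)\<close>, and \<open>l\<close> is applied to the equation of
    numerators.\<close>
  define m where "m = (\<Sum>j\<in>J. Suc (k j))"
  let ?Q = "\<lambda>j. F * pderiv_mpoly j (P j) - of_nat (k j) * P j * pderiv_mpoly j F"
  have le: "Suc (k j) \<le> m" if "j \<in> J" for j
    unfolding m_def using member_le_sum[of j J "\<lambda>j. Suc (k j)"] that J(1) by simp
  have ext: "Fraction_Field.Fract X (F ^ a) = Fraction_Field.Fract (F ^ (2 + m - a) * X) (F ^ (2 + m))" if "a \<le> 2 + m" for X a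
  proof -
    have "F ^ (2 + m) = F ^ (2 + m - a) * F ^ a" using that by (simp flip: power_add)
    then show ?thesis using F by (simp add: eq_fract)
  qed
  have "Fraction_Field.Fract (F ^ m * A) (F ^ (2 + m)) = Fraction_Field.Fract A (F ^ 2)"
    using ext[of 2 A] by simp
  also have "\<dots> = (\<Sum>j\<in>J. Fraction_Field.Fract (F ^ (2 + m - Suc (k j)) * ((- 1) ^ c j * ?Q j)) (F ^ (2 + m)))"
    unfolding eq
  proof (rule sum.cong[OF refl])
    fix j assume "j \<in> J"
    then show "(- 1) ^ c j * pderiv_rat j (Fraction_Field.Fract (P j) (F ^ k j)) =
      Fraction_Field.Fract (F ^ (2 + m - Suc (k j)) * ((- 1) ^ c j * ?Q j)) (F ^ (2 + m))"
      unfolding pderiv_rat_Fract_power[OF F] Fract_minus_one_power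
      by (intro ext) (use le in force)
  qed
  also have "\<dots> = Fraction_Field.Fract (\<Sum>j\<in>J. F ^ (2 + m - Suc (k j)) * ((- 1) ^ c j * ?Q j)) (F ^ (2 + m))"
    using F by (intro Fract_sum) simp
  finally have "F ^ m * A = (\<Sum>j\<in>J. F ^ (2 + m - Suc (k j)) * ((- 1) ^ c j * ?Q j))"
    using F by (simp add: eq_fract)
  then have "l (2 + m) (F ^ m * A) = (\<Sum>j\<in>J. l (2 + m) (F ^ (2 + m - Suc (k j)) * ((- 1) ^ c j * ?Q j)))"
    by (simp only: period_sum[OF l])
  also have "\<dots> = 0"
  proof (rule sum.neutral, rule)
    fix j assume j: "j \<in> J"
    have neg: "l i (- X) = - l i X" for i X
      using period_add[OF l, of i X "- X"] by (simp add: period_0[OF l] eq_neg_iff_add_eq_0 add.commute)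
    have "l (2 + m) (F ^ (2 + m - Suc (k j)) * X) = l (Suc (k j)) X" for X
      using period_mult_power[OF l, of "Suc (k j)" "2 + m - Suc (k j)" X] le[OF j] by simp
    moreover have "l (Suc (k j)) ((- 1) ^ c j * ?Q j) = 0"
    proof -
      have "l (Suc (k j)) (?Q j) = 0" using period_deriv[OF l] J j by blast
      moreover have "(- 1) ^ c j * ?Q j = ?Q j \<or> (- 1) ^ c j * ?Q j = - ?Q j"
        by (cases "even (c j)") simp_all
      ultimately show ?thesis by (elim disjE) (simp_all only: neg minus_zero)
    qed
    ultimately show "l (2 + m) (F ^ (2 + m - Suc (k j)) * ((- 1) ^ c j * ?Q j)) = 0" by simp
  qed
  finally show ?thesis using period_mult_power[OF l, of 2 m A] by simp
qed

lemma pderiv_rat_0 [simp]: "pderiv_rat j 0 = 0"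
  using pderiv_rat_Fract[of 1 j 0] by (simp add: fract_collapse)

section \<open>The form \<open>\<Omega> / F\<^sup>2\<close>\<close>

text \<open>\<open>N = 2 * d\<close> balances degrees: A_i / F^2 has degree 1 - 2 d = -(N - 1), as
  required of a coefficient of an (N - 1)-form.\<close>

locale double_pole_form =
  fixes N d :: nat and F :: "'k::field mpoly" and \<eta> :: "'k dform"
  assumes F: "homogeneous N d F" "F \<noteq> 0" and N: "N = 2 * d" "d > 0"
    and \<eta>: "\<eta> = (\<lambda>I. proj_volume N I / Fraction_Field.Fract (F ^ 2) 1)"
begin

lemma F2: "F ^ 2 \<noteq> 0" "F * F \<noteq> 0"
  using F by simp_all

lemma eta_omit:
  assumes "i \<in> {1..N}"
  shows "\<eta> ({1..N} - {i}) = Fraction_Field.Fract ((- 1) ^ i * mvar i) (F ^ 2)"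
proof -
  have "proj_volume N ({1..N} - {i}) = (\<Sum>j\<in>{1..N}. if j = i then (- 1) ^ i * Fraction_Field.Fract (mvar i) 1 else 0 :: 'k ratfun)"
    unfolding proj_volume_def
  proof (intro sum.cong refl)
    fix j assume "j \<in> {1..N}"
    then have "{1..N} - {i} = {1..N} - {j} \<longleftrightarrow> j = i" using assms by blast
    then show "(if {1..N} - {i} = {1..N} - {j} then (- 1) ^ j * Fraction_Field.Fract (mvar j) 1 else 0) =
      (if j = i then (- 1) ^ i * Fraction_Field.Fract (mvar i) 1 else 0 :: 'k ratfun)" by simp
  qed
  also have "\<dots> = Fraction_Field.Fract ((- 1) ^ i * mvar i) 1"
    using assms by (simp add: Fract_minus_one_power)
  finally show ?thesis unfolding \<eta> by simp
qed

lemma eta_zero: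
  assumes "\<And>i. i \<in> {1..N} \<Longrightarrow> I \<noteq> {1..N} - {i}"
  shows "\<eta> I = 0"
  unfolding \<eta> proj_volume_def using assms by (simp add: sum.neutral)

lemma eta_compl_forms: "\<eta> \<in> compl_forms N F (N - 1)"
  unfolding compl_forms_def
proof (intro CollectI conjI allI impI)
  fix I assume I: "I \<subseteq> {1..N} \<and> card I = N - 1"
  have "card ({1..N} - I) = 1" using I N card_Diff_subset[of I "{1..N}"] finite_subset[of I "{1..N}"] by simp
  then obtain i where i: "{1..N} - I = {i}" by (rule card_1_singletonE)
  then have *: "I = {1..N} - {i}" "i \<in> {1..N}" using I by auto
  have "homogeneous N 1 ((- 1) ^ i * mvar i :: 'k mpoly)"
    by (rule homogeneous_sign_mvar[OF *(2)])
  then show "\<eta> I \<in> localization_part N F (- int (N - 1))"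
    unfolding localization_part_def *(1) eta_omit[OF *(2)] using F(1) N
    by (intro CollectI exI[of _ "(- 1) ^ i * mvar i"] exI[of _ 2] exI[of _ 1] exI[of _ d]) auto
next
  fix I assume I: "\<not> (I \<subseteq> {1..N} \<and> card I = N - 1)"
  show "\<eta> I = 0"
  proof (rule eta_zero)
    fix i assume "i \<in> {1..N}"
    then show "I \<noteq> {1..N} - {i}" using I by auto
  qed
next
  show "euler_contract N \<eta> = (\<lambda>_. 0)"
  proof
    fix I
    show "euler_contract N \<eta> I = 0"
    proof (cases "\<exists>i j. i \<in> {1..N} \<and> j \<in> {1..N} \<and> i < j \<and> I = {1..N} - {i, j}")
      case True
      then obtain i j where ij: "i \<in> {1..N}" "j \<in> {1..N}" "i < j" "I = {1..N} - {i, j}" by blast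
      have c: "{1..N} - I = {i, j}" "insert j I = {1..N} - {i}" "insert i I = {1..N} - {j}"
        using ij by auto
      \<comment> \<open>Since \<open>i\<close> is missing, only \<open>j - 2\<close> indices lie
        below \<open>j\<close>; this shift gives the two terms opposite signs.\<close>
      have "{x \<in> I. x < j} = {1..<j} - {i}" "{x \<in> I. x < i} = {1..<i}" using ij by auto
      then have n: "card {x \<in> I. x < j} = j - 2" "card {x \<in> I. x < i} = i - 1" using ij by auto
      have "euler_contract N \<eta> I =
        (- 1) ^ (i - 1) * Fraction_Field.Fract (mvar i) 1 * \<eta> ({1..N} - {j}) +
        (- 1) ^ (j - 2) * Fraction_Field.Fract (mvar j) 1 * \<eta> ({1..N} - {i})"
        unfolding euler_contract_def c(1) using ij(3) by (simp add: c n)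
      also have "\<dots> = 0"
      proof -
        obtain i' where i': "i = Suc i'" using ij by (cases i) auto
        obtain j' where j': "j = Suc (Suc j')" using ij i' by (metis less_imp_Suc_add add_Suc_right Suc_less_eq2)
        show ?thesis unfolding eta_omit[OF ij(1)] eta_omit[OF ij(2)] Fract_minus_one_power
          by (simp add: i' j' Fract_add_same F(2) F2 algebra_simps fract_collapse)
      qed
      finally show ?thesis .
    next
      case False
      have "\<eta> (insert j I) = 0" if j: "j \<in> {1..N} - I" for j
      proof (rule eta_zero, rule notI)
        fix i assume i: "i \<in> {1..N}" "insert j I = {1..N} - {i}"
        have ne: "i \<noteq> j" using i(2) by blast
        have "I = {1..N} - {i, j}" using i(2) j by blast
        moreover from this have "I = {1..N} - {j, i}" by (simp only: insert_commute)
        ultimately show False using False i(1) j ne by (cases "i < j") (blast, metis DiffD1 linorder_neqE_nat)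
      qed
      then show ?thesis by (simp add: euler_contract_def)
    qed
  qed
qed

lemma ext_deriv_eta: "ext_deriv \<eta> = (\<lambda>_. 0)"
proof
  fix J
  show "ext_deriv \<eta> J = 0"
  proof (cases "J = {1..N}")
    case True
    have "(- 1) ^ card {i \<in> J. i < j} * pderiv_rat j (\<eta> (J - {j})) =
      Fraction_Field.Fract (2 * mvar j * pderiv_mpoly j F - F) (F ^ 3)" if j: "j \<in> J" for j
    proof -
      have "{i \<in> J. i < j} = {1..<j}" using j True by auto
      then have c: "card {i \<in> J. i < j} = j - 1" by simp
      obtain j' where j': "j = Suc j'" using j True by (cases j) auto
      have p: "pderiv_mpoly j ((- 1) ^ j * mvar j) = ((- 1) ^ j :: 'k mpoly)"
        by (cases "even j") (simp_all add: pderiv_mpoly_uminus pderiv_mpoly_mvar)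
      have "pderiv_rat j (\<eta> (J - {j})) =
        Fraction_Field.Fract (F * (- 1) ^ j - of_nat 2 * ((- 1) ^ j * mvar j) * pderiv_mpoly j F) (F ^ Suc 2)"
        using j unfolding True by (simp only: eta_omit pderiv_rat_Fract_power[OF F(2)] p)
      then show ?thesis unfolding c
        by (simp add: Fract_minus_one_power j' algebra_simps eval_nat_numeral)
    qed
    then have "ext_deriv \<eta> J = Fraction_Field.Fract (\<Sum>j\<in>{1..N}. 2 * mvar j * pderiv_mpoly j F - F) (F ^ 3)"
      unfolding ext_deriv_def using F(2) True by (simp add: Fract_sum)
    also have "(\<Sum>j\<in>{1..N}. 2 * mvar j * pderiv_mpoly j F - F) =
      2 * (\<Sum>j\<in>{1..N}. mvar j * pderiv_mpoly j F) - of_nat N * F"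
      by (simp add: sum_subtractf sum_distrib_left mult.assoc)
    also have "\<dots> = 0" unfolding euler_homogeneous[OF F(1)] by (simp add: N(1) algebra_simps)
    finally show ?thesis by (simp add: fract_collapse)
  next
    case False
    \<comment> \<open>\<open>ext_deriv\<close> is also evaluated at sets with an index
      \<open>j\<close> outside \<open>{1..N}\<close>; neither \<open>F\<close> nor the numerators
      contain that variable.\<close>
    have "pderiv_rat j (\<eta> (J - {j})) = 0" if j: "j \<in> J" for j
    proof (cases "\<exists>i\<in>{1..N}. J - {j} = {1..N} - {i}")
      case True
      then obtain i where i: "i \<in> {1..N}" "J - {j} = {1..N} - {i}" by blast
      have jN: "j \<notin> {1..N}"
      proof
        assume "j \<in> {1..N}"
        then have "j = i" using i(2) by blast
        then have "J = {1..N}" using i j by blast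
        then show False using False by simp
      qed
      have "homogeneous N 1 ((- 1) ^ i * mvar i :: 'k mpoly)"
        by (rule homogeneous_sign_mvar[OF i(1)])
      then have "pderiv_mpoly j ((- 1) ^ i * mvar i) = (0 :: 'k mpoly)" using jN by (rule pderiv_homogeneous_0)
      then show ?thesis unfolding i(2) eta_omit[OF i(1)] pderiv_rat_Fract_power[OF F(2)]
        using pderiv_homogeneous_0[OF F(1) jN] by (simp add: fract_collapse)
    next
      case False
      then have "\<eta> (J - {j}) = 0" by (intro eta_zero) blast
      then show ?thesis by simp
    qed
    then show ?thesis by (simp add: ext_deriv_def)
  qed
qed

lemma eta_closed: "\<eta> \<in> closed_forms N F (N - 1)"
  using eta_compl_forms ext_deriv_eta by (simp add: closed_forms_def)

text \<open>The component of an exact form at \<open>{1..N} - {y}\<close> contains only derivatives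
  in the indices of that set, and the functional kills all of them.\<close>

lemma eta_not_exact:
  assumes l: "period_functional l ({1..N} - {y}) F" "l 2 (mvar y) \<noteq> 0" and y: "y \<in> {1..N}"
  shows "\<eta> \<notin> exact_forms N F (N - 1)"
proof
  assume ex: "\<eta> \<in> exact_forms N F (N - 1)"
  obtain q where q: "N - 1 = Suc q" using N by (cases d) auto
  with ex obtain \<xi> where \<xi>: "\<xi> \<in> compl_forms N F q" "\<eta> = ext_deriv \<xi>" by (auto simp: exact_forms_def)
  let ?J = "{1..N} - {y}"
  have "\<exists>P k. \<xi> (?J - {j}) = Fraction_Field.Fract P (F ^ k)" if "j \<in> ?J" for j
  proof -
    have "?J - {j} \<subseteq> {1..N}" "card (?J - {j}) = q" using that y q by auto
    then have "\<xi> (?J - {j}) \<in> localization_part N F (- int q)" using \<xi>(1) by (simp add: compl_forms_def)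
    then show ?thesis by (auto simp: localization_part_def)
  qed
  then obtain P k where P: "\<And>j. j \<in> ?J \<Longrightarrow> \<xi> (?J - {j}) = Fraction_Field.Fract (P j) (F ^ k j)" by metis
  have "Fraction_Field.Fract ((- 1) ^ y * mvar y) (F ^ 2) = ext_deriv \<xi> ?J"
    using eta_omit[OF y] \<xi>(2) by simp
  also have "\<dots> = (\<Sum>j\<in>?J. (- 1) ^ card {i \<in> ?J. i < j} * pderiv_rat j (Fraction_Field.Fract (P j) (F ^ k j)))"
    unfolding ext_deriv_def by (intro sum.cong refl) (simp only: P)
  finally have "l 2 ((- 1) ^ y * mvar y) = 0"
    by (rule period_functional_exact[OF l(1) F(2), rotated 2]) auto
  moreover have "l 2 (- mvar y) = - l 2 (mvar y)"
    using period_add[OF l(1), of 2 "mvar y" "- mvar y"] period_0[OF l(1)] by (simp add: eq_neg_iff_add_eq_0 add.commute)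
  ultimately show False using l(2) by (cases "even y") simp_all
qed

lemma zero_exact: "(\<lambda>_. 0) \<in> exact_forms N F (N - 1)"
proof -
  obtain q where q: "N - 1 = Suc q" using N by (cases d) auto
  have "(\<lambda>_. 0) \<in> compl_forms N F q"
  proof -
    have "0 \<in> localization_part N F (- int q)"
    proof -
      \<comment> \<open>The zero form still needs a numerator degree that gives total degree
        \<open>- q\<close>; the natural subtraction is exact because \<open>d > 0\<close>.\<close>
      have "int (q * d - q) - int q * int d = - int q" using N by (cases d) (simp_all add: algebra_simps)
      then show ?thesis unfolding localization_part_def using F(1)
        by (intro CollectI exI[of _ 0] exI[of _ q] exI[of _ "q * d - q"] exI[of _ d])
          (simp add: homogeneous_0 fract_collapse)
    qed
    then show ?thesis by (simp add: compl_forms_def euler_contract_def)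
  qed
  moreover have "ext_deriv (\<lambda>_. 0) = (\<lambda>_. 0 :: 'k ratfun)" by (simp add: ext_deriv_def)
  ultimately show ?thesis unfolding exact_forms_def q nat.case by (metis imageI)
qed

lemma deRham_class_eta:
  assumes "\<eta> \<notin> exact_forms N F (N - 1)"
  shows "deRham_class N F (N - 1) \<eta> \<noteq> deRham_class N F (N - 1) (\<lambda>_. 0)"
proof -
  have "\<eta> \<in> deRham_class N F (N - 1) \<eta>" using eta_closed zero_exact by (simp add: deRham_class_def)
  moreover have "\<eta> \<notin> deRham_class N F (N - 1) (\<lambda>_. 0)" using assms by (simp add: deRham_class_def)
  ultimately show ?thesis by blast
qed

end

theorem theorem2p3p4:
  fixes n :: nat
    and \<Psi> :: "'k::{alg_closed_field, field_char_0} mpoly"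
    and \<eta> :: "'k dform"
  assumes "n \<ge> 2"
    and "\<Psi> = graph_poly (gzz2 n)"
    and "\<eta> = (\<lambda>I. proj_volume (2 * n + 6) I / Fraction_Field.Fract (\<Psi> ^ 2) 1)"
  shows "\<eta> \<in> closed_forms (2 * n + 6) \<Psi> (2 * n + 5) \<and>
    deRham_class (2 * n + 6) \<Psi> (2 * n + 5) \<eta> \<noteq> deRham_class (2 * n + 6) \<Psi> (2 * n + 5) (\<lambda>_. 0)"
proof -
  obtain l where l: "period_functional l ({1..2 * n + 6} - {n + 4}) \<Psi>" "l 2 (mvar (n + 4)) \<noteq> 0"
    using gzz2_period[OF assms(1)] assms(2) by blast
  \<comment> \<open>If \<open>\<Psi>\<close> were 0, the nonzero value of \<open>l 2\<close> at the
    variable would equal \<open>l 3 0\<close>, which is 0.\<close>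
  have "\<Psi> \<noteq> 0"
    using l period_mult[OF l(1), of 2 "mvar (n + 4)"] period_0[OF l(1)] by auto
  moreover have "homogeneous (2 * n + 6) (n + 3) \<Psi>"
    unfolding assms(2) using assms(1) by (intro homogeneous_gzz2) simp
  ultimately interpret double_pole_form "2 * n + 6" "n + 3" \<Psi> \<eta>
    using assms(3) by unfold_locales simp_all
  have N1: "2 * n + 6 - 1 = 2 * n + 5" and y: "n + 4 \<in> {1..2 * n + 6}" by simp_all
  show ?thesis
    using eta_closed deRham_class_eta[OF eta_not_exact[OF l y]] unfolding N1 ..
qed

end
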